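(* In the setting described in the context, suppose that $0\in\rho(A_0^* )$, i.e. $(A_0^* )^{-1}$ is well defined and bounded on $H$, and that $$\lambda-\omega>\Vert (A_0^* )^{-1}\Vert_{L(H)}\,\Vert B\Vert^2_{L(U,V')}\,[(h_0^* )']\,[g_0'].$$ Then there exists a unique $\bar x\in D(A)$ such that $$A\bar x+B(h_0^* )'(-B^*\Psi'(\bar x))=0.$$
   Context: Spaces. $H$ and $U$ are real Hilbert spaces. $A_0:D(A_0)\subset H\to H$ generates a strongly continuous semigroup $\{e^{tA_0}\}_{t\ge0}$ on $H$, with adjoint $A_0^*$. $V:=D(A_0^* )$ is the Hilbert space with scalar product $(v|w)_V=(v|w)_H+(A_0^*v|A_0^*w)_H$. $V'$ is its dual, not identified with $V$, with $V\subset H\equiv H'\subset V'$, and $\langle\cdot,\cdot\rangle$ is the duality pairing of $V$ and $V'$. The semigroup is extended to a strongly continuous semigroup $\{e^{tA}\}_{t\ge0}$ on $V'$, whose generator $A:D(A)\subset V'\to V'$ is a proper extension of $A_0$. Notation. For a map $f:X\to Y$ between Banach spaces, $[f]:=\sup_{x\ne y}|f(x)-f(y)|_Y/|x-y|_X$. For $r\ge 0$, $\mathcal B_r(X)$ is the set of $f:X\to\mathbb R$ with $\sup_x |f(x)|/(1+|x|_X^r)<\infty$. $\Sigma_0(X)$ is the set of convex functions $w\in\mathcal B_2(X)$ that are $C^1$ (Fréchet) with $[w']<\infty$. The derivative of a real function on $V'$ is regarded as a $V$-valued map, and that of a function on $U$ as a $U$-valued map. $h_0^*$ is the convex conjugate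 of $h_0$. $B^*:V\to U$ is the adjoint of $B$. Assumptions. $\lambda\in\mathbb R$ and: (1) $A$ generates the strongly continuous semigroup $\{e^{tA}\}_{t\ge 0}$ on $V'$; (2) $B\in L(U,V')$; (3) there is $\omega\ge0$ with $|e^{tA}x|_{V'}\le e^{\omega t}|x|_{V'}$ for all $t\ge0$, $x\in V'$ (the $\omega$ of the statement); (4) $g_0\in\Sigma_0(V')$; (5) $h_0:U\to\mathbb R\cup\{+\infty\}$ is convex, lower semicontinuous, and $\partial h_0$ is injective; (6) $h_0^*(0)=0$ and $h_0^*\in\Sigma_0(U)$; (7) there are $a>0$, $b\in\mathbb R$, $p\ge2$ with $h_0(u)\ge a|u|_U^p+b$ for all $u\in U$; (8) either (8.a) $p>2$ and $\lambda>2\omega$, or (8.b) $\lambda>\omega$ and $g_0\in\mathcal B_1(V')$. Value function. For $x\in V'$ and $u\in L^p_\lambda(0,+\infty;U)=\{u:[0,+\infty)\to U:\ \tau\mapsto u(\tau)e^{-\lambda\tau/p}\in L^p(0,+\infty;U)\}$, let $y(\tau)=e^{\tau A}x+\int_0^\tau e^{(\tau-\sigma)A}Bu(\sigma)\,d\sigma$ and $$\Psi(x)=\inf_{u\in L^p_\lambda(0,+\infty;U)}\int_0^{+\infty}e^{-\lambda\tau}[g_0(y(\tau))+h_0(u(\tau))]\,d\tau .$$ Under these assumptions $\Psi\in\Sigma_0(V')$ (known), and $\Psi'$ is its Fréchet derivative. *)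

theory Defs
  imports "HOL-Analysis.Analysis"
begin

section \<open>Strongly continuous semigroups and unbounded operators\<close>

text \<open>An unbounded operator is a pair of a domain \<open>D\<close> and a function \<open>A\<close>; the values of \<open>A\<close>
  outside \<open>D\<close> are irrelevant. A semigroup is a family indexed by \<open>real\<close>, of which only the
  members with nonnegative index matter.\<close>

definition C0_semigroup :: "(real \<Rightarrow> 'a::real_normed_vector \<Rightarrow>\<^sub>L 'a) \<Rightarrow> bool" where
  "C0_semigroup S \<longleftrightarrow>
     S 0 = id_blinfun \<and>
     (\<forall>s\<ge>0. \<forall>t\<ge>0. S (s + t) = S s o\<^sub>L S t) \<and>
     (\<forall>x. ((\<lambda>t. S t x) \<longlongrightarrow> x) (at_right 0))"

definition is_generator ::
  "'a set \<Rightarrow> ('a \<Rightarrow> 'a) \<Rightarrow> (real \<Rightarrow> 'a::real_normed_vector \<Rightarrow>\<^sub>L 'a) \<Rightarrow> bool" where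
  "is_generator D A S \<longleftrightarrow>
     D = {x. \<exists>z. ((\<lambda>t. (1 / t) *\<^sub>R (S t x - x)) \<longlongrightarrow> z) (at_right 0)} \<and>
     (\<forall>x\<in>D. ((\<lambda>t. (1 / t) *\<^sub>R (S t x - x)) \<longlongrightarrow> A x) (at_right 0))"

definition adj_dom :: "'a set \<Rightarrow> ('a \<Rightarrow> 'a) \<Rightarrow> 'a::real_inner set" where
  "adj_dom D A = {v. \<exists>w. \<forall>x\<in>D. inner (A x) v = inner x w}"

text \<open>The \<open>THE\<close> is well defined on \<open>adj_dom D A\<close> when \<open>D\<close> is dense.\<close>

definition adj_op :: "'a set \<Rightarrow> ('a \<Rightarrow> 'a) \<Rightarrow> 'a \<Rightarrow> 'a::real_inner" where
  "adj_op D A v = (THE w. \<forall>x\<in>D. inner (A x) v = inner x w)"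

definition resolvent_set :: "'a set \<Rightarrow> ('a \<Rightarrow> 'a::real_normed_vector) \<Rightarrow> real set" where
  "resolvent_set D A =
     {\<mu>. bij_betw (\<lambda>v. A v - \<mu> *\<^sub>R v) D UNIV \<and>
          bounded_linear (inv_into D (\<lambda>v. A v - \<mu> *\<^sub>R v))}"


section \<open>The spaces \<open>V\<close> and \<open>V'\<close>\<close>

text \<open>The Hilbert space \<open>V = D(A\<^sub>0\<^sup>*)\<close>, whose inner product is not the one of \<open>H\<close>, is
  represented by a type \<open>'v\<close> together with an isometric isomorphism \<open>J\<close> from \<open>'v\<close> onto the
  set \<open>D(A\<^sub>0\<^sup>*)\<close> with its graph inner product. Its dual \<open>V'\<close> is the type
  \<open>'v \<Rightarrow>\<^sub>L real\<close>, normed by the dual norm; the pairing of \<open>\<phi>\<close> in \<open>V'\<close> and \<open>v\<close> in \<open>V\<close> is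
  \<open>blinfun_apply \<phi> v\<close>. Every \<open>A\<^sub>0\<close> is covered: \<open>V\<close> is isometric to \<open>H\<close> via
  \<open>(I + A\<^sub>0 A\<^sub>0\<^sup>*)\<close> raised to the power \<open>1/2\<close>.\<close>

definition represents_dom ::
  "('v::real_inner \<Rightarrow> 'h::real_inner) \<Rightarrow> 'h set \<Rightarrow> ('h \<Rightarrow> 'h) \<Rightarrow> bool" where
  "represents_dom J D A \<longleftrightarrow>
     linear J \<and> range J = D \<and>
     (\<forall>v w. inner v w = inner (J v) (J w) + inner (A (J v)) (A (J w)))"

text \<open>The embedding of \<open>H\<close>, identified with its dual, into \<open>V'\<close>.\<close>

definition embed_dual :: "('v::real_inner \<Rightarrow> 'h::real_inner) \<Rightarrow> 'h \<Rightarrow> ('v \<Rightarrow>\<^sub>L real)" where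
  "embed_dual J h = Blinfun (\<lambda>v. inner h (J v))"

lemma embed_dual_apply:
  assumes "represents_dom J D A"
  shows "blinfun_apply (embed_dual J h) v = inner h (J v)"
proof -
  have lin: "linear J"
    and ip: "\<And>v w. inner v w = inner (J v) (J w) + inner (A (J v)) (A (J w))"
    using assms by (auto simp: represents_dom_def)
  have "norm (J v) \<le> norm v" for v
    unfolding norm_eq_sqrt_inner by (rule real_sqrt_le_mono) (simp add: ip[of v v])
  then have "bounded_linear J"
    using lin by (intro bounded_linear_intro[where K = 1])
      (auto simp: linear_add linear_scale)
  then have "bounded_linear (\<lambda>v. inner h (J v))"
    by (rule bounded_linear_inner_right_comp)
  then show ?thesis
    by (simp add: embed_dual_def bounded_linear_Blinfun_apply)
qed

text \<open>The adjoint \<open>V \<rightarrow> U\<close> of an operator in \<open>L(U, V')\<close>.\<close>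

definition adjoint_to_dual ::
  "('u::real_inner \<Rightarrow>\<^sub>L ('v::real_normed_vector \<Rightarrow>\<^sub>L real)) \<Rightarrow> 'v \<Rightarrow> 'u" where
  "adjoint_to_dual B v = (THE w. \<forall>u. inner w u = blinfun_apply (B u) v)"


section \<open>Function classes and derivatives\<close>

definition lip_const :: "('a::real_normed_vector \<Rightarrow> 'b::real_normed_vector) \<Rightarrow> ennreal" where
  "lip_const f = (SUP (x, y) \<in> {(x, y). x \<noteq> y}. ennreal (norm (f x - f y) / norm (x - y)))"

definition growth_class :: "real \<Rightarrow> ('a::real_normed_vector \<Rightarrow> real) set" where
  "growth_class r = {f. bdd_above (range (\<lambda>x. \<bar>f x\<bar> / (1 + norm x powr r)))}"

definition frechet :: "('a::real_normed_vector \<Rightarrow> real) \<Rightarrow> 'a \<Rightarrow> ('a \<Rightarrow>\<^sub>L real)" where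
  "frechet f x = Blinfun (frechet_derivative f (at x))"

definition Sigma0 :: "('a::real_normed_vector \<Rightarrow> real) set" where
  "Sigma0 = {w \<in> growth_class 2. convex_on UNIV w \<and> (\<forall>x. w differentiable (at x)) \<and>
     continuous_on UNIV (frechet w) \<and> lip_const (frechet w) < \<infinity>}"

text \<open>The derivative regarded as an element of the Hilbert space itself, and the derivative of a
  function on \<open>V'\<close> regarded as an element of \<open>V\<close>.\<close>

definition gradient :: "('u::real_inner \<Rightarrow> real) \<Rightarrow> 'u \<Rightarrow> 'u" where
  "gradient f x = (THE d. GDERIV f x :> d)"

definition predual_gradient ::
  "(('v::real_normed_vector \<Rightarrow>\<^sub>L real) \<Rightarrow> real) \<Rightarrow> ('v \<Rightarrow>\<^sub>L real) \<Rightarrow> 'v" where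
  "predual_gradient f x = (THE v. (f has_derivative (\<lambda>\<phi>. blinfun_apply \<phi> v)) (at x))"


section \<open>Convex functions with values in the extended reals\<close>

definition ereal_convex :: "('a::real_vector \<Rightarrow> ereal) \<Rightarrow> bool" where
  "ereal_convex h \<longleftrightarrow>
     (\<forall>x y t. 0 \<le> t \<and> t \<le> 1 \<longrightarrow>
        h ((1 - t) *\<^sub>R x + t *\<^sub>R y) \<le> ereal (1 - t) * h x + ereal t * h y)"

definition lower_semicontinuous :: "('a::topological_space \<Rightarrow> ereal) \<Rightarrow> bool" where
  "lower_semicontinuous h \<longleftrightarrow> (\<forall>x. h x \<le> Liminf (at x) h)"

definition subdifferential :: "('a::real_inner \<Rightarrow> ereal) \<Rightarrow> 'a \<Rightarrow> 'a set" where
  "subdifferential h u = {q. \<bar>h u\<bar> \<noteq> \<infinity> \<and> (\<forall>v. h u + ereal (inner q (v - u)) \<le> h v)}"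

text \<open>Injectivity of a multivalued map: its inverse is single valued.\<close>

definition multi_injective :: "('a \<Rightarrow> 'b set) \<Rightarrow> bool" where
  "multi_injective F \<longleftrightarrow> (\<forall>x y. F x \<inter> F y \<noteq> {} \<longrightarrow> x = y)"

definition convex_conjugate :: "('a::real_inner \<Rightarrow> ereal) \<Rightarrow> 'a \<Rightarrow> ereal" where
  "convex_conjugate h q = (SUP u. ereal (inner q u) - h u)"


section \<open>The control problem\<close>

text \<open>The library's Bochner integral needs a second countable codomain, whereas \<open>U\<close> and \<open>V'\<close>
  need not be separable. These are the usual notions for an arbitrary codomain: strong
  measurability replaces Borel measurability.\<close>

definition strongly_measurable :: "'a measure \<Rightarrow> ('a \<Rightarrow> 'b::real_normed_vector) \<Rightarrow> bool" where
  "strongly_measurable M f \<longleftrightarrow>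
     (\<exists>s. (\<forall>i. simple_function M (s i)) \<and> (AE x in M. (\<lambda>i. s i x) \<longlonglongrightarrow> f x))"

definition has_strong_integral ::
  "'a measure \<Rightarrow> ('a \<Rightarrow> 'b::real_normed_vector) \<Rightarrow> 'b \<Rightarrow> bool" where
  "has_strong_integral M f I \<longleftrightarrow> strongly_measurable M f \<and>
     (\<exists>s. (\<forall>i::nat. Bochner_Integration.simple_bochner_integrable M (s i)) \<and>
          (\<lambda>i. \<integral>\<^sup>+x. norm (f x - s i x) \<partial>M) \<longlonglongrightarrow> 0 \<and>
          (\<lambda>i. Bochner_Integration.simple_bochner_integral M (s i)) \<longlonglongrightarrow> I)"

definition strong_integral :: "'a measure \<Rightarrow> ('a \<Rightarrow> 'b::real_normed_vector) \<Rightarrow> 'b" where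
  "strong_integral M f = (THE I. has_strong_integral M f I)"

text \<open>Positive part minus negative part; meaningful unless both are infinite (which does not occur
  for the cost below, since its negative part is integrable).\<close>

definition ereal_integral :: "'a measure \<Rightarrow> ('a \<Rightarrow> ereal) \<Rightarrow> ereal" where
  "ereal_integral M f =
     enn2ereal (\<integral>\<^sup>+x. e2ennreal (f x) \<partial>M) - enn2ereal (\<integral>\<^sup>+x. e2ennreal (- f x) \<partial>M)"

text \<open>Controls are functions on \<open>real\<close>; their values at negative times are irrelevant.\<close>

definition weighted_Lp :: "real \<Rightarrow> real \<Rightarrow> (real \<Rightarrow> 'u::real_normed_vector) set" where
  "weighted_Lp p lam =
     {u. strongly_measurable (lebesgue_on {0..}) u \<and>
         (\<integral>\<^sup>+\<tau>. ennreal (norm (exp (- lam * \<tau> / p) *\<^sub>R u \<tau>) powr p) \<partial>lebesgue_on {0..}) < \<infinity>}"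

definition trajectory ::
  "(real \<Rightarrow> 'x::real_normed_vector \<Rightarrow>\<^sub>L 'x) \<Rightarrow> ('u::real_normed_vector \<Rightarrow>\<^sub>L 'x) \<Rightarrow>
     'x \<Rightarrow> (real \<Rightarrow> 'u) \<Rightarrow> real \<Rightarrow> 'x" where
  "trajectory S B x u \<tau> =
     S \<tau> x + strong_integral (lebesgue_on {0..\<tau>}) (\<lambda>\<sigma>. S (\<tau> - \<sigma>) (B (u \<sigma>)))"

definition cost ::
  "(real \<Rightarrow> 'x::real_normed_vector \<Rightarrow>\<^sub>L 'x) \<Rightarrow> ('u::real_normed_vector \<Rightarrow>\<^sub>L 'x) \<Rightarrow>
     ('x \<Rightarrow> real) \<Rightarrow> ('u \<Rightarrow> ereal) \<Rightarrow> real \<Rightarrow> 'x \<Rightarrow> (real \<Rightarrow> 'u) \<Rightarrow> ereal" where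
  "cost S B g h lam x u =
     ereal_integral (lebesgue_on {0..})
       (\<lambda>\<tau>. ereal (exp (- lam * \<tau>)) * (ereal (g (trajectory S B x u \<tau>)) + h (u \<tau>)))"

definition value_function ::
  "(real \<Rightarrow> 'x::real_normed_vector \<Rightarrow>\<^sub>L 'x) \<Rightarrow> ('u::real_normed_vector \<Rightarrow>\<^sub>L 'x) \<Rightarrow>
     ('x \<Rightarrow> real) \<Rightarrow> ('u \<Rightarrow> ereal) \<Rightarrow> real \<Rightarrow> real \<Rightarrow> 'x \<Rightarrow> real" where
  "value_function S B g h lam p x =
     real_of_ereal (INF u \<in> weighted_Lp p lam. cost S B g h lam x u)"

end

theory Submission
  imports Defs
begin

text \<open>An equilibrium \<open>x\<close> of the closed loop satisfies \<open>\<Psi>'(x) = (\<lambda> - A\<^sup>*)\<^sup>-\<^sup>1 g\<^sub>0'(x)\<close>, the costate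
  equation along the constant trajectory. So equilibria are the fixed points of
  \<open>x \<mapsto> - A\<^sup>-\<^sup>1 B (h\<^sub>0\<^sup>*)'(- B\<^sup>* (\<lambda> - A\<^sup>*)\<^sup>-\<^sup>1 g\<^sub>0'(x))\<close>, and since the resolvent has norm at most
  \<open>1 / (\<lambda> - \<omega>)\<close> this map is a contraction; no Lipschitz bound on \<open>\<Psi>'\<close> is required.

  At a fixed point the constant control is optimal, because the constant costate yields an affine
  minorant of every cost (Fubini and convexity), and \<open>\<Psi>\<close> is squeezed between that minorant and
  the cost of the constant control. This fixed point also makes \<open>\<Psi>\<close> finite everywhere; being convex
  and semiconcave with a power larger than 1, \<open>\<Psi>\<close> is differentiable everywhere. Conversely, at a
  solution of the closed loop equation dynamic programming over a short time interval shows that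
  the constant control is optimal, and the same squeezing identifies \<open>\<Psi>'\<close> with the costate.\<close>

section \<open>Riesz representation and duality\<close>

text \<open>The smallness condition is the product of the norms met along the fixed-point map:
  \<open>B\<close> and its adjoint give the square, the two gradients their Lipschitz constants. The
  norm of the inverse of A on V' is bounded by that of the inverse of A_0^* on H, because A on the
  embedded copy of H is the dual of A_0^* as a map from V to H. The spaces may be nonseparable, so
  vector-valued integrals are handled through scalar pairings, and vectors are recovered from
  functionals by Riesz representation and reflexivity. Both growth alternatives are merged into one
  remainder bound for \<open>g0\<close> with exponent 1 + \<theta>. Along S t h it grows like the
  exponential of (1 + \<theta>) \<omega> t, and \<theta> is chosen so that the discount still
  dominates. In the converse direction the slope q of \<Psi> at a solution is not known to lie in
  the domain of the generator of the adjoint semigroup, so the Hamilton-Jacobi-Bellman equation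
  cannot be evaluated pointwise at a nearby state. Strong continuity of the adjoint semigroup at q,
  together with strong convexity of \<open>h0\<close>, replaces that regularity.\<close>

lemma quadratic_nonneg_imp_linear_zero:
  fixes a c :: real
  assumes "\<And>t. 0 \<le> t\<^sup>2 * a + 2 * t * c"
  shows "c = 0"
proof (rule ccontr)
  assume c: "c \<noteq> 0"
  have a: "0 \<le> a" using assms[of 1] assms[of "-1"] by simp
  \<comment> \<open>The minimizer would be -c/a; the denominator a + 1 covers a = 0 and still gives
    a negative value.\<close>
  define t where "t = - c / (a + 1)"
  have "t\<^sup>2 * a + 2 * t * c = - (c\<^sup>2) * (a + 2) / (a + 1)\<^sup>2"
  proof -
    have a1: "a + 1 \<noteq> 0" using a by simp
    show ?thesis unfolding t_def
      by (simp add: power_divide divide_simps a1) (algebra add: a1)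
  qed
  also have "\<dots> < 0" using a c by (simp add: divide_neg_pos mult_pos_pos)
  finally show False using assms[of t] by simp
qed

text \<open>Direct method: \<open>w\<close> minimizes |x|^2 - 2 F x. The linear part cancels in the
  parallelogram identity, so minimizing sequences are Cauchy, and the first variation at the minimum
  is F y = (w | y).\<close>

theorem riesz_representation:
  fixes F :: "'a::{real_inner, complete_space} \<Rightarrow> real"
  assumes "bounded_linear F"
  obtains w where "\<And>x. F x = inner w x"
proof -
  interpret F: bounded_linear F by fact
  obtain K where K: "\<And>x. norm (F x) \<le> norm x * K" using F.bounded by blast
  define G where "G x = (norm x)\<^sup>2 - 2 * F x" for x
  have lower: "- K\<^sup>2 \<le> G x" for x
    using K[of x] zero_le_power2[of "norm x - K"]
    unfolding G_def by (simp add: power2_diff mult.commute)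
  then have bdd: "bdd_below (range G)" by (auto intro!: bdd_belowI)
  define m where "m = Inf (range G)"
  have m_le: "m \<le> G x" for x unfolding m_def using bdd by (simp add: cINF_lower)
  have "\<exists>x. G x < m + 1 / real (Suc n)" for n
    using cInf_lessD[of "range G" "m + 1 / real (Suc n)"] unfolding m_def by auto
  then obtain x where x: "\<And>n. G (x n) < m + 1 / real (Suc n)" by metis
  have par: "(norm (a - b))\<^sup>2 = 2 * G a + 2 * G b - 4 * G ((1/2) *\<^sub>R (a + b))" for a b
    unfolding G_def power2_norm_eq_inner F.scaleR F.add
    by (simp add: algebra_simps inner_commute power2_eq_square)
  have close: "(norm (x i - x j))\<^sup>2 < 2 / real (Suc i) + 2 / real (Suc j)" for i j
    using x[of i] x[of j] m_le[of "(1/2) *\<^sub>R (x i + x j)"] unfolding par by simp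
  have "Cauchy x"
  proof (rule CauchyI)
    fix e :: real assume e: "0 < e"
    obtain N :: nat where "4 / e\<^sup>2 < real N" using reals_Archimedean2 by blast
    then have N: "4 / e\<^sup>2 < real (Suc N)" by simp
    show "\<exists>M. \<forall>i\<ge>M. \<forall>j\<ge>M. norm (x i - x j) < e"
    proof (intro exI[of _ N] allI impI)
      fix i j assume "N \<le> i" "N \<le> j"
      then have "2 / real (Suc i) \<le> 2 / real (Suc N)" "2 / real (Suc j) \<le> 2 / real (Suc N)"
        by (simp_all add: frac_le)
      then have "(norm (x i - x j))\<^sup>2 < 4 / real (Suc N)" using close[of i j] by simp
      also have "\<dots> < e\<^sup>2" using N e by (simp add: field_simps)
      finally show "norm (x i - x j) < e" using e by (simp add: power_less_imp_less_base)
    qed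
  qed
  then obtain w where w: "x \<longlonglongrightarrow> w" using Cauchy_convergent convergent_def by blast
  have "(\<lambda>n. G (x n)) \<longlonglongrightarrow> G w"
    unfolding G_def by (intro tendsto_intros w F.tendsto)
  moreover have "(\<lambda>n. G (x n)) \<longlonglongrightarrow> m"
  proof (rule tendsto_sandwich)
    show "\<forall>\<^sub>F n in sequentially. m \<le> G (x n)" using m_le by simp
    show "\<forall>\<^sub>F n in sequentially. G (x n) \<le> m + 1 / real (Suc n)"
      using x by (simp add: less_imp_le)
    show "(\<lambda>n. m + 1 / real (Suc n)) \<longlonglongrightarrow> m"
      using tendsto_add[OF tendsto_const lim_1_over_n[THEN LIMSEQ_Suc], of m] by simp
  qed simp
  ultimately have Gw: "G w = m" using LIMSEQ_unique by blast
  have "F y = inner w y" for y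
  proof -
    have "0 \<le> t\<^sup>2 * (norm y)\<^sup>2 + 2 * t * (inner w y - F y)" for t
      using m_le[of "w + t *\<^sub>R y"] unfolding Gw[symmetric] G_def F.add F.scaleR power2_norm_eq_inner
      by (simp add: algebra_simps inner_commute power2_eq_square)
    from quadratic_nonneg_imp_linear_zero[OF this] show ?thesis by simp
  qed
  then show thesis using that by blast
qed

definition dual_vec :: "'a::real_inner \<Rightarrow> ('a \<Rightarrow>\<^sub>L real)" where
  "dual_vec v = blinfun_inner_right v"

lemma dual_vec_apply [simp]: "blinfun_apply (dual_vec v) w = inner v w"
  by (simp add: dual_vec_def)

lemma norm_dual_vec [simp]: "norm (dual_vec v) = norm v"
proof (rule antisym)
  show "norm (dual_vec v) \<le> norm v"
    by (rule norm_blinfun_bound) (use Cauchy_Schwarz_ineq2[of v] in auto)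
  have "norm v * norm v \<le> norm (dual_vec v) * norm v"
    using norm_blinfun[of "dual_vec v" v] by (simp add: dot_square_norm power2_eq_square)
  then show "norm v \<le> norm (dual_vec v)" by (cases "v = 0") auto
qed

lemma dual_vec_diff: "dual_vec (v - w) = dual_vec v - dual_vec w"
  by (rule blinfun_eqI) (simp add: inner_diff_left blinfun.diff_left)

lemma dual_eqI:
  fixes v w :: "'a::real_inner"
  assumes "\<And>\<phi> :: 'a \<Rightarrow>\<^sub>L real. blinfun_apply \<phi> v = blinfun_apply \<phi> w"
  shows "v = w"
  using assms[of "dual_vec (v - w)"] inner_eq_zero_iff[of "v - w"] by (simp add: inner_diff_right)

text \<open>Testing with the Riesz functional of \<open>v\<close> itself gives |v|^2 on the left.
  This bounds elements of V that are known only through their pairings with V'.\<close>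

lemma dual_norm_le:
  fixes v :: "'a::real_inner"
  assumes "\<And>\<phi> :: 'a \<Rightarrow>\<^sub>L real. blinfun_apply \<phi> v \<le> c * norm \<phi>" "0 \<le> c"
  shows "norm v \<le> c"
proof -
  have "norm v * norm v \<le> c * norm v"
    using assms(1)[of "dual_vec v"] by (simp add: dot_square_norm power2_eq_square)
  then show ?thesis using assms(2) by (cases "v = 0") auto
qed

lemma dual_vec_surj:
  fixes \<phi> :: "'a::{real_inner, complete_space} \<Rightarrow>\<^sub>L real"
  obtains w where "\<phi> = dual_vec w"
  using riesz_representation[OF blinfun.bounded_linear_right[of \<phi>]]
  by (metis blinfun_eqI dual_vec_apply)

text \<open>Riesz applied twice: \<open>F\<close> composed with the Riesz map is a functional on the
  space itself. Costates, adjoint orbits and derivatives of functions on V' are obtained as elements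
  of V in this way.\<close>

theorem hilbert_reflexive:
  fixes F :: "('a::{real_inner, complete_space} \<Rightarrow>\<^sub>L real) \<Rightarrow> real"
  assumes "bounded_linear F"
  obtains v where "\<And>\<phi>. F \<phi> = \<phi> v"
proof -
  have "bounded_linear (\<lambda>w::'a. F (dual_vec w))"
    unfolding dual_vec_def
    by (rule bounded_linear_compose[OF assms bounded_linear_blinfun_inner_right])
  then obtain v where v: "\<And>w. F (dual_vec w) = inner v w"
    using riesz_representation by metis
  have "F \<phi> = \<phi> v" for \<phi>
  proof -
    obtain w where "\<phi> = dual_vec w" by (rule dual_vec_surj)
    then show ?thesis using v by (simp add: inner_commute)
  qed
  then show thesis using that by blast
qed

text \<open>Riesz representation of u \<mapsto> B u v provides the vector that the definite
  description asks for.\<close>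

lemma adjoint_to_dual_apply:
  fixes B :: "'u::{real_inner, complete_space} \<Rightarrow>\<^sub>L ('v::real_normed_vector \<Rightarrow>\<^sub>L real)"
  shows "inner (adjoint_to_dual B v) u = B u v"
proof -
  have "bounded_linear (\<lambda>u. blinfun_apply (B u) v)"
    by (rule bounded_linear_compose[OF blinfun.bounded_linear_left blinfun.bounded_linear_right])
  then obtain w where w: "\<And>u. blinfun_apply (B u) v = inner w u"
    using riesz_representation by metis
  have "\<forall>u. inner (adjoint_to_dual B v) u = B u v"
    unfolding adjoint_to_dual_def
    by (rule theI[of _ w]) (simp add: w, metis w vector_eq_rdot)
  then show ?thesis by simp
qed

text \<open>Pairing the difference with itself moves it to the \<open>B\<close> side. This supplies
  the second factor \<open>norm B\<close> of the contraction constant; the form with differences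
  makes linearity of the adjoint unnecessary to state.\<close>

lemma norm_adjoint_to_dual_diff_le:
  fixes B :: "'u::{real_inner, complete_space} \<Rightarrow>\<^sub>L ('v::real_normed_vector \<Rightarrow>\<^sub>L real)"
  shows "norm (adjoint_to_dual B v - adjoint_to_dual B w) \<le> norm B * norm (v - w)"
proof -
  let ?d = "adjoint_to_dual B v - adjoint_to_dual B w"
  have "norm ?d * norm ?d = inner ?d ?d"
    by (metis power2_eq_square power2_norm_eq_inner)
  also have "\<dots> = B ?d (v - w)"
    by (subst inner_diff_left) (simp only: adjoint_to_dual_apply blinfun.diff_right)
  also have "\<dots> \<le> norm (B ?d) * norm (v - w)"
    using norm_blinfun[of "B ?d" "v - w"] by simp
  also have "\<dots> \<le> (norm B * norm ?d) * norm (v - w)"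
    by (intro mult_right_mono norm_blinfun) simp
  finally have "norm ?d * norm ?d \<le> (norm B * norm (v - w)) * norm ?d" by (simp add: mult_ac)
  then show ?thesis by (cases "?d = 0") auto
qed

section \<open>Strongly continuous semigroups\<close>

text \<open>The centre \<open>x\<close> does not matter: 2 T z = T (x + z) - T (x - z), so at one of
  the two points x + z and x - z the operator is at least as large as at \<open>z\<close>.\<close>

lemma ball_norm_blinfun_ge:
  fixes T :: "'a::real_normed_vector \<Rightarrow>\<^sub>L 'b::real_normed_vector"
  assumes "0 < r" "0 < norm T"
  obtains y where "norm (y - x) \<le> r" "2 / 3 * r * norm T \<le> norm (T y)"
proof -
  obtain z where z: "norm z \<le> r" "2 / 3 * r * norm T \<le> norm (T z)"
  proof (rule ccontr)
    assume "\<not> thesis"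
    then have small: "\<And>z. norm z \<le> r \<Longrightarrow> norm (T z) < 2 / 3 * r * norm T"
      using that not_le by blast
    have "norm T \<le> 2 / 3 * norm T"
    proof (rule norm_blinfun_bound)
      fix y
      show "norm (T y) \<le> 2 / 3 * norm T * norm y"
      proof (cases "y = 0")
        case False
        have "norm (T ((r / norm y) *\<^sub>R y)) < 2 / 3 * r * norm T"
          using False assms(1) by (intro small) simp
        then have "r * (norm (T y) / norm y) < r * (2 / 3 * norm T)"
          using assms(1) by (simp add: blinfun.scaleR_right)
        then show ?thesis using assms(1) False by (simp add: field_simps)
      qed simp
    qed (use assms in simp)
    then show False using assms by simp
  qed
  have "2 * norm (T z) = norm (T (x + z) - T (x - z))"
    by (simp add: blinfun.add_right blinfun.diff_right flip: scaleR_2)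
  also have "\<dots> \<le> norm (T (x + z)) + norm (T (x - z))"
    by (rule norm_triangle_ineq4)
  finally have "norm (T z) \<le> norm (T (x + z)) \<or> norm (T z) \<le> norm (T (x - z))"
    by linarith
  then show thesis
    using that[of "x + z"] that[of "x - z"] z by auto
qed

text \<open>Sokal's proof of the uniform boundedness principle, avoiding the Baire category theorem.\<close>

lemma gliding_hump:
  fixes T :: "nat \<Rightarrow> 'a::{real_normed_vector, complete_space} \<Rightarrow>\<^sub>L 'b::real_normed_vector"
  assumes "\<And>n. 4 ^ n \<le> norm (T n)"
  obtains x where "\<And>n. (1 / 6) * (4 / 3) ^ n \<le> norm (T n x)"
proof -
  have T_pos: "0 < norm (T n)" for n
    using assms[of n] by (rule order.strict_trans2[rotated]) simp
  have "\<exists>x. \<forall>n. 2 / 3 * (1 / 3) ^ n * norm (T n) \<le> norm (T n (x n)) \<and>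
      norm (x (Suc n) - x n) \<le> (1 / 3) ^ Suc n"
  proof (rule dependent_nat_choice)
    show "\<exists>x. 2 / 3 * (1 / 3) ^ 0 * norm (T 0) \<le> norm (T 0 x)"
      using ball_norm_blinfun_ge[of 1 "T 0"] T_pos[of 0] by auto
    show "\<exists>y. 2 / 3 * (1 / 3) ^ Suc n * norm (T (Suc n)) \<le> norm (T (Suc n) y) \<and>
        norm (y - x) \<le> (1 / 3) ^ Suc n" for x n
      using ball_norm_blinfun_ge[of "(1 / 3) ^ Suc n" "T (Suc n)" x] T_pos[of "Suc n"]
      by (metis zero_less_power zero_less_divide_1_iff zero_less_numeral)
  qed
  then obtain x where x: "\<And>n. 2 / 3 * (1 / 3) ^ n * norm (T n) \<le> norm (T n (x n))"
    and step: "\<And>n. norm (x (Suc n) - x n) \<le> (1 / 3) ^ Suc n"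
    by blast
  \<comment> \<open>The bound is the exact geometric sum; the subtracted term lets the induction
    close.\<close>
  have tail: "norm (x (n + k) - x n) \<le> 1 / 2 * (1 / 3) ^ n - 1 / 2 * (1 / 3) ^ (n + k)" for n k
  proof (induction k)
    case (Suc k)
    have "norm (x (n + Suc k) - x n) \<le> norm (x (Suc (n + k)) - x (n + k)) + norm (x (n + k) - x n)"
      using norm_triangle_ineq[of "x (Suc (n + k)) - x (n + k)" "x (n + k) - x n"] by simp
    then show ?case using Suc step[of "n + k"] by simp
  qed simp
  have half: "norm (x m - x n) \<le> 1 / 2 * (1 / 3) ^ n" if "n \<le> m" for m n
  proof -
    have "norm (x m - x n) \<le> 1 / 2 * (1 / 3) ^ n - 1 / 2 * (1 / 3) ^ m"
      using tail[of n "m - n"] that by simp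
    moreover have "(0::real) \<le> 1 / 2 * (1 / 3) ^ m" by simp
    ultimately show ?thesis by linarith
  qed
  have "Cauchy x"
  proof (rule CauchyI)
    fix e :: real assume "0 < e"
    then obtain N where N: "(1 / 3) ^ N < e"
      using real_arch_pow_inv[of e "1 / 3"] by auto
    show "\<exists>M. \<forall>m\<ge>M. \<forall>n\<ge>M. norm (x m - x n) < e"
    proof (intro exI[of _ N] allI impI)
      fix m n assume "N \<le> m" "N \<le> n"
      then have "norm (x m - x N) + norm (x n - x N) \<le> (1 / 3) ^ N"
        using half[of N m] half[of N n] by simp
      then show "norm (x m - x n) < e"
        using N norm_triangle_ineq4[of "x m - x N" "x n - x N"] by simp
    qed
  qed
  then obtain z where z: "x \<longlonglongrightarrow> z" using Cauchy_convergent convergent_def by blast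
  have "(1 / 6) * (4 / 3) ^ n \<le> norm (T n z)" for n
  proof -
    have "norm (z - x n) \<le> 1 / 2 * (1 / 3) ^ n"
    proof (rule tendsto_upperbound)
      show "(\<lambda>m. norm (x m - x n)) \<longlonglongrightarrow> norm (z - x n)" by (intro tendsto_intros z)
      show "\<forall>\<^sub>F m in sequentially. norm (x m - x n) \<le> 1 / 2 * (1 / 3) ^ n"
        using half eventually_ge_at_top[of n] by (rule eventually_mono[rotated])
    qed simp
    \<comment> \<open>All later corrections cost at most 1/2 of the n-th scale, while stage n
      secured 2/3 of it; the difference 1/6 survives in the limit.\<close>
    then have "norm (T n (z - x n)) \<le> norm (T n) * (1 / 2 * (1 / 3) ^ n)"
      by (intro order_trans[OF norm_blinfun] mult_left_mono) simp_all
    moreover have "norm (T n (x n)) \<le> norm (T n z) + norm (T n (z - x n))"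
      using norm_triangle_ineq4[of "T n z" "T n (z - x n)"] by (simp add: blinfun.diff_right)
    ultimately have "1 / 6 * (1 / 3) ^ n * norm (T n) \<le> norm (T n z)"
      using x[of n] by (simp add: mult_ac)
    moreover have "1 / 6 * (1 / 3) ^ n * 4 ^ n \<le> 1 / 6 * (1 / 3) ^ n * norm (T n)"
      by (intro mult_left_mono assms) simp
    ultimately show ?thesis by (simp add: power_divide)
  qed
  then show thesis using that by blast
qed

section \<open>Local boundedness of strongly continuous semigroups\<close>

lemma C0_semigroup_0: "C0_semigroup S \<Longrightarrow> S 0 x = x"
  by (simp add: C0_semigroup_def)

lemma C0_semigroup_add: "C0_semigroup S \<Longrightarrow> 0 \<le> s \<Longrightarrow> 0 \<le> t \<Longrightarrow> S (s + t) x = S s (S t x)"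
  by (simp add: C0_semigroup_def)

lemma C0_semigroup_tendsto: "C0_semigroup S \<Longrightarrow> ((\<lambda>t. S t x) \<longlongrightarrow> x) (at_right 0)"
  by (simp add: C0_semigroup_def)

text \<open>Unboundedness near 0 would yield times tending to 0 along which the operator norms
  exceed 4^n; the gliding hump then produces one orbit that blows up, against convergence of S t x
  to x. A bound on a short interval spreads to any interval by the semigroup law.\<close>

lemma C0_semigroup_locally_bounded:
  fixes S :: "real \<Rightarrow> 'a::{real_normed_vector, complete_space} \<Rightarrow>\<^sub>L 'a"
  assumes C0: "C0_semigroup S"
  shows "\<exists>M. \<forall>t\<in>{0..T}. norm (S t) \<le> M"
proof -
  obtain d M where d: "0 < d" and M: "\<And>t. t \<in> {0..d} \<Longrightarrow> norm (S t) \<le> M"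
  proof (rule ccontr)
    assume "\<not> thesis"
    note no_bound = this
    have "\<exists>t\<in>{0..1 / real (Suc n)}. 4 ^ n < norm (S t)" for n
    proof (rule ccontr)
      assume "\<not> ?thesis"
      then have "\<And>t. t \<in> {0..1 / real (Suc n)} \<Longrightarrow> norm (S t) \<le> 4 ^ n" by (meson not_le)
      then show False using that[of "1 / real (Suc n)" "4 ^ n"] no_bound by simp
    qed
    then obtain t where t: "\<And>n. t n \<in> {0..1 / real (Suc n)}" "\<And>n. 4 ^ n < norm (S (t n))"
      by metis
    \<comment> \<open>Strong continuity is a punctured right limit, so the times must not be 0; at 0
      the norm is at most 1.\<close>
    have pos: "0 < t n" for n
    proof (rule ccontr)
      assume "\<not> 0 < t n"
      then have "t n = 0" using t(1)[of n] by simp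
      then have "norm (S (t n)) \<le> 1"
        using C0 by (simp add: C0_semigroup_def norm_blinfun_id_le)
      moreover have "(1::real) \<le> 4 ^ n" by simp
      ultimately show False using t(2)[of n] by simp
    qed
    obtain x where x: "\<And>n. (1 / 6) * (4 / 3) ^ n \<le> norm (S (t n) x)"
      using gliding_hump[of "\<lambda>n. S (t n)"] t(2) by (metis less_imp_le)
    have "t \<longlonglongrightarrow> 0"
    proof (rule tendsto_sandwich[of "\<lambda>_. 0" t _ "\<lambda>n. 1 / real (Suc n)"])
      show "(\<lambda>n. 1 / real (Suc n)) \<longlonglongrightarrow> 0" by (rule LIMSEQ_Suc[OF lim_1_over_n])
    qed (use t(1) in auto)
    then have "filterlim t (at_right 0) sequentially"
      using pos pos[THEN less_imp_neq, symmetric] by (simp add: filterlim_at)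
    then have "(\<lambda>n. norm (S (t n) x)) \<longlonglongrightarrow> norm x"
      by (intro tendsto_norm filterlim_compose[OF C0_semigroup_tendsto[OF C0]])
    then have "Bseq (\<lambda>n. norm (S (t n) x))" by (rule convergent_imp_Bseq[OF convergentI])
    then obtain C where C: "\<And>n. norm (S (t n) x) \<le> C" by (auto simp: Bseq_def)
    obtain n where "6 * C < (4 / 3) ^ n" using real_arch_pow[of "4 / 3"] by auto
    then show False using x[of n] C[of n] by simp
  qed
  \<comment> \<open>C at least 1 makes the powers of C increasing, so the bound of one block also
    covers the shorter times.\<close>
  define C where "C = max M 1"
  have C: "1 \<le> C" "\<And>t. t \<in> {0..d} \<Longrightarrow> norm (S t) \<le> C"
    using M by (fastforce simp: C_def)+
  have "\<forall>t\<in>{0..real n * d}. norm (S t) \<le> C ^ n" for n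
  proof (induction n)
    case 0
    then show ?case using C0 by (simp add: C0_semigroup_def norm_blinfun_id_le)
  next
    case (Suc n)
    show ?case
    proof
      fix t assume t: "t \<in> {0..real (Suc n) * d}"
      show "norm (S t) \<le> C ^ Suc n"
      proof (cases "t \<le> d")
        case True
        then have "norm (S t) \<le> C" using C t by simp
        also have "C * 1 \<le> C * C ^ n" using C(1) by (intro mult_left_mono one_le_power) auto
        finally show ?thesis by simp
      next
        case False
        then have "t - d \<in> {0..real n * d}" using t by (simp add: algebra_simps)
        then have "norm (S (t - d)) \<le> C ^ n" using Suc by blast
        have "S t = S d o\<^sub>L S (t - d)"
          using C0 False d unfolding C0_semigroup_def
          by (metis diff_add_cancel add.commute diff_ge_0_iff_ge less_imp_le not_le)
        then have "norm (S t) \<le> norm (S d) * norm (S (t - d))"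
          by (simp add: norm_blinfun_compose)
        also have "\<dots> \<le> C * C ^ n"
          using C(2)[of d] C(1) d \<open>norm (S (t - d)) \<le> C ^ n\<close> by (intro mult_mono) auto
        finally show ?thesis by simp
      qed
    qed
  qed
  moreover obtain n where "T < real n * d" using ex_less_of_nat_mult[OF d] by blast
  ultimately show ?thesis by (meson atLeastAtMost_iff less_imp_le order_trans)
qed

text \<open>Local boundedness is a locale assumption, so the facts below hold over any normed space.
  On H and on V' it is supplied by \<open>C0_semigroup_locally_bounded\<close>.\<close>

locale bounded_C0_semigroup =
  fixes S :: "real \<Rightarrow> 'a::real_normed_vector \<Rightarrow>\<^sub>L 'a"
  assumes C0: "C0_semigroup S"
    and locally_bounded: "\<And>T. \<exists>M. \<forall>t\<in>{0..T}. norm (S t) \<le> M"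
begin

lemmas S_0 [simp] = C0_semigroup_0[OF C0]
lemmas S_add = C0_semigroup_add[OF C0]
lemmas S_tendsto = C0_semigroup_tendsto[OF C0]

lemma S_tendsto_0: "((\<lambda>t. S t x) \<longlongrightarrow> x) (at 0 within {0..})"
proof -
  have "((\<lambda>t. S t x) \<longlongrightarrow> S 0 x) (at 0 within {0<..} \<union> {0})"
    using S_tendsto unfolding continuous_within[symmetric]
    by (simp add: continuous_within at_within_def insert_Diff_if)
  moreover have "{0<..} \<union> {0} = {0::real..}" by auto
  ultimately show ?thesis by simp
qed

lemma S_diff_bound:
  obtains M where "0 < M"
    "\<And>s t x. s \<in> {0..T} \<Longrightarrow> t \<in> {0..T} \<Longrightarrow> norm (S s x - S t x) \<le> M * norm (S \<bar>s - t\<bar> x - x)"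
proof -
  obtain M where M: "\<And>t. t \<in> {0..T} \<Longrightarrow> norm (S t) \<le> M" using locally_bounded by blast
  have *: "norm (S s x - S t x) \<le> max M 1 * norm (S (s - t) x - x)"
    if "s \<in> {0..T}" "t \<in> {0..T}" "t \<le> s" for s t x
  proof -
    have "S s x = S t (S (s - t) x)" using S_add[of t "s - t" x] that by simp
    then have "norm (S s x - S t x) = norm (S t (S (s - t) x - x))"
      by (simp add: blinfun.diff_right)
    also have "\<dots> \<le> norm (S t) * norm (S (s - t) x - x)" by (rule norm_blinfun)
    also have "\<dots> \<le> max M 1 * norm (S (s - t) x - x)"
      using M[OF that(2)] by (intro mult_right_mono) auto
    finally show ?thesis .
  qed
  have "norm (S s x - S t x) \<le> max M 1 * norm (S \<bar>s - t\<bar> x - x)"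
    if "s \<in> {0..T}" "t \<in> {0..T}" for s t x
    using *[of s t x] *[of t s x] that by (cases "t \<le> s") (auto simp: norm_minus_commute abs_if)
  then show thesis using that[of "max M 1"] by auto
qed

lemma S_continuous_on: "continuous_on {0..} (\<lambda>t. S t x)"
  unfolding continuous_on_iff
proof (intro ballI allI impI)
  fix t e :: real assume t: "t \<in> {0..}" and e: "0 < e"
  obtain M where M: "0 < M"
    "\<And>s r x. s \<in> {0..t + 1} \<Longrightarrow> r \<in> {0..t + 1} \<Longrightarrow> norm (S s x - S r x) \<le> M * norm (S \<bar>s - r\<bar> x - x)"
    by (rule S_diff_bound[of "t + 1"]) blast
  obtain d where d: "0 < d" "\<And>r. 0 \<le> r \<Longrightarrow> r < d \<Longrightarrow> norm (S r x - x) < e / M"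
    using S_tendsto_0[of x] e M(1) unfolding Lim_within dist_norm
    by (metis S_0 atLeast_iff divide_pos_pos abs_of_nonneg diff_zero diff_self norm_zero
        real_norm_def le_less)
  show "\<exists>d>0. \<forall>s\<in>{0..}. dist s t < d \<longrightarrow> dist (S s x) (S t x) < e"
  proof (intro exI[of _ "min d 1"] conjI ballI impI)
    fix s assume s: "s \<in> {0..}" "dist s t < min d 1"
    then have "norm (S s x - S t x) \<le> M * norm (S \<bar>s - t\<bar> x - x)"
      using t by (intro M(2)) (auto simp: dist_norm)
    also have "\<dots> < M * (e / M)"
      using s M(1) by (intro mult_strict_left_mono d) (auto simp: dist_norm)
    finally show "dist (S s x) (S t x) < e" using M(1) by (simp add: dist_norm)
  qed (use d in simp)
qed

lemma S_continuous_on_compose: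
  assumes "continuous_on X f" "f ` X \<subseteq> {0..}"
  shows "continuous_on X (\<lambda>t. S (f t) x)"
  using continuous_on_compose2[OF S_continuous_on assms] .

lemma generator_commute:
  assumes gen: "is_generator D A S" and x: "x \<in> D" and t: "0 \<le> t"
  shows "S t x \<in> D" "A (S t x) = S t (A x)"
proof -
  have "((\<lambda>r. S t ((1 / r) *\<^sub>R (S r x - x))) \<longlongrightarrow> S t (A x)) (at_right 0)"
    using gen x by (intro blinfun.tendsto tendsto_const) (auto simp: is_generator_def)
  moreover have "\<forall>\<^sub>F r in at_right 0. S t ((1 / r) *\<^sub>R (S r x - x)) = (1 / r) *\<^sub>R (S r (S t x) - S t x)"
    unfolding eventually_at_right_field
  proof (intro exI[of _ 1] conjI allI impI)
    fix r :: real assume "0 < r"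
    then have "S t (S r x) = S r (S t x)"
      using S_add[of t r x] S_add[of r t x] t by (simp add: add.commute)
    then show "S t ((1 / r) *\<^sub>R (S r x - x)) = (1 / r) *\<^sub>R (S r (S t x) - S t x)"
      by (simp add: blinfun.diff_right blinfun.scaleR_right)
  qed simp
  ultimately have lim: "((\<lambda>r. (1 / r) *\<^sub>R (S r (S t x) - S t x)) \<longlongrightarrow> S t (A x)) (at_right 0)"
    by (rule Lim_transform_eventually)
  then show D: "S t x \<in> D" using gen unfolding is_generator_def by blast
  then have "((\<lambda>r. (1 / r) *\<^sub>R (S r (S t x) - S t x)) \<longlongrightarrow> A (S t x)) (at_right 0)"
    using gen unfolding is_generator_def by blast
  then show "A (S t x) = S t (A x)" using lim tendsto_unique trivial_limit_at_right_real by blast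
qed

lemma generator_diff:
  assumes gen: "is_generator D A S" and "x \<in> D" "y \<in> D"
  shows "x - y \<in> D" "A (x - y) = A x - A y"
proof -
  have "((\<lambda>r. (1 / r) *\<^sub>R (S r x - x) - (1 / r) *\<^sub>R (S r y - y)) \<longlongrightarrow> A x - A y) (at_right 0)"
    using assms by (intro tendsto_diff) (auto simp: is_generator_def)
  then have lim: "((\<lambda>r. (1 / r) *\<^sub>R (S r (x - y) - (x - y))) \<longlongrightarrow> A x - A y) (at_right 0)"
    by (simp add: blinfun.diff_right algebra_simps)
  then show D: "x - y \<in> D" using gen unfolding is_generator_def by blast
  then have "((\<lambda>r. (1 / r) *\<^sub>R (S r (x - y) - (x - y))) \<longlongrightarrow> A (x - y)) (at_right 0)"
    using gen unfolding is_generator_def by blast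
  then show "A (x - y) = A x - A y" using lim tendsto_unique trivial_limit_at_right_real by blast
qed

lemma generatorI:
  assumes gen: "is_generator D A S"
    and lim: "((\<lambda>r. (1 / r) *\<^sub>R (S r x - x)) \<longlongrightarrow> y) (at_right 0)"
  shows "x \<in> D" "A x = y"
proof -
  show D: "x \<in> D" using gen lim unfolding is_generator_def by blast
  then have "((\<lambda>r. (1 / r) *\<^sub>R (S r x - x)) \<longlongrightarrow> A x) (at_right 0)"
    using gen unfolding is_generator_def by blast
  then show "A x = y" using lim tendsto_unique trivial_limit_at_right_real by blast
qed

text \<open>The generator only gives the right derivative at 0. With r = |s - t| and m = min s t,
  the difference of the orbit is, up to sign, S m applied to the increment over r at 0. Local
  boundedness of S m and continuity of the orbit of A x then treat both sides of t at once.\<close>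

lemma S_has_vector_derivative:
  assumes gen: "is_generator D A S" and x: "x \<in> D" and t: "0 \<le> t"
  shows "((\<lambda>t. S t x) has_vector_derivative S t (A x)) (at t within {0..})"
proof -
  obtain M where M: "\<And>s. s \<in> {0..t + 1} \<Longrightarrow> norm (S s) \<le> M" using locally_bounded by blast
  define C where "C = max M 1"
  have C: "0 < C" "\<And>s. s \<in> {0..t + 1} \<Longrightarrow> norm (S s) \<le> C"
    using M by (fastforce simp: C_def)+
  let ?Q = "\<lambda>r. (1 / r) *\<^sub>R (S r x - x)"
  have "((\<lambda>s. (S s x - S t x - (s - t) *\<^sub>R S t (A x)) /\<^sub>R norm (s - t)) \<longlongrightarrow> 0) (at t within {0..})"
  proof (rule Lim_null_comparison)
    show "\<forall>\<^sub>F s in at t within {0..}. norm ((S s x - S t x - (s - t) *\<^sub>R S t (A x)) /\<^sub>R norm (s - t)) \<le>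
       C * norm (?Q \<bar>s - t\<bar> - A x) + norm (S (min s t) (A x) - S t (A x))"
      unfolding eventually_at
    proof (intro exI[of _ 1] conjI ballI impI)
      fix s assume s: "s \<in> {0..}" "s \<noteq> t \<and> dist s t < 1"
      let ?r = "\<bar>s - t\<bar>" and ?m = "min s t"
      have r: "0 < ?r" using s by simp
      have "norm (S s x - S t x - (s - t) *\<^sub>R S t (A x)) = norm (S ?m (S ?r x - x) - ?r *\<^sub>R S t (A x))"
      proof (cases "t \<le> s")
        case True
        then show ?thesis
          using S_add[of t "s - t" x] t by (simp add: min_def blinfun.diff_right)
      next
        case False
        then have "S ?m (S ?r x - x) - ?r *\<^sub>R S t (A x) = - (S s x - S t x - (s - t) *\<^sub>R S t (A x))"
          using S_add[of s "t - s" x] s by (simp add: min_def blinfun.diff_right algebra_simps)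
        then show ?thesis by (metis norm_minus_cancel)
      qed
      also have "S ?m (S ?r x - x) - ?r *\<^sub>R S t (A x) =
          ?r *\<^sub>R (S ?m (?Q ?r - A x) + (S ?m (A x) - S t (A x)))"
      proof -
        have "S ?m (?r *\<^sub>R q) - ?r *\<^sub>R S t (A x) =
            ?r *\<^sub>R (S ?m (q - A x) + (S ?m (A x) - S t (A x)))" for q
          by (simp add: blinfun.scaleR_right blinfun.diff_right algebra_simps)
        moreover have "?r *\<^sub>R ?Q ?r = S ?r x - x" using r by simp
        ultimately show ?thesis by metis
      qed
      finally have "norm ((S s x - S t x - (s - t) *\<^sub>R S t (A x)) /\<^sub>R norm (s - t)) =
          norm (S ?m (?Q ?r - A x) + (S ?m (A x) - S t (A x)))"
        using r by simp
      also have "\<dots> \<le> norm (S ?m (?Q ?r - A x)) + norm (S ?m (A x) - S t (A x))"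
        by (rule norm_triangle_ineq)
      also have "norm (S ?m (?Q ?r - A x)) \<le> norm (S ?m) * norm (?Q ?r - A x)"
        by (rule norm_blinfun)
      also have "\<dots> \<le> C * norm (?Q ?r - A x)"
        using s t by (intro mult_right_mono C) (auto simp: dist_norm)
      finally show "norm ((S s x - S t x - (s - t) *\<^sub>R S t (A x)) /\<^sub>R norm (s - t)) \<le>
        C * norm (?Q ?r - A x) + norm (S ?m (A x) - S t (A x))" by simp
    qed simp
    have dist: "filterlim (\<lambda>s. \<bar>s - t\<bar>) (at_right 0) (at t within {0..})"
      unfolding filterlim_at
      by (auto simp: eventually_at intro!: tendsto_eq_intros exI[of _ 1])
    have "(?Q \<longlongrightarrow> A x) (at_right 0)" using gen x unfolding is_generator_def by blast
    then have "((\<lambda>s. ?Q \<bar>s - t\<bar>) \<longlongrightarrow> A x) (at t within {0..})"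
      by (rule filterlim_compose[OF _ dist])
    moreover have "((\<lambda>s. S (min s t) (A x)) \<longlongrightarrow> S (min t t) (A x)) (at t within {0..})"
    proof -
      have "continuous_on {0..} (\<lambda>s. S (min s t) (A x))"
        using t by (intro S_continuous_on_compose continuous_intros) auto
      from this[unfolded continuous_on_def, rule_format, of t] t show ?thesis by simp
    qed
    ultimately have "((\<lambda>s. C * norm (?Q \<bar>s - t\<bar> - A x) + norm (S (min s t) (A x) - S t (A x))) \<longlongrightarrow>
      C * norm (A x - A x) + norm (S t (A x) - S t (A x))) (at t within {0..})"
      by (intro tendsto_add tendsto_mult tendsto_norm tendsto_diff tendsto_const) simp_all
    then show "((\<lambda>s. C * norm (?Q \<bar>s - t\<bar> - A x) + norm (S (min s t) (A x) - S t (A x))) \<longlongrightarrow> 0) (at t within {0..})"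
      by simp
  qed
  then show ?thesis
    unfolding has_vector_derivative_def has_derivative_within
    by (simp add: bounded_linear_scaleR_left divide_inverse_commute diff_diff_eq)
qed

lemma S_integral:
  fixes F :: "'a \<Rightarrow> real"
  assumes gen: "is_generator D A S" and x: "x \<in> D" and t: "0 \<le> t" and F: "bounded_linear F"
  shows "((\<lambda>s. F (S s (A x))) has_integral F (S t x) - F x) {0..t}"
proof -
  have "((\<lambda>s. F (S s x)) has_vector_derivative F (S s (A x))) (at s within {0..t})" if "s \<in> {0..t}" for s
  proof (rule bounded_linear.has_vector_derivative[OF F])
    show "((\<lambda>t. S t x) has_vector_derivative S s (A x)) (at s within {0..t})"
      by (rule has_vector_derivative_within_subset[OF S_has_vector_derivative[OF gen x]])
        (use that in auto)
  qed
  from fundamental_theorem_of_calculus[OF t this] show ?thesis by simp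
qed

end

section \<open>Generators on Hilbert spaces and the extrapolated semigroup\<close>

text \<open>Weak integral of a continuous curve: the scalar integrals depend linearly and boundedly
  on \<open>k\<close>, and Riesz turns them into a vector.\<close>

lemma hilbert_integral:
  fixes f :: "real \<Rightarrow> 'a::{real_inner, complete_space}"
  assumes ab: "a \<le> b" and f: "continuous_on {a..b} f"
  obtains m where "\<And>k. ((\<lambda>s. inner (f s) k) has_integral inner m k) {a..b}"
proof -
  have int: "(\<lambda>s. inner (f s) k) integrable_on {a..b}" for k
    by (intro integrable_continuous_real continuous_intros f)
  have "bounded (f ` {a..b})"
    by (intro compact_imp_bounded compact_continuous_image f) auto
  then obtain C where C: "\<And>s. s \<in> {a..b} \<Longrightarrow> norm (f s) \<le> C"
    unfolding bounded_iff by blast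
  have "bounded_linear (\<lambda>k. integral {a..b} (\<lambda>s. inner (f s) k))"
  proof (rule bounded_linear_intro[where K = "C * (b - a)"])
    fix k l :: 'a and r :: real
    show "integral {a..b} (\<lambda>s. inner (f s) (k + l)) =
        integral {a..b} (\<lambda>s. inner (f s) k) + integral {a..b} (\<lambda>s. inner (f s) l)"
      using int by (simp add: inner_add_right integral_add)
    show "integral {a..b} (\<lambda>s. inner (f s) (r *\<^sub>R k)) = r *\<^sub>R integral {a..b} (\<lambda>s. inner (f s) k)"
      by simp
    have "norm (integral {a..b} (\<lambda>s. inner (f s) k)) \<le> (C * norm k) * (b - a)"
    proof (rule integral_bound[OF ab])
      show "continuous_on {a..b} (\<lambda>s. inner (f s) k)" by (intro continuous_intros f)
      fix s assume "s \<in> {a..b}"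
      then have "norm (f s) * norm k \<le> C * norm k" by (intro mult_right_mono C) auto
      then show "norm (inner (f s) k) \<le> C * norm k"
        using Cauchy_Schwarz_ineq2[of "f s" k] by simp
    qed
    then show "norm (integral {a..b} (\<lambda>s. inner (f s) k)) \<le> norm k * (C * (b - a))"
      by (simp add: mult_ac)
  qed
  then obtain m where "\<And>k. integral {a..b} (\<lambda>s. inner (f s) k) = inner m k"
    using riesz_representation by metis
  then have "((\<lambda>s. inner (f s) k) has_integral inner m k) {a..b}" for k
    using integrable_integral[OF int] by metis
  then show thesis using that by blast
qed

text \<open>Testing with the error vector itself turns the scalar estimate into a norm
  estimate.\<close>

lemma hilbert_integral_close:
  fixes f :: "real \<Rightarrow> 'a::real_inner"
  assumes m: "\<And>k. ((\<lambda>s. inner (f s) k) has_integral inner m k) {a..b}"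
    and ab: "a \<le> b" and e: "\<And>s. s \<in> {a..b} \<Longrightarrow> norm (f s - c) \<le> e"
  shows "norm (m - (b - a) *\<^sub>R c) \<le> e * (b - a)"
proof -
  let ?d = "m - (b - a) *\<^sub>R c"
  have e0: "0 \<le> e" using e[of a] ab by (auto intro: order_trans[OF norm_ge_zero])
  have "((\<lambda>s. inner (f s) ?d - inner c ?d) has_integral inner m ?d - (b - a) * inner c ?d) {a..b}"
    using has_integral_diff[OF m[of ?d] has_integral_const_real[of "inner c ?d" a b]] ab by simp
  then have "((\<lambda>s. inner (f s - c) ?d) has_integral inner ?d ?d) {a..b}"
    by (simp add: inner_diff_left)
  moreover have "norm (inner (f s - c) ?d) \<le> e * norm ?d" if "s \<in> {a..b}" for s
    using Cauchy_Schwarz_ineq2[of "f s - c" ?d] mult_right_mono[OF e[OF that], of "norm ?d"]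
    by simp
  ultimately have "norm (inner ?d ?d) \<le> (e * norm ?d) * measure lborel (cbox a b)"
    using e0 by (intro has_integral_bound[where f = "\<lambda>s. inner (f s - c) ?d"]) auto
  then have "norm ?d * norm ?d \<le> (e * (b - a)) * norm ?d"
    using ab by (simp add: dot_square_norm power2_eq_square mult_ac)
  then show ?thesis using e0 ab by (cases "?d = 0") auto
qed

section \<open>The generator of a semigroup on a Hilbert space\<close>

context
  fixes S :: "real \<Rightarrow> 'a::{real_inner, complete_space} \<Rightarrow>\<^sub>L 'a" and D A
  assumes C0: "C0_semigroup S" and gen: "is_generator D A S"
begin

interpretation bounded_C0_semigroup S
  using C0 C0_semigroup_locally_bounded[OF C0] by unfold_locales

lemma C0_semigroup_near_0:
  assumes "0 < e"
  obtains d where "0 < d" "\<And>s. s \<in> {0..d} \<Longrightarrow> norm (S s x - x) \<le> e"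
proof -
  have "\<forall>\<^sub>F s in at 0 within {0..}. norm (S s x - x) < e"
    using S_tendsto_0[of x] assms by (simp add: tendsto_iff dist_norm)
  then obtain d where d: "0 < d" "\<And>s. s \<in> {0..} \<Longrightarrow> s \<noteq> 0 \<Longrightarrow> dist s 0 < d \<Longrightarrow> norm (S s x - x) < e"
    unfolding eventually_at by blast
  have "norm (S s x - x) \<le> e" if "s \<in> {0..d / 2}" for s
    using d(2)[of s] d(1) that assms by (cases "s = 0") auto
  then show thesis using that[of "d / 2"] d(1) by simp
qed

text \<open>Applying S r to the integral over [0, t] shifts the window to [r, t + r]. The difference
  is an integral over [t, t + r] minus one over [0, r], and after division by r these tend to S t x
  and x.\<close>

lemma generator_mean_integral:
  assumes t: "0 \<le> t" and m: "\<And>k. ((\<lambda>s. inner (S s x) k) has_integral inner m k) {0..t}"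
  shows "m \<in> D" "A m = S t x - x"
proof -
  have "((\<lambda>r. (1 / r) *\<^sub>R (S r m - m)) \<longlongrightarrow> S t x - x) (at_right 0)"
    unfolding tendsto_iff
  proof (intro allI impI)
    fix e :: real assume e: "0 < e"
    obtain d1 where d1: "0 < d1" "\<And>s. s \<in> {0..d1} \<Longrightarrow> norm (S s (S t x) - S t x) \<le> e / 4"
      using C0_semigroup_near_0[of "e / 4"] e by (metis zero_less_divide_iff zero_less_numeral)
    obtain d2 where d2: "0 < d2" "\<And>s. s \<in> {0..d2} \<Longrightarrow> norm (S s x - x) \<le> e / 4"
      using C0_semigroup_near_0[of "e / 4"] e by (metis zero_less_divide_iff zero_less_numeral)
    show "\<forall>\<^sub>F r in at_right 0. dist ((1 / r) *\<^sub>R (S r m - m)) (S t x - x) < e"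
      unfolding eventually_at_right_field
    proof (intro exI[of _ "min d1 d2"] conjI allI impI)
      fix r :: real assume r: "0 < r" "r < min d1 d2"
      have "((\<lambda>s. inner (S (t + s) x - S s x) k) has_integral inner (S r m - m) k) {0..r}" for k
      proof -
        \<comment> \<open>The vector \<open>l\<close> found here is the adjoint of S r applied to
          \<open>k\<close>; it carries S r inside the weak integral.\<close>
        have "bounded_linear (\<lambda>y. inner (S r y) k)"
          by (rule bounded_linear_compose[OF bounded_linear_inner_left blinfun.bounded_linear_right])
        then obtain l where l: "\<And>y. inner (S r y) k = inner y l"
          using riesz_representation by (metis inner_commute)
        let ?f = "\<lambda>s. inner (S s x) k"
        have ii: "?f integrable_on {u..v}" if "0 \<le> u" for u v
          using that by (intro integrable_continuous_real continuous_intros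
              continuous_on_subset[OF S_continuous_on]) auto
        have "((\<lambda>s. inner (S (s + r) x) k) has_integral inner (S r m) k) {0..t}"
        proof (rule has_integral_eq[rotated])
          show "((\<lambda>s. inner (S s x) l) has_integral inner (S r m) k) {0..t}"
            unfolding l by (rule m)
          show "inner (S s x) l = inner (S (s + r) x) k" if "s \<in> {0..t}" for s
            using S_add[of r s x] r that by (simp add: add.commute flip: l)
        qed
        then have 1: "(?f has_integral inner (S r m) k) {r..t + r}"
          using has_integral_shift_Icc_real[of ?f r "inner (S r m) k" 0 t]
          by (simp add: o_def add.commute)
        have "integral {0..r} ?f + integral {r..t + r} ?f = integral {0..t + r} ?f"
          "integral {0..t} ?f + integral {t..t + r} ?f = integral {0..t + r} ?f"
          using r t ii by (auto intro!: Henstock_Kurzweil_Integration.integral_combine)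
        moreover have "integral {r..t + r} ?f = inner (S r m) k" "integral {0..t} ?f = inner m k"
          using 1 m by (auto intro: integral_unique)
        ultimately have "integral {t..t + r} ?f - integral {0..r} ?f = inner (S r m - m) k"
          by (simp add: inner_diff_left)
        moreover have "((\<lambda>s. ?f (t + s)) has_integral integral {t..t + r} ?f) {0..r}"
          using has_integral_shift_Icc_real[of ?f t _ 0 r] integrable_integral[OF ii[OF t]]
          by (simp add: o_def add.commute)
        ultimately show ?thesis
          using has_integral_diff[OF _ integrable_integral[OF ii[of 0 r]]]
          by (fastforce simp: inner_diff_left)
      qed
      then have "norm (S r m - m - (r - 0) *\<^sub>R (S t x - x)) \<le> (e / 2) * (r - 0)"
      proof (rule hilbert_integral_close)
        fix s assume s: "s \<in> {0..r}"
        have "S (t + s) x - S s x - (S t x - x) = (S s (S t x) - S t x) - (S s x - x)"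
          using S_add[of s t x] s t by (simp add: add.commute)
        also have "norm \<dots> \<le> norm (S s (S t x) - S t x) + norm (S s x - x)"
          by (rule norm_triangle_ineq4)
        also have "\<dots> \<le> e / 4 + e / 4" using s r by (intro add_mono d1 d2) auto
        finally show "norm (S (t + s) x - S s x - (S t x - x)) \<le> e / 2" by simp
      qed (use r in simp)
      moreover
      have "(1 / r) *\<^sub>R (S r m - m) - (S t x - x) = (1 / r) *\<^sub>R (S r m - m - (r - 0) *\<^sub>R (S t x - x))"
        using r by (simp add: algebra_simps)
      then have "norm ((1 / r) *\<^sub>R (S r m - m) - (S t x - x)) =
          norm (S r m - m - (r - 0) *\<^sub>R (S t x - x)) / r"
        using r by (simp only: norm_scaleR) simp
      ultimately have "norm ((1 / r) *\<^sub>R (S r m - m) - (S t x - x)) \<le> e / 2"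
        using r by (simp add: pos_divide_le_eq)
      then show "dist ((1 / r) *\<^sub>R (S r m - m)) (S t x - x) < e" using e by (simp add: dist_norm)
    qed (use d1 d2 in simp)
  qed
  from generatorI[OF gen this] show "m \<in> D" "A m = S t x - x" by auto
qed

lemma generator_mean_exists:
  assumes "0 < t"
  obtains m where "\<And>k. ((\<lambda>s. inner (S s x) k) has_integral inner m k) {0..t}"
    "m \<in> D" "A m = S t x - x"
proof -
  obtain m where m: "\<And>k. ((\<lambda>s. inner (S s x) k) has_integral inner m k) {0..t}"
    using hilbert_integral[of 0 t "\<lambda>s. S s x"] assms continuous_on_subset[OF S_continuous_on]
    by (metis Icc_subset_Ici_iff less_imp_le order_refl)
  then show thesis using that[of m] generator_mean_integral[OF _ m] assms by (meson less_imp_le)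
qed

text \<open>The means of the orbit over short intervals lie in the domain and approach the starting
  point.\<close>

lemma generator_dense:
  assumes "0 < e"
  obtains y where "y \<in> D" "norm (y - x) \<le> e"
proof -
  obtain d where d: "0 < d" "\<And>s. s \<in> {0..d} \<Longrightarrow> norm (S s x - x) \<le> e"
    using C0_semigroup_near_0[OF assms] by metis
  obtain m where m: "\<And>k. ((\<lambda>s. inner (S s x) k) has_integral inner m k) {0..d}" "m \<in> D"
    using generator_mean_exists[OF d(1)] by metis
  have close: "norm (m - (d - 0) *\<^sub>R x) \<le> e * (d - 0)"
    using d by (intro hilbert_integral_close[OF m(1)]) auto
  have "((\<lambda>r. (1 / d) *\<^sub>R (1 / r) *\<^sub>R (S r m - m)) \<longlongrightarrow> (1 / d) *\<^sub>R A m) (at_right 0)"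
    using gen m(2) by (intro tendsto_intros) (auto simp: is_generator_def)
  then have "((\<lambda>r. (1 / r) *\<^sub>R (S r ((1 / d) *\<^sub>R m) - (1 / d) *\<^sub>R m)) \<longlongrightarrow> (1 / d) *\<^sub>R A m) (at_right 0)"
    by (simp add: blinfun.scaleR_right scaleR_diff_right mult.commute)
  then have "(1 / d) *\<^sub>R m \<in> D" by (rule generatorI[OF gen])
  moreover have "norm ((1 / d) *\<^sub>R m - x) \<le> e"
  proof -
    have "(1 / d) *\<^sub>R m - x = (1 / d) *\<^sub>R (m - (d - 0) *\<^sub>R x)"
      using d(1) by (simp add: algebra_simps)
    then have "norm ((1 / d) *\<^sub>R m - x) = norm (m - (d - 0) *\<^sub>R x) / d"
      using d(1) by (simp only: norm_scaleR) simp
    also have "\<dots> \<le> e" using close d(1) by (simp add: pos_divide_le_eq)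
    finally show ?thesis .
  qed
  ultimately show thesis using that by blast
qed

text \<open>Two candidates differ by a vector orthogonal to the dense domain. This is what makes the
  definite description in \<open>adj_op\<close> denote.\<close>

lemma adjoint_unique:
  assumes "\<forall>x\<in>D. inner (A x) v = inner x w" "\<forall>x\<in>D. inner (A x) v = inner x w'"
  shows "w = w'"
proof (rule ccontr)
  assume "w \<noteq> w'"
  then have pos: "0 < norm (w - w')" by simp
  obtain y where y: "y \<in> D" "norm (y - (w - w')) \<le> norm (w - w') / 2"
    using generator_dense[of "norm (w - w') / 2" "w - w'"] pos by auto
  have 0: "inner y (w - w') = 0" using assms y(1) by (simp add: inner_diff_right)
  have "norm (w - w') * norm (w - w') = inner (w - w' - y) (w - w')"
    using 0 by (simp add: inner_diff_left dot_square_norm power2_eq_square)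
  also have "\<dots> \<le> norm (w - w' - y) * norm (w - w')" by (rule norm_cauchy_schwarz)
  also have "\<dots> \<le> (norm (w - w') / 2) * norm (w - w')"
    using y(2) by (intro mult_right_mono) (auto simp: norm_minus_commute)
  finally show False using mult_pos_pos[OF pos pos] by simp
qed

lemma adj_op_eqI:
  assumes "\<forall>x\<in>D. inner (A x) v = inner x w"
  shows "adj_op D A v = w"
  unfolding adj_op_def by (rule the_equality) (use assms adjoint_unique in auto)

lemma inner_adj_op:
  assumes "v \<in> adj_dom D A" "x \<in> D"
  shows "inner (A x) v = inner x (adj_op D A v)"
  using assms adj_op_eqI unfolding adj_dom_def by blast

end


section \<open>The inverse of the extrapolated generator\<close>

locale extrapolated_semigroup =
  fixes D0 :: "'h::{real_inner, complete_space} set"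
    and A0 :: "'h \<Rightarrow> 'h"
    and S0 :: "real \<Rightarrow> 'h \<Rightarrow>\<^sub>L 'h"
    and J :: "'v::{real_inner, complete_space} \<Rightarrow> 'h"
    and D :: "('v \<Rightarrow>\<^sub>L real) set"
    and A :: "('v \<Rightarrow>\<^sub>L real) \<Rightarrow> ('v \<Rightarrow>\<^sub>L real)"
    and S :: "real \<Rightarrow> ('v \<Rightarrow>\<^sub>L real) \<Rightarrow>\<^sub>L ('v \<Rightarrow>\<^sub>L real)"
  assumes C0_0: "C0_semigroup S0" and gen_0: "is_generator D0 A0 S0"
    and rep: "represents_dom J (adj_dom D0 A0) (adj_op D0 A0)"
    and C0: "C0_semigroup S" and gen: "is_generator D A S"
    and ext: "\<And>t x. 0 \<le> t \<Longrightarrow> S t (embed_dual J x) = embed_dual J (S0 t x)"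
    and res: "0 \<in> resolvent_set (adj_dom D0 A0) (adj_op D0 A0)"
begin

sublocale bounded_C0_semigroup S
  using C0 C0_semigroup_locally_bounded[OF C0] by unfold_locales

abbreviation E :: "'h \<Rightarrow> 'v \<Rightarrow>\<^sub>L real" where "E \<equiv> embed_dual J"

text \<open>A_0^* transported to the type that represents V. Since 0 is in the resolvent set, it is
  an isomorphism of V onto H, with inverse \<open>G\<close>.\<close>

definition K :: "'v \<Rightarrow> 'h" where "K v = adj_op D0 A0 (J v)"

abbreviation inv_adj :: "'h \<Rightarrow> 'h" where
  "inv_adj \<equiv> inv_into (adj_dom D0 A0) (adj_op D0 A0)"

lemma linear_J: "linear J" and J_in: "J v \<in> adj_dom D0 A0"
  and J_surj: "h \<in> adj_dom D0 A0 \<Longrightarrow> \<exists>v. h = J v"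
  and inner_V: "inner v w = inner (J v) (J w) + inner (K v) (K w)"
  using rep unfolding represents_dom_def K_def by auto

lemma bij_adj: "bij_betw (adj_op D0 A0) (adj_dom D0 A0) UNIV"
  and bounded_linear_inv_adj: "bounded_linear inv_adj"
  using res unfolding resolvent_set_def by simp_all

lemma E_apply: "E h v = inner h (J v)"
  by (rule embed_dual_apply[OF rep])

lemma inner_K: "x \<in> D0 \<Longrightarrow> inner (A0 x) (J v) = inner x (K v)"
  unfolding K_def by (rule inner_adj_op[OF C0_0 gen_0 J_in])

lemma K_eqI: "(\<And>x. x \<in> D0 \<Longrightarrow> inner (A0 x) (J v) = inner x w) \<Longrightarrow> K v = w"
  unfolding K_def by (rule adj_op_eqI[OF C0_0 gen_0]) blast

lemma linear_K: "linear K"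
proof (rule linearI)
  show "K (v + w) = K v + K w" for v w
    by (rule K_eqI) (simp add: linear_add[OF linear_J] inner_add_right inner_K)
  show "K (r *\<^sub>R v) = r *\<^sub>R K v" for r v
    by (rule K_eqI) (simp add: linear_scale[OF linear_J] inner_K)
qed

lemma norm_V: "(norm v)\<^sup>2 = (norm (J v))\<^sup>2 + (norm (K v))\<^sup>2"
  by (simp add: power2_norm_eq_inner inner_V)

lemma norm_K_le: "norm (K v) \<le> norm v"
  by (rule power2_le_imp_le) (simp_all add: norm_V)

lemma bounded_linear_K: "bounded_linear K"
  by (rule bounded_linear_intro[where K = 1])
    (simp_all add: linear_add[OF linear_K] linear_scale[OF linear_K] norm_K_le)

lemma inv_adj_K: "inv_adj (K v) = J v"
  unfolding K_def using bij_adj J_in by (simp add: bij_betw_def)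

lemma norm_J_le_K: "norm (J v) \<le> onorm inv_adj * norm (K v)"
  using onorm[OF bounded_linear_inv_adj, of "K v"] by (simp add: inv_adj_K)

lemma K_surj: "\<exists>v. K v = k"
proof -
  have "inv_adj k \<in> adj_dom D0 A0"
    using bij_adj by (metis UNIV_I bij_betw_def inv_into_into)
  then obtain v where "inv_adj k = J v" using J_surj by blast
  then show ?thesis
    using bij_adj unfolding K_def by (metis UNIV_I bij_betw_inv_into_right)
qed

lemma K_inj: "K v = 0 \<Longrightarrow> v = 0"
  using norm_J_le_K[of v] norm_V[of v] by simp

text \<open>The inverse of A_0^* with values in V; it is bounded because the square of the graph
  norm of G k is |J (G k)|^2 + |k|^2.\<close>

definition G :: "'h \<Rightarrow> 'v" where "G k = (SOME v. K v = k)"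

lemma K_G [simp]: "K (G k) = k"
  unfolding G_def using K_surj by (rule someI_ex)

lemma G_K [simp]: "G (K v) = v"
  using K_inj[of "G (K v) - v"] by (simp add: linear_diff[OF linear_K])

lemma bounded_linear_G: "bounded_linear G"
proof (rule bounded_linear_intro[where K = "sqrt ((onorm inv_adj)\<^sup>2 + 1)"])
  show "G (k + l) = G k + G l" for k l
    using G_K[of "G k + G l"] by (simp add: linear_add[OF linear_K])
  show "G (r *\<^sub>R k) = r *\<^sub>R G k" for r k
    using G_K[of "r *\<^sub>R G k"] by (simp add: linear_scale[OF linear_K])
  show "norm (G k) \<le> norm k * sqrt ((onorm inv_adj)\<^sup>2 + 1)" for k
  proof (rule power2_le_imp_le)
    have "(norm (J (G k)))\<^sup>2 \<le> (onorm inv_adj * norm k)\<^sup>2"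
      using norm_J_le_K[of "G k"] by (simp add: power_mono)
    then show "(norm (G k))\<^sup>2 \<le> (norm k * sqrt ((onorm inv_adj)\<^sup>2 + 1))\<^sup>2"
      by (simp add: norm_V[of "G k"] power_mult_distrib algebra_simps)
  qed simp
qed

text \<open>The dual of \<open>K\<close>, that is, A_0 extended to all of H with values in V'. It is
  an isomorphism of H onto V', and \<open>A_E\<close> identifies it with A on the embedded
  H.\<close>

definition L :: "'h \<Rightarrow> 'v \<Rightarrow>\<^sub>L real" where "L h = Blinfun (\<lambda>v. inner h (K v))"

lemma L_apply: "L h v = inner h (K v)"
  unfolding L_def
  by (simp add: bounded_linear_Blinfun_apply bounded_linear_inner_right_comp bounded_linear_K)

lemma norm_L_le: "norm (L h) \<le> norm h"
proof (rule norm_blinfun_bound)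
  show "norm (L h v) \<le> norm h * norm v" for v
    using Cauchy_Schwarz_ineq2[of h "K v"] mult_left_mono[OF norm_K_le[of v], of "norm h"]
    by (simp add: L_apply)
qed simp

lemma L_diff: "L (g - h) = L g - L h" and L_scale: "L (r *\<^sub>R h) = r *\<^sub>R L h"
  by (auto intro!: blinfun_eqI simp: L_apply blinfun.diff_left blinfun.scaleR_left inner_diff_left)

lemma E_diff: "E (g - h) = E g - E h" and E_scale: "E (r *\<^sub>R h) = r *\<^sub>R E h"
  by (auto intro!: blinfun_eqI simp: E_apply blinfun.diff_left blinfun.scaleR_left inner_diff_left)

lemma L_surj: obtains h where "L h = y"
proof -
  have "bounded_linear (\<lambda>k. y (G k))"
    by (rule bounded_linear_compose[OF blinfun.bounded_linear_right bounded_linear_G])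
  then obtain h where h: "\<And>k. y (G k) = inner h k" using riesz_representation by blast
  have "L h = y" by (rule blinfun_eqI) (simp add: L_apply flip: h)
  then show thesis by (rule that)
qed

lemma norm_le_L:
  obtains C where "0 < C" "\<And>h. norm h \<le> C * norm (L h)"
proof -
  obtain C where C: "0 < C" "\<And>k. norm (G k) \<le> norm k * C"
    using bounded_linear.pos_bounded[OF bounded_linear_G] by blast
  have "norm h \<le> C * norm (L h)" for h
  proof -
    have "norm h * norm h = L h (G h)" by (simp add: L_apply dot_square_norm power2_eq_square)
    also have "\<dots> \<le> norm (L h) * norm (G h)" using norm_blinfun[of "L h" "G h"] by simp
    also have "\<dots> \<le> norm (L h) * (norm h * C)" by (intro mult_left_mono C) simp
    finally have "norm h * norm h \<le> (C * norm (L h)) * norm h" by (simp add: mult_ac)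
    then show ?thesis using C(1) by (cases "h = 0") auto
  qed
  then show thesis using that C(1) by blast
qed

text \<open>The sharp constant of the smallness condition. E h is L h composed with v \<mapsto> G (J
  v), which is the inverse of A_0^* acting on V. This inverse commutes with A_0^*, so both parts of
  the graph norm shrink by its norm on H, and no larger constant enters.\<close>

lemma norm_E_le: "norm (E h) \<le> onorm inv_adj * norm (L h)"
proof (rule norm_blinfun_bound)
  have N: "0 \<le> onorm inv_adj" by (rule onorm_pos_le[OF bounded_linear_inv_adj])
  then show "0 \<le> onorm inv_adj * norm (L h)" by simp
  fix v
  let ?w = "G (J v)"
  have "norm ?w \<le> onorm inv_adj * norm v"
  proof (rule power2_le_imp_le)
    have "(norm (J ?w))\<^sup>2 \<le> (onorm inv_adj * norm (J v))\<^sup>2"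
      using norm_J_le_K[of ?w] by (simp add: power_mono)
    moreover have "(norm (K ?w))\<^sup>2 \<le> (onorm inv_adj * norm (K v))\<^sup>2"
      using norm_J_le_K[of v] by (simp add: power_mono)
    ultimately show "(norm ?w)\<^sup>2 \<le> (onorm inv_adj * norm v)\<^sup>2"
      by (simp add: norm_V[of ?w] norm_V[of v] power_mult_distrib algebra_simps)
  qed (use N in simp)
  have "norm (E h v) = norm (L h ?w)" by (simp add: E_apply L_apply)
  also have "\<dots> \<le> norm (L h) * norm ?w" by (rule norm_blinfun)
  also have "\<dots> \<le> norm (L h) * (onorm inv_adj * norm v)"
    by (intro mult_left_mono) (use \<open>norm ?w \<le> _\<close> in auto)
  finally show "norm (E h v) \<le> onorm inv_adj * norm (L h) * norm v" by (simp add: mult_ac)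
qed

text \<open>With m the integral of the orbit of h over [0, t], S0 t h - h = A0 m, and A0 m embeds as
  L m. Since m / t tends to h, the difference quotient of E h tends to L h, even for h outside the
  domain of A0.\<close>

lemma E_in_D: "E h \<in> D" and A_E: "A (E h) = L h"
proof -
  have "((\<lambda>t. (1 / t) *\<^sub>R (S t (E h) - E h)) \<longlongrightarrow> L h) (at_right 0)"
    unfolding tendsto_iff
  proof (intro allI impI)
    fix e :: real assume e: "0 < e"
    obtain d where d: "0 < d" "\<And>s. s \<in> {0..d} \<Longrightarrow> norm (S0 s h - h) \<le> e / 2"
      using C0_semigroup_near_0[OF C0_0 gen_0, of "e / 2"] e by (metis half_gt_zero)
    show "\<forall>\<^sub>F t in at_right 0. dist ((1 / t) *\<^sub>R (S t (E h) - E h)) (L h) < e"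
      unfolding eventually_at_right_field
    proof (intro exI[of _ d] conjI allI impI)
      fix t assume t: "0 < t" "t < d"
      obtain m where m: "\<And>k. ((\<lambda>s. inner (S0 s h) k) has_integral inner m k) {0..t}"
        "m \<in> D0" "A0 m = S0 t h - h"
        using generator_mean_exists[OF C0_0 gen_0 t(1)] by metis
      have "norm (m - (t - 0) *\<^sub>R h) \<le> e / 2 * (t - 0)"
        using d t by (intro hilbert_integral_close[OF m(1)]) auto
      then have "norm ((1 / t) *\<^sub>R (m - t *\<^sub>R h)) \<le> e / 2"
        using t by (simp only: norm_scaleR) (simp add: pos_divide_le_eq)
      moreover have "(1 / t) *\<^sub>R (m - t *\<^sub>R h) = (1 / t) *\<^sub>R m - h"
        using t by (simp add: scaleR_diff_right)
      ultimately have close: "norm ((1 / t) *\<^sub>R m - h) \<le> e / 2" by simp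
      have "E (S0 t h - h) = L m"
        by (rule blinfun_eqI) (simp add: E_apply L_apply inner_K[OF m(2)] flip: m(3))
      then have "(1 / t) *\<^sub>R (S t (E h) - E h) - L h = L ((1 / t) *\<^sub>R m - h)"
        using t by (simp add: ext L_diff L_scale E_diff)
      then have "norm ((1 / t) *\<^sub>R (S t (E h) - E h) - L h) \<le> e / 2"
        using norm_L_le[of "(1 / t) *\<^sub>R m - h"] close by simp
      then show "dist ((1 / t) *\<^sub>R (S t (E h) - E h)) (L h) < e" using e by (simp add: dist_norm)
    qed (rule d)
  qed
  from generatorI[OF gen this] show "E h \<in> D" "A (E h) = L h" by auto
qed

lemma S_L: "0 \<le> t \<Longrightarrow> S t (L h) = L (S0 t h)"
  using generator_commute(2)[OF gen E_in_D, of t h] by (simp add: A_E ext)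

text \<open>\<open>L\<close> conjugates \<open>S\<close> on V' with \<open>S0\<close> on H and is
  bounded below, so A z = 0 pulls back to A0 h = 0 with h in the domain. Then h is orthogonal to the
  range of A_0^*, which is all of H.\<close>

lemma A_inj:
  assumes z: "z \<in> D" "A z = 0"
  shows "z = 0"
proof -
  obtain h where h: "L h = z" by (rule L_surj)
  obtain C where C: "0 < C" "\<And>h. norm h \<le> C * norm (L h)" by (rule norm_le_L) blast
  interpret S0: bounded_C0_semigroup S0
    using C0_0 C0_semigroup_locally_bounded[OF C0_0] by unfold_locales
  have "((\<lambda>t. (1 / t) *\<^sub>R (S0 t h - h)) \<longlongrightarrow> 0) (at_right 0)"
  proof (rule Lim_null_comparison)
    show "\<forall>\<^sub>F t in at_right 0. norm ((1 / t) *\<^sub>R (S0 t h - h)) \<le> C * norm ((1 / t) *\<^sub>R (S t z - z))"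
      unfolding eventually_at_right_field
    proof (intro exI[of _ 1] conjI allI impI)
      fix t :: real assume "0 < t"
      then have "L ((1 / t) *\<^sub>R (S0 t h - h)) = (1 / t) *\<^sub>R (S t z - z)"
        using S_L[of t h] by (simp add: L_scale L_diff h)
      then show "norm ((1 / t) *\<^sub>R (S0 t h - h)) \<le> C * norm ((1 / t) *\<^sub>R (S t z - z))"
        using C(2) by metis
    qed simp
    have "((\<lambda>t. (1 / t) *\<^sub>R (S t z - z)) \<longlongrightarrow> A z) (at_right 0)"
      using gen z(1) unfolding is_generator_def by blast
    then have "((\<lambda>t. (1 / t) *\<^sub>R (S t z - z)) \<longlongrightarrow> 0) (at_right 0)" using z(2) by simp
    then show "((\<lambda>t. C * norm ((1 / t) *\<^sub>R (S t z - z))) \<longlongrightarrow> 0) (at_right 0)"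
      by (intro tendsto_mult_right_zero tendsto_norm_zero)
  qed
  from S0.generatorI[OF gen_0 this] have "h \<in> D0" "A0 h = 0" by auto
  then have "inner h (K (G h)) = 0" using inner_K[of h "G h"] by simp
  then have "h = 0" by simp
  then have "norm z \<le> 0" using norm_L_le[of h] h by simp
  then show ?thesis by simp
qed

lemma A_surj: "\<exists>x\<in>D. A x = y"
proof -
  obtain h where "L h = y" by (rule L_surj)
  then show ?thesis using E_in_D[of h] A_E[of h] by (intro bexI[of _ "E h"]) simp_all
qed

lemma A_eq_iff:
  assumes "x \<in> D" "y \<in> D"
  shows "A x = A y \<longleftrightarrow> x = y"
proof
  assume "A x = A y"
  then have "A (x - y) = 0" using generator_diff(2)[OF gen assms] by simp
  with generator_diff(1)[OF gen assms] have "x - y = 0" by (rule A_inj)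
  then show "x = y" by simp
qed simp

lemma norm_diff_le_A:
  assumes "x \<in> D" "y \<in> D"
  shows "norm (x - y) \<le> onorm inv_adj * norm (A x - A y)"
proof -
  obtain h where h: "L h = A x - A y" by (rule L_surj)
  have "E h = x - y"
    using h A_eq_iff[OF E_in_D generator_diff(1)[OF gen assms]] generator_diff(2)[OF gen assms]
    by (simp add: A_E)
  then show ?thesis using norm_E_le[of h] h by simp
qed

end

section \<open>Strong integrals\<close>

lemma complete_measure_lebesgue_on:
  assumes X: "X \<in> sets lebesgue"
  shows "complete_measure (lebesgue_on X)"
proof
  fix A B assume "B \<subseteq> A" "A \<in> null_sets (lebesgue_on X)"
  then have "A \<in> null_sets lebesgue" "B \<subseteq> A" "A \<subseteq> X" using X by (auto simp: null_sets_restrict_space)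
  then have "B \<in> sets lebesgue" "B = X \<inter> B" using completion.complete by blast+
  then show "B \<in> sets (lebesgue_on X)" by (auto simp: sets_restrict_space)
qed

lemma (in complete_measure) borel_measurable_cong_AE_imp:
  assumes g: "g \<in> borel_measurable M" and ae: "AE x in M. f x = g x"
  shows "f \<in> borel_measurable M"
proof (rule measurableI)
  fix T :: "'b set" assume "T \<in> sets borel"
  then have "g -` T \<inter> space M \<in> sets M" using g by (rule measurable_sets[rotated])
  then show "f -` T \<inter> space M \<in> sets M"
    by (rule in_sets_AE[rotated]) (use ae in auto)
qed simp

text \<open>The simple functions are set to 0 on a measurable null set containing the exceptional
  points; their limit is Borel, and completeness of the measure carries this back to
  \<open>f\<close>.\<close>

lemma (in complete_measure) strongly_measurable_imp_borel:
  fixes f :: "'a \<Rightarrow> 'b::real_normed_vector"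
  assumes "strongly_measurable M f"
  shows "f \<in> borel_measurable M"
proof -
  obtain s where s: "\<And>i. simple_function M (s i)" "AE x in M. (\<lambda>i. s i x) \<longlonglongrightarrow> f x"
    using assms unfolding strongly_measurable_def by blast
  then obtain N where N: "{x \<in> space M. \<not> (\<lambda>i. s i x) \<longlonglongrightarrow> f x} \<subseteq> N" "N \<in> null_sets M"
    by (auto elim!: AE_E intro: null_setsI)
  define g where "g x = (if x \<in> N then 0 else f x)" for x
  have "g \<in> borel_measurable M"
  proof (rule borel_measurable_LIMSEQ_metric)
    show "(\<lambda>x. if x \<in> N then 0 else s i x) \<in> borel_measurable M" for i
      using borel_measurable_simple_function[OF s(1)] N(2) by (intro measurable_If_set) auto
    show "(\<lambda>i. if x \<in> N then 0 else s i x) \<longlonglongrightarrow> g x" if "x \<in> space M" for x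
      using that N(1) by (auto simp: g_def)
  qed
  moreover have "AE x in M. f x = g x"
    using AE_not_in[OF N(2)] by eventually_elim (simp add: g_def)
  ultimately show ?thesis by (rule borel_measurable_cong_AE_imp)
qed

lemma strongly_measurable_simple: "simple_function M f \<Longrightarrow> strongly_measurable M f"
  unfolding strongly_measurable_def by (intro exI[of _ "\<lambda>_. f"]) auto

lemma strongly_measurable_diff:
  assumes "strongly_measurable M f" "strongly_measurable M g"
  shows "strongly_measurable M (\<lambda>x. f x - g x)"
proof -
  obtain s t where s: "\<And>i. simple_function M (s i)" "AE x in M. (\<lambda>i. s i x) \<longlonglongrightarrow> f x"
    and t: "\<And>i. simple_function M (t i)" "AE x in M. (\<lambda>i. t i x) \<longlonglongrightarrow> g x"
    using assms unfolding strongly_measurable_def by blast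
  have "AE x in M. (\<lambda>i. s i x - t i x) \<longlonglongrightarrow> f x - g x"
    using s(2) t(2) by eventually_elim (rule tendsto_diff)
  moreover have "simple_function M (\<lambda>x. s i x - t i x)" for i
    using s(1) t(1) by (rule simple_function_compose2)
  ultimately show ?thesis
    unfolding strongly_measurable_def by (intro exI[of _ "\<lambda>i x. s i x - t i x"]) blast
qed

text \<open>Passes to simple functions for \<open>lborel\<close>, where translations and product
  measures are available. Each Lebesgue simple function is changed on a null set, and countably many
  such sets are still negligible.\<close>

lemma strongly_measurable_lebesgue_on_iff:
  fixes f :: "real \<Rightarrow> 'b::real_normed_vector"
  assumes X: "X \<in> sets lebesgue"
  shows "strongly_measurable (lebesgue_on X) f \<longleftrightarrow>
    (\<exists>s. (\<forall>i. simple_function lborel (s i)) \<and> (AE x in lborel. x \<in> X \<longrightarrow> (\<lambda>i. s i x) \<longlonglongrightarrow> f x))"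
    (is "?l \<longleftrightarrow> ?r")
proof
  assume ?l
  then obtain s where s: "\<And>i. simple_function (lebesgue_on X) (s i)"
    "AE x in lebesgue. x \<in> X \<longrightarrow> (\<lambda>i. s i x) \<longlonglongrightarrow> f x"
    using X unfolding strongly_measurable_def by (auto simp: AE_restrict_space_iff)
  have "simple_function lebesgue (\<lambda>x. indicator X x *\<^sub>R s i x)" for i
    using s(1)[of i] X by (simp add: simple_function_restrict_space)
  then have "\<forall>i. \<exists>s'. simple_function lborel s' \<and> (AE x in lborel. indicator X x *\<^sub>R s i x = s' x)"
    using completion_ex_simple_function by blast
  then obtain s' where s': "\<And>i. simple_function lborel (s' i)"
    "\<And>i. AE x in lborel. indicator X x *\<^sub>R s i x = s' i x"
    by metis
  from s'(2) have "AE x in lborel. \<forall>i. indicator X x *\<^sub>R s i x = s' i x"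
    by (simp add: AE_all_countable)
  moreover have "AE x in lborel. x \<in> X \<longrightarrow> (\<lambda>i. s i x) \<longlonglongrightarrow> f x"
    using s(2) by (simp add: AE_completion_iff)
  ultimately have "AE x in lborel. x \<in> X \<longrightarrow> (\<lambda>i. s' i x) \<longlonglongrightarrow> f x"
  proof eventually_elim
    case (elim x)
    show ?case
    proof
      assume "x \<in> X"
      then have "s' i x = s i x" for i using elim(1)[rule_format, of i] by simp
      then show "(\<lambda>i. s' i x) \<longlonglongrightarrow> f x" using elim(2) \<open>x \<in> X\<close> by simp
    qed
  qed
  then show ?r using s'(1) by blast
next
  assume ?r
  then obtain s where s: "\<And>i. simple_function lborel (s i)"
    "AE x in lborel. x \<in> X \<longrightarrow> (\<lambda>i. s i x) \<longlonglongrightarrow> f x" by blast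
  have "simple_function (lebesgue_on X) (s i)" for i
  proof -
    have "simple_function lebesgue (\<lambda>x. (if x \<in> X then 1 else 0) *\<^sub>R s i x)"
      using simple_function_completion[OF s(1)] X
      by (intro simple_function_compose2[where h = "\<lambda>a b. a *\<^sub>R b"] simple_function_If_set) auto
    then show ?thesis using X by (simp add: simple_function_restrict_space indicator_def of_bool_def)
  qed
  moreover have "AE x in lebesgue_on X. (\<lambda>i. s i x) \<longlonglongrightarrow> f x"
    using s(2) X by (simp add: AE_restrict_space_iff AE_completion_iff)
  ultimately show ?l unfolding strongly_measurable_def by blast
qed

text \<open>A functional maps the approximating simple functions to approximating simple functions
  of F \<circ> f. This is the passage to scalar Bochner integrals, on which later computations
  rest.\<close>

lemma has_strong_integral_functional:
  fixes F :: "'b::real_normed_vector \<Rightarrow> real"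
  assumes M: "complete_measure M" and I: "has_strong_integral M f I" and F: "bounded_linear F"
  shows "has_bochner_integral M (\<lambda>x. F (f x)) (F I)"
proof -
  interpret F: bounded_linear F by fact
  interpret complete_measure M by fact
  obtain C where C: "0 < C" "\<And>x. norm (F x) \<le> norm x * C" using F.pos_bounded by blast
  obtain s where f: "strongly_measurable M f"
    and s: "\<And>i. Bochner_Integration.simple_bochner_integrable M (s i)"
    and lim: "(\<lambda>i. \<integral>\<^sup>+x. norm (f x - s i x) \<partial>M) \<longlonglongrightarrow> 0"
    and sI: "(\<lambda>i. Bochner_Integration.simple_bochner_integral M (s i)) \<longlonglongrightarrow> I"
    using I unfolding has_strong_integral_def by blast
  note [measurable] = strongly_measurable_imp_borel[OF f]
  have [measurable]: "s i \<in> borel_measurable M" for i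
    using s[of i] by (auto elim!: Bochner_Integration.simple_bochner_integrable.cases
        intro: borel_measurable_simple_function)
  show ?thesis
  proof (rule has_bochner_integral.intros)
    have "F \<in> borel_measurable borel"
      by (intro borel_measurable_continuous_onI linear_continuous_on F)
    then show "(\<lambda>x. F (f x)) \<in> borel_measurable M" by measurable
    show "Bochner_Integration.simple_bochner_integrable M (\<lambda>x. F (s i x))" for i
      using simple_bochner_integrable_compose2[where p = "\<lambda>x y. F x", OF F.zero s s] .
    show "(\<lambda>i. Bochner_Integration.simple_bochner_integral M (\<lambda>x. F (s i x))) \<longlonglongrightarrow> F I"
      using F.tendsto[OF sI] simple_bochner_integral_linear[OF F.linear_axioms s] by simp
    show "(\<lambda>i. \<integral>\<^sup>+x. ennreal (norm (F (f x) - F (s i x))) \<partial>M) \<longlonglongrightarrow> 0"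
    proof (rule tendsto_sandwich[OF always_eventually[OF allI[OF zero_le]] _ tendsto_const])
      show "\<forall>\<^sub>F i in sequentially. (\<integral>\<^sup>+x. ennreal (norm (F (f x) - F (s i x))) \<partial>M) \<le>
          (\<integral>\<^sup>+x. ennreal C * ennreal (norm (f x - s i x)) \<partial>M)"
        using C by (intro always_eventually allI nn_integral_mono)
          (auto simp: mult.commute ennreal_mult[symmetric] intro!: ennreal_leI simp flip: F.diff real_norm_def)
      have "(\<integral>\<^sup>+x. ennreal C * ennreal (norm (f x - s i x)) \<partial>M) = ennreal C * (\<integral>\<^sup>+x. norm (f x - s i x) \<partial>M)" for i
      proof (rule nn_integral_cmult)
        have "strongly_measurable M (\<lambda>x. f x - s i x)"
          using f s[of i]
          by (auto elim!: Bochner_Integration.simple_bochner_integrable.cases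
              intro: strongly_measurable_diff strongly_measurable_simple)
        note [measurable] = strongly_measurable_imp_borel[OF this]
        show "(\<lambda>x. ennreal (norm (f x - s i x))) \<in> borel_measurable M" by measurable
      qed
      then show "(\<lambda>i. \<integral>\<^sup>+x. ennreal C * ennreal (norm (f x - s i x)) \<partial>M) \<longlonglongrightarrow> 0"
        using ennreal_tendsto_cmult[OF _ lim, of "ennreal C"] by simp
    qed
  qed
qed


text \<open>For values in a dual space the candidate is explicit, v \<mapsto> \<integral> f x v.
  Integrals of truncated simple functions converge to it in norm by dominated convergence.\<close>

lemma has_strong_integral_exists:
  fixes f :: "'a \<Rightarrow> ('v::real_normed_vector \<Rightarrow>\<^sub>L real)"
  assumes M: "complete_measure M" and f: "strongly_measurable M f"
    and fin: "(\<integral>\<^sup>+x. norm (f x) \<partial>M) < \<infinity>"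
  shows "\<exists>I. has_strong_integral M f I"
proof -
  interpret complete_measure M by fact
  note f_meas [measurable] = strongly_measurable_imp_borel[OF f]
  obtain s where s: "\<And>i. simple_function M (s i)" "AE x in M. (\<lambda>i. s i x) \<longlonglongrightarrow> f x"
    using f unfolding strongly_measurable_def by blast
  have [measurable]: "s i \<in> borel_measurable M" for i
    by (rule borel_measurable_simple_function[OF s(1)])
  \<comment> \<open>The cut gives the integrable majorant 3 |f| for |f - r i|. As 2 > 1, it is
    eventually inactive wherever s i x converges to f x and f x is nonzero.\<close>
  define r where "r i x = (if norm (s i x) \<le> 2 * norm (f x) then s i x else 0)" for i x
  have r_simple: "simple_function M (r i)" for i
    unfolding r_def[abs_def]
  proof (rule simple_function_If[OF s(1)])
    show "{x \<in> space M. norm (s i x) \<le> 2 * norm (f x)} \<in> sets M" by measurable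
  qed simp
  have r_bound: "norm (r i x) \<le> 2 * norm (f x)" for i x by (simp add: r_def)
  have r_lim: "AE x in M. (\<lambda>i. r i x) \<longlonglongrightarrow> f x"
    using s(2)
  proof eventually_elim
    case (elim x)
    show ?case
    proof (cases "f x = 0")
      case True
      then have "r i x = 0" for i by (simp add: r_def)
      then show ?thesis using True by simp
    next
      case False
      then have "\<forall>\<^sub>F i in sequentially. norm (s i x) < 2 * norm (f x)"
        by (intro order_tendstoD(2)[OF tendsto_norm[OF elim]]) simp
      then have "\<forall>\<^sub>F i in sequentially. s i x = r i x"
        by eventually_elim (simp add: r_def)
      with elim show ?thesis by (rule Lim_transform_eventually)
    qed
  qed
  have diff_meas: "(\<lambda>x. f x - r i x) \<in> borel_measurable M" for i
    by (intro strongly_measurable_imp_borel strongly_measurable_diff f strongly_measurable_simple r_simple)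
  have "(\<integral>\<^sup>+x. norm (r i x) \<partial>M) \<le> (\<integral>\<^sup>+x. 2 * ennreal (norm (f x)) \<partial>M)" for i
    by (intro nn_integral_mono)
      (use r_bound ennreal_leI in \<open>fastforce simp: ennreal_mult' simp flip: ennreal_numeral\<close>)
  also have "(\<integral>\<^sup>+x. 2 * ennreal (norm (f x)) \<partial>M) < \<infinity>"
    using fin by (subst nn_integral_cmult) (auto simp: ennreal_mult_less_top)
  finally have r_int: "Bochner_Integration.simple_bochner_integrable M (r i)" for i
    by (intro simple_bochner_integrableI_bounded r_simple) auto
  have lim: "(\<lambda>i. \<integral>\<^sup>+x. norm (f x - r i x) \<partial>M) \<longlonglongrightarrow> (\<integral>\<^sup>+x. 0 \<partial>M)"
  proof (rule nn_integral_dominated_convergence[where w = "\<lambda>x. 3 * ennreal (norm (f x))"])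
    show "(\<lambda>x. ennreal (norm (f x - r i x))) \<in> borel_measurable M" for i
      using diff_meas[of i] by measurable
    show "(\<integral>\<^sup>+x. 3 * ennreal (norm (f x)) \<partial>M) < \<infinity>"
      using fin by (subst nn_integral_cmult) (auto simp: ennreal_mult_less_top)
    show "AE x in M. ennreal (norm (f x - r i x)) \<le> 3 * ennreal (norm (f x))" for i
    proof (rule AE_I2)
      fix x
      have "norm (f x - r i x) \<le> 3 * norm (f x)"
        using norm_triangle_ineq4[of "f x" "r i x"] r_bound[of i x] by simp
      from ennreal_leI[OF this] show "ennreal (norm (f x - r i x)) \<le> 3 * ennreal (norm (f x))"
        by (simp add: ennreal_mult')
    qed
    show "AE x in M. (\<lambda>i. ennreal (norm (f x - r i x))) \<longlonglongrightarrow> 0"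
      using r_lim
    proof eventually_elim
      case (elim x)
      have "(\<lambda>i. norm (f x - r i x)) \<longlonglongrightarrow> norm (f x - f x)" by (intro tendsto_intros elim)
      then show ?case using tendsto_ennrealI by fastforce
    qed
  qed auto
  have fv: "integrable M (\<lambda>x. f x v)" for v
  proof (rule integrableI_bounded)
    have "(\<lambda>\<phi>::'v \<Rightarrow>\<^sub>L real. blinfun_apply \<phi> v) \<in> borel_measurable borel"
      by (intro borel_measurable_continuous_onI linear_continuous_on blinfun.bounded_linear_left)
    then show "(\<lambda>x. f x v) \<in> borel_measurable M" by measurable
    have "(\<integral>\<^sup>+x. norm (f x v) \<partial>M) \<le> (\<integral>\<^sup>+x. ennreal (norm v) * ennreal (norm (f x)) \<partial>M)"
    proof (rule nn_integral_mono)
      show "ennreal (norm (f x v)) \<le> ennreal (norm v) * ennreal (norm (f x))" for x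
        using ennreal_leI[OF norm_blinfun[of "f x" v]] by (simp add: ennreal_mult' mult.commute)
    qed
    also have "\<dots> < \<infinity>"
      using fin by (subst nn_integral_cmult) (auto simp: ennreal_mult_less_top)
    finally show "(\<integral>\<^sup>+x. ennreal (norm (f x v)) \<partial>M) < \<infinity>" .
  qed
  have f_int: "integrable M (\<lambda>x. norm (f x))"
    using fin by (intro integrableI_bounded) auto
  define I where "I = Blinfun (\<lambda>v. \<integral>x. f x v \<partial>M)"
  have "bounded_linear (\<lambda>v. \<integral>x. f x v \<partial>M)"
  proof (rule bounded_linear_intro[where K = "\<integral>x. norm (f x) \<partial>M"])
    show "(\<integral>x. f x (v + w) \<partial>M) = (\<integral>x. f x v \<partial>M) + (\<integral>x. f x w \<partial>M)" for v w
      using fv by (simp add: blinfun.add_right)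
    show "(\<integral>x. f x (c *\<^sub>R v) \<partial>M) = c *\<^sub>R (\<integral>x. f x v \<partial>M)" for c v
      using fv by (simp add: blinfun.scaleR_right)
    show "norm (\<integral>x. f x v \<partial>M) \<le> norm v * (\<integral>x. norm (f x) \<partial>M)" for v
    proof -
      have "norm (\<integral>x. f x v \<partial>M) \<le> (\<integral>x. norm (f x v) \<partial>M)" by (rule integral_norm_bound)
      also have "\<dots> \<le> (\<integral>x. norm (f x) * norm v \<partial>M)"
        by (intro integral_mono integrable_norm fv integrable_mult_left f_int norm_blinfun)
      finally show ?thesis by (simp add: mult.commute)
    qed
  qed
  then have I_apply: "I v = (\<integral>x. f x v \<partial>M)" for v
    unfolding I_def by (simp add: bounded_linear_Blinfun_apply)
  have diff_int: "integrable M (\<lambda>x. norm (f x - r i x))" for i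
  proof (rule Bochner_Integration.integrable_bound[OF integrable_mult_left[OF f_int, of 3]])
    show "(\<lambda>x. norm (f x - r i x)) \<in> borel_measurable M" using diff_meas[of i] by measurable
    show "AE x in M. norm (norm (f x - r i x)) \<le> norm (norm (f x) * 3)"
    proof (rule AE_I2)
      show "norm (norm (f x - r i x)) \<le> norm (norm (f x) * 3)" for x
        using norm_triangle_ineq4[of "f x" "r i x"] r_bound[of i x] by simp
    qed
  qed
  have close: "norm (Bochner_Integration.simple_bochner_integral M (r i) - I) \<le> (\<integral>x. norm (f x - r i x) \<partial>M)" for i
  proof (rule norm_blinfun_bound)
    fix v
    have lin: "linear (\<lambda>\<phi>::'v \<Rightarrow>\<^sub>L real. blinfun_apply \<phi> v)"
      using blinfun.bounded_linear_left bounded_linear.linear by blast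
    have rv: "Bochner_Integration.simple_bochner_integrable M (\<lambda>x. r i x v)"
      using simple_bochner_integrable_compose2[where p = "\<lambda>x y. blinfun_apply x v", OF _ r_int r_int]
      by simp
    have "Bochner_Integration.simple_bochner_integral M (r i) v = (\<integral>x. r i x v \<partial>M)"
      using simple_bochner_integral_linear[OF lin r_int] simple_bochner_integrable_eq_integral[OF rv]
      by simp
    then have "norm ((Bochner_Integration.simple_bochner_integral M (r i) - I) v) =
        norm (\<integral>x. (f x - r i x) v \<partial>M)"
      using fv[of v] integrableI_simple_bochner_integrable[OF rv]
      by (simp add: blinfun.diff_left I_apply abs_minus_commute)
    also have "\<dots> \<le> (\<integral>x. norm ((f x - r i x) v) \<partial>M)" by (rule integral_norm_bound)
    also have "\<dots> \<le> (\<integral>x. norm (f x - r i x) * norm v \<partial>M)"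
    proof (intro integral_mono integrable_norm integrable_mult_left diff_int norm_blinfun)
      show "integrable M (\<lambda>x. (f x - r i x) v)"
        using fv[of v] integrableI_simple_bochner_integrable[OF rv] by (simp add: blinfun.diff_left)
    qed
    finally show "norm ((Bochner_Integration.simple_bochner_integral M (r i) - I) v) \<le>
      (\<integral>x. norm (f x - r i x) \<partial>M) * norm v" by simp
  qed simp
  have "(\<lambda>i. \<integral>x. norm (f x - r i x) \<partial>M) \<longlonglongrightarrow> 0"
  proof -
    have "ennreal (\<integral>x. norm (f x - r i x) \<partial>M) = (\<integral>\<^sup>+x. norm (f x - r i x) \<partial>M)" for i
      by (rule nn_integral_eq_integral[symmetric]) (use diff_int in auto)
    then have "(\<lambda>i. ennreal (\<integral>x. norm (f x - r i x) \<partial>M)) \<longlonglongrightarrow> ennreal 0" using lim by simp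
    then show ?thesis by (rule tendsto_ennrealD) auto
  qed
  then have "(\<lambda>i. Bochner_Integration.simple_bochner_integral M (r i) - I) \<longlonglongrightarrow> 0"
    by (rule Lim_null_comparison[rotated]) (simp add: close)
  then have "(\<lambda>i. Bochner_Integration.simple_bochner_integral M (r i)) \<longlonglongrightarrow> I"
    by (rule LIM_zero_cancel)
  moreover have "(\<lambda>i. \<integral>\<^sup>+x. norm (f x - r i x) \<partial>M) \<longlonglongrightarrow> 0" using lim by simp
  ultimately show ?thesis
    unfolding has_strong_integral_def using f r_int by blast
qed

theorem strong_integral_functional:
  fixes f :: "'a \<Rightarrow> ('v::real_normed_vector \<Rightarrow>\<^sub>L real)"
  assumes M: "complete_measure M" and f: "strongly_measurable M f"
    and fin: "(\<integral>\<^sup>+x. norm (f x) \<partial>M) < \<infinity>" and F: "bounded_linear F"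
  shows "has_bochner_integral M (\<lambda>x. F (f x)) (F (strong_integral M f) :: real)"
proof -
  obtain I where I: "has_strong_integral M f I"
    using has_strong_integral_exists[OF M f fin] by blast
  have "strong_integral M f = I"
    unfolding strong_integral_def
  proof (intro the_equality I)
    fix I' assume I': "has_strong_integral M f I'"
    have ev: "bounded_linear (\<lambda>\<phi>::'v \<Rightarrow>\<^sub>L real. blinfun_apply \<phi> v)" for v
      by (rule blinfun.bounded_linear_left)
    show "I' = I"
    proof (rule blinfun_eqI)
      show "I' v = I v" for v
        using has_strong_integral_functional[OF M I ev[of v]] has_strong_integral_functional[OF M I' ev[of v]]
        by (rule has_bochner_integral_eq[rotated])
    qed
  qed
  with has_strong_integral_functional[OF M I F] show ?thesis by simp
qed

lemma norm_strong_integral_le: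
  fixes f :: "'a \<Rightarrow> ('v::real_normed_vector \<Rightarrow>\<^sub>L real)"
  assumes M: "complete_measure M" and f: "strongly_measurable M f"
    and g: "integrable M g" and le: "\<And>x. x \<in> space M \<Longrightarrow> norm (f x) \<le> g x"
  shows "norm (strong_integral M f) \<le> (\<integral>x. g x \<partial>M)"
proof (rule norm_blinfun_bound)
  have "(\<integral>\<^sup>+x. norm (f x) \<partial>M) \<le> (\<integral>\<^sup>+x. norm (g x) \<partial>M)"
    by (intro nn_integral_mono) (use le in \<open>auto intro!: ennreal_leI order_trans[OF le]\<close>)
  also have "\<dots> < \<infinity>" using g by (simp add: integrable_iff_bounded)
  finally have fin: "(\<integral>\<^sup>+x. norm (f x) \<partial>M) < \<infinity>" .
  have g0: "0 \<le> g x" if "x \<in> space M" for x using le[OF that] norm_ge_zero order_trans by blast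
  show "0 \<le> (\<integral>x. g x \<partial>M)" by (intro integral_nonneg_AE AE_I2 g0)
  fix v
  have bi: "has_bochner_integral M (\<lambda>x. f x v) (strong_integral M f v)"
    by (rule strong_integral_functional[OF M f fin blinfun.bounded_linear_left])
  then have "norm (strong_integral M f v) = norm (\<integral>x. f x v \<partial>M)"
    by (simp add: has_bochner_integral_integral_eq)
  also have "\<dots> \<le> (\<integral>x. norm (f x v) \<partial>M)" by (rule integral_norm_bound)
  also have "\<dots> \<le> (\<integral>x. g x * norm v \<partial>M)"
  proof (rule integral_mono)
    show "integrable M (\<lambda>x. norm (f x v))" using bi by (auto simp: has_bochner_integral_iff)
    show "norm (f x v) \<le> g x * norm v" if "x \<in> space M" for x
      using norm_blinfun[of "f x" v] mult_right_mono[OF le[OF that], of "norm v"] by simp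
  qed (use g in simp)
  finally show "norm (strong_integral M f v) \<le> (\<integral>x. g x \<partial>M) * norm v" by simp
qed

section \<open>Controlled trajectories\<close>

lemma has_bochner_integral_lebesgue_on_shift:
  fixes f :: "real \<Rightarrow> real"
  assumes X: "X \<in> sets lebesgue" and Y: "Y \<in> sets lebesgue" and XY: "\<And>x. t + x \<in> X \<longleftrightarrow> x \<in> Y"
  shows "has_bochner_integral (lebesgue_on X) f I \<longleftrightarrow>
    has_bochner_integral (lebesgue_on Y) (\<lambda>x. f (t + x)) I"
proof -
  have "has_bochner_integral (lebesgue_on X) f I \<longleftrightarrow>
      has_bochner_integral lebesgue (\<lambda>x. indicator X x *\<^sub>R f x) I"
    using X by (simp add: has_bochner_integral_restrict_space)
  also have "\<dots> \<longleftrightarrow> has_bochner_integral lebesgue (\<lambda>x. indicator X (t + 1 * x) *\<^sub>R f (t + 1 * x)) (I /\<^sub>R \<bar>1\<bar>)"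
    by (rule has_bochner_integral_lebesgue_real_affine_iff) simp
  also have "\<dots> \<longleftrightarrow> has_bochner_integral lebesgue (\<lambda>x. indicator Y x *\<^sub>R f (t + x)) I"
    using XY by (simp add: indicator_def)
  also have "\<dots> \<longleftrightarrow> has_bochner_integral (lebesgue_on Y) (\<lambda>x. f (t + x)) I"
    using Y by (simp add: has_bochner_integral_restrict_space)
  finally show ?thesis .
qed

text \<open>A negligible overlap is allowed because adjacent closed intervals share an
  endpoint.\<close>

lemma has_bochner_integral_lebesgue_on_Un:
  fixes f :: "'a::euclidean_space \<Rightarrow> real"
  assumes X: "X \<in> sets lebesgue" and Y: "Y \<in> sets lebesgue" and XY: "negligible (X \<inter> Y)"
    and f: "has_bochner_integral (lebesgue_on X) f I" "has_bochner_integral (lebesgue_on Y) f I'"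
  shows "has_bochner_integral (lebesgue_on (X \<union> Y)) f (I + I')"
proof -
  have "has_bochner_integral lebesgue (\<lambda>x. indicator X x *\<^sub>R f x + indicator Y x *\<^sub>R f x) (I + I')"
    using f X Y by (intro has_bochner_integral_add) (simp_all add: has_bochner_integral_restrict_space)
  moreover have "AE x in lebesgue. indicator X x *\<^sub>R f x + indicator Y x *\<^sub>R f x = indicator (X \<union> Y) x *\<^sub>R f x"
  proof -
    have "AE x in lebesgue. x \<notin> X \<inter> Y"
      using XY by (intro AE_not_in) (simp add: negligible_iff_null_sets)
    then show ?thesis by eventually_elim (auto simp: indicator_def)
  qed
  moreover have "(\<lambda>x. indicator (X \<union> Y) x *\<^sub>R f x) \<in> borel_measurable lebesgue"
    by (rule completion.borel_measurable_cong_AE_imp[OF borel_measurable_has_bochner_integral[OF calculation(1)]])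
      (use calculation(2) in eventually_elim, simp)
  ultimately have "has_bochner_integral lebesgue (\<lambda>x. indicator (X \<union> Y) x *\<^sub>R f x) (I + I')"
    by (subst has_bochner_integral_cong_AE[symmetric]) (auto dest: borel_measurable_has_bochner_integral)
  then show ?thesis using X Y by (simp add: has_bochner_integral_restrict_space)
qed

lemma has_bochner_integral_split:
  fixes f :: "real \<Rightarrow> real"
  assumes "0 \<le> t" "has_bochner_integral (lebesgue_on {0..t}) f I"
    "has_bochner_integral (lebesgue_on {0..s}) (\<lambda>r. f (t + r)) I'" "0 \<le> s"
  shows "has_bochner_integral (lebesgue_on {0..t + s}) f (I + I')"
proof -
  have "has_bochner_integral (lebesgue_on {t..t + s}) f I'"
    using assms(3) has_bochner_integral_lebesgue_on_shift[of "{t..t + s}" "{0..s}" t f] by simp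
  moreover have "{0..t} \<union> {t..t + s} = {0..t + s}" "{0..t} \<inter> {t..t + s} = {t}" using assms by auto
  ultimately show ?thesis
    using has_bochner_integral_lebesgue_on_Un[of "{0..t}" "{t..t + s}" f] assms(2) by simp
qed

lemma has_bochner_integral_exp_atLeast:
  fixes c t :: real
  assumes "0 < c"
  shows "has_bochner_integral (lebesgue_on {t..}) (\<lambda>s. exp (- c * s)) (exp (- c * t) / c)"
proof -
  have "(\<lambda>s. exp (- c * s)) absolutely_integrable_on {t..}"
    using integrable_on_exp_minus_to_infinity[OF assms]
    by (intro nonnegative_absolutely_integrable_1) auto
  then have i: "integrable (lebesgue_on {t..}) (\<lambda>s. exp (- c * s))"
    by (simp add: integrable_restrict_space set_integrable_def)
  have "integral\<^sup>L (lebesgue_on {t..}) (\<lambda>s. exp (- c * s)) = integral {t..} (\<lambda>s. exp (- c * s))"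
    using i by (rule lebesgue_integral_eq_integral) simp
  also have "\<dots> = exp (- c * t) / c"
    by (rule integral_unique[OF has_integral_exp_minus_to_infinity[OF assms]])
  finally show ?thesis using i by (simp add: has_bochner_integral_iff)
qed

lemma integrable_lebesgue_on_subset:
  fixes f :: "real \<Rightarrow> real"
  assumes "integrable (lebesgue_on X) f" "Y \<subseteq> X" "X \<in> sets lebesgue" "Y \<in> sets lebesgue"
  shows "integrable (lebesgue_on Y) f"
proof -
  have "integrable lebesgue (\<lambda>x. indicator Y x *\<^sub>R (indicator X x *\<^sub>R f x))"
    by (rule integrable_mult_indicator) (use assms in \<open>simp_all add: integrable_restrict_space\<close>)
  moreover have "(\<lambda>x. indicator Y x *\<^sub>R (indicator X x *\<^sub>R f x)) = (\<lambda>x. indicator Y x *\<^sub>R f x)"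
    using assms(2) by (intro ext) (auto simp: indicator_def)
  ultimately have "integrable lebesgue (\<lambda>x. indicator Y x *\<^sub>R f x)" by (simp only:)
  then show ?thesis using assms by (simp add: integrable_restrict_space)
qed

text \<open>Sampling on a grid strictly to the right of t gives Borel step functions, and right
  continuity makes them converge. Trajectories are shown measurable this way.\<close>

lemma right_continuous_borel_measurable:
  fixes f :: "real \<Rightarrow> 'a::metric_space"
  assumes "\<And>t. 0 \<le> t \<Longrightarrow> (f \<longlongrightarrow> f t) (at_right t)"
  shows "f \<in> borel_measurable (lebesgue_on {0..})"
proof (rule borel_measurable_LIMSEQ_metric)
  \<comment> \<open>The added 1 places the grid point strictly beyond t, as the limit
    \<open>at_right\<close> demands.\<close>
  define c where "c n t = (real_of_int \<lfloor>real (Suc n) * t\<rfloor> + 1) / real (Suc n)" for n t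
  show "(\<lambda>t. f (c n t)) \<in> borel_measurable (lebesgue_on {0..})" for n
  proof -
    have "(\<lambda>t. \<lfloor>real (Suc n) * t\<rfloor>) \<in> measurable borel (count_space UNIV)" by measurable
    then have "(\<lambda>t. f ((real_of_int \<lfloor>real (Suc n) * t\<rfloor> + 1) / real (Suc n))) \<in> borel_measurable borel"
      by (rule measurable_compose) simp
    then have "(\<lambda>t. f (c n t)) \<in> borel_measurable lborel" by (simp add: c_def)
    then show ?thesis by (intro measurable_restrict_space1 measurable_completion)
  qed
  fix t :: real assume "t \<in> space (lebesgue_on {0..})"
  then have t: "0 \<le> t" by simp
  have c: "t < c n t" "c n t \<le> t + 1 / real (Suc n)" for n
  proof -
    let ?x = "real (Suc n) * t"
    have "?x < real_of_int \<lfloor>?x\<rfloor> + 1" by linarith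
    then show "t < c n t" unfolding c_def by (simp add: pos_less_divide_eq mult.commute)
    have "real_of_int \<lfloor>?x\<rfloor> + 1 \<le> (t + 1 / real (Suc n)) * real (Suc n)"
      by (simp add: distrib_right) (simp add: algebra_simps)
    then show "c n t \<le> t + 1 / real (Suc n)" unfolding c_def by (simp only: pos_divide_le_eq of_nat_0_less_iff zero_less_Suc)
  qed
  have "(\<lambda>n. c n t) \<longlonglongrightarrow> t"
  proof (rule tendsto_sandwich[of "\<lambda>_. t" _ _ "\<lambda>n. t + 1 / real (Suc n)"])
    show "(\<lambda>n. t + 1 / real (Suc n)) \<longlonglongrightarrow> t"
      using tendsto_add[OF tendsto_const LIMSEQ_Suc[OF lim_1_over_n], of t] by simp
  qed (use c in \<open>auto intro!: always_eventually less_imp_le\<close>)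
  then have "filterlim (\<lambda>n. c n t) (at_right t) sequentially"
    using c(1) c(1)[THEN less_imp_neq, symmetric] by (simp add: filterlim_at)
  then show "(\<lambda>n. f (c n t)) \<longlonglongrightarrow> f t"
    by (rule filterlim_compose[OF assms[OF t]])
qed

section \<open>Admissible controls and mild trajectories\<close>

locale control_system =
  fixes S :: "real \<Rightarrow> ('v::{real_inner, complete_space} \<Rightarrow>\<^sub>L real) \<Rightarrow>\<^sub>L ('v \<Rightarrow>\<^sub>L real)"
    and B :: "'u::{real_inner, complete_space} \<Rightarrow>\<^sub>L ('v \<Rightarrow>\<^sub>L real)"
    and \<omega> lam :: real
  assumes C0: "C0_semigroup S"
    and omega_nonneg: "0 \<le> \<omega>" and growth: "\<And>t x. 0 \<le> t \<Longrightarrow> norm (S t x) \<le> exp (\<omega> * t) * norm x"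
    and lam_gt: "\<omega> < lam"
begin

sublocale bounded_C0_semigroup S
  using C0 C0_semigroup_locally_bounded[OF C0] by unfold_locales

lemma lam_pos: "0 < lam" using lam_gt omega_nonneg by simp

lemma growth_le: "0 \<le> t \<Longrightarrow> t \<le> T \<Longrightarrow> norm (S t x) \<le> exp (\<omega> * T) * norm x"
  using omega_nonneg
  by (intro order_trans[OF growth[of t x]] mult_right_mono) (simp_all add: mult_left_mono)

text \<open>Discounted integrability instead of the weighted p-th power: this class contains
  \<open>weighted_Lp\<close> and all constants, is closed under shifts and linear combinations, and
  suffices for trajectories and their Laplace transforms.\<close>

definition control :: "(real \<Rightarrow> 'u) \<Rightarrow> bool" where
  "control u \<longleftrightarrow> strongly_measurable (lebesgue_on {0..}) u \<and>
     integrable (lebesgue_on {0..}) (\<lambda>s. exp (- lam * s) * norm (u s))"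

lemma control_measurable:
  assumes "control u"
  shows "u \<in> borel_measurable (lebesgue_on {0..})"
  using assms unfolding control_def
  by (intro complete_measure.strongly_measurable_imp_borel complete_measure_lebesgue_on) auto

lemma control_approx:
  assumes "control u"
  shows "\<exists>s. (\<forall>i. simple_function lborel (s i)) \<and>
    (AE x in lborel. 0 \<le> x \<longrightarrow> (\<lambda>i. s i x) \<longlonglongrightarrow> u x)"
  using assms unfolding control_def by (auto simp: strongly_measurable_lebesgue_on_iff)

lemma control_integrable_norm:
  assumes u: "control u" and t: "0 \<le> t"
  shows "integrable (lebesgue_on {0..t}) (\<lambda>s. norm (u s))"
proof -
  have i: "integrable (lebesgue_on {0..t}) (\<lambda>s. exp (- lam * s) * norm (u s))"
    by (rule integrable_lebesgue_on_subset[of "{0..}"]) (use u in \<open>auto simp: control_def\<close>)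
  show ?thesis
  proof (rule Bochner_Integration.integrable_bound[OF integrable_mult_right[OF i, of "exp (lam * t)"]])
    show "(\<lambda>s. norm (u s)) \<in> borel_measurable (lebesgue_on {0..t})"
    proof -
      have "u \<in> borel_measurable (restrict_space (lebesgue_on {0..}) {0..t})"
        using control_measurable[OF u] by (rule measurable_restrict_space1)
      then show ?thesis using t by (simp add: restrict_restrict_space Int_absorb1)
    qed
    show "AE s in lebesgue_on {0..t}. norm (norm (u s)) \<le> norm (exp (lam * t) * (exp (- lam * s) * norm (u s)))"
    proof (rule AE_I2)
      fix s assume "s \<in> space (lebesgue_on {0..t})"
      then have "1 \<le> exp (lam * t) * exp (- lam * s)"
        using lam_pos by (simp flip: exp_add)
      then show "norm (norm (u s)) \<le> norm (exp (lam * t) * (exp (- lam * s) * norm (u s)))"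
        using mult_right_mono[of 1 "exp (lam * t) * exp (- lam * s)" "norm (u s)"]
        by (simp add: abs_mult mult_ac)
    qed
  qed
qed

lemma control_shift:
  assumes u: "control u" and t: "0 \<le> t"
  shows "control (\<lambda>s. u (t + s))"
proof -
  obtain s where s: "\<And>i. simple_function lborel (s i)"
    "AE x in lborel. 0 \<le> x \<longrightarrow> (\<lambda>i. s i x) \<longlonglongrightarrow> u x"
    using control_approx[OF u] by blast
  have "simple_function lborel (\<lambda>x. s i (t + x))" for i
    by (rule simple_function_comp[where T = "\<lambda>x. t + x" and M' = lborel, unfolded comp_def])
      (use s(1) in auto)
  moreover have "AE x in lborel. 0 \<le> x \<longrightarrow> (\<lambda>i. s i (t + x)) \<longlonglongrightarrow> u (t + x)"
  proof -
    have "AE x in distr lborel borel ((+) t). 0 \<le> x \<longrightarrow> (\<lambda>i. s i x) \<longlonglongrightarrow> u x"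
      unfolding lborel_distr_plus by (rule s(2))
    then have "AE x in lborel. 0 \<le> t + x \<longrightarrow> (\<lambda>i. s i (t + x)) \<longlonglongrightarrow> u (t + x)"
      by (rule AE_distrD[rotated]) simp
    then show ?thesis by eventually_elim (use t in auto)
  qed
  ultimately have m: "strongly_measurable (lebesgue_on {0..}) (\<lambda>s. u (t + s))"
    by (subst strongly_measurable_lebesgue_on_iff) (auto intro!: exI[of _ "\<lambda>i x. s i (t + x)"])
  have "integrable (lebesgue_on {t..}) (\<lambda>s. exp (- lam * s) * norm (u s))"
    by (rule integrable_lebesgue_on_subset[of "{0..}"]) (use u t in \<open>auto simp: control_def\<close>)
  then have "integrable (lebesgue_on {0..}) (\<lambda>s. exp (- lam * (t + s)) * norm (u (t + s)))"
    using has_bochner_integral_lebesgue_on_shift[of "{t..}" "{0..}" t]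
    by (auto simp: integrable.simps)
  then have "integrable (lebesgue_on {0..}) (\<lambda>s. exp (lam * t) * (exp (- lam * (t + s)) * norm (u (t + s))))"
    by (rule integrable_mult_right)
  moreover have "exp (lam * t) * exp (- lam * (t + s)) = exp (- lam * s)" for s
    by (simp add: algebra_simps flip: exp_add)
  ultimately have "integrable (lebesgue_on {0..}) (\<lambda>s. exp (- lam * s) * norm (u (t + s)))"
    by (simp only: mult.assoc[symmetric])
  then show ?thesis
    using m unfolding control_def by blast
qed

lemma control_const: "control (\<lambda>_. w)"
proof -
  have "integrable (lebesgue_on {0..}) (\<lambda>s. exp (- lam * s))"
    using has_bochner_integral_exp_atLeast[OF lam_pos, of 0] by (auto simp: has_bochner_integral_iff)
  then show ?thesis
    unfolding control_def by (auto intro!: strongly_measurable_simple)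
qed

lemma strongly_measurable_add_scale:
  fixes u v :: "real \<Rightarrow> 'u"
  assumes "strongly_measurable M u" "strongly_measurable M v"
  shows "strongly_measurable M (\<lambda>s. c *\<^sub>R u s + d *\<^sub>R v s)"
proof -
  obtain s t where s: "\<And>i. simple_function M (s i)" "AE x in M. (\<lambda>i. s i x) \<longlonglongrightarrow> u x"
    and t: "\<And>i. simple_function M (t i)" "AE x in M. (\<lambda>i. t i x) \<longlonglongrightarrow> v x"
    using assms unfolding strongly_measurable_def by blast
  have "AE x in M. (\<lambda>i. c *\<^sub>R s i x + d *\<^sub>R t i x) \<longlonglongrightarrow> c *\<^sub>R u x + d *\<^sub>R v x"
    using s(2) t(2) by eventually_elim (intro tendsto_intros)
  moreover have "simple_function M (\<lambda>x. c *\<^sub>R s i x + d *\<^sub>R t i x)" for i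
    using s(1) t(1) by (rule simple_function_compose2)
  ultimately show ?thesis
    unfolding strongly_measurable_def by (intro exI[of _ "\<lambda>i x. c *\<^sub>R s i x + d *\<^sub>R t i x"]) blast
qed

lemma control_add_scale:
  assumes "control u" "control v"
  shows "control (\<lambda>s. c *\<^sub>R u s + d *\<^sub>R v s)"
proof -
  have m: "strongly_measurable (lebesgue_on {0..}) (\<lambda>s. c *\<^sub>R u s + d *\<^sub>R v s)"
    using assms unfolding control_def by (intro strongly_measurable_add_scale) auto
  have [measurable]: "(\<lambda>s. c *\<^sub>R u s + d *\<^sub>R v s) \<in> borel_measurable (lebesgue_on {0..})"
    by (intro complete_measure.strongly_measurable_imp_borel complete_measure_lebesgue_on m) simp
  have [measurable]: "(\<lambda>s::real. exp (- lam * s)) \<in> borel_measurable (lebesgue_on {0..})"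
    by (intro measurable_restrict_space1 measurable_completion) simp
  have "integrable (lebesgue_on {0..}) (\<lambda>s. exp (- lam * s) * norm (c *\<^sub>R u s + d *\<^sub>R v s))"
  proof (rule Bochner_Integration.integrable_bound)
    show "integrable (lebesgue_on {0..}) (\<lambda>s. \<bar>c\<bar> * (exp (- lam * s) * norm (u s)) + \<bar>d\<bar> * (exp (- lam * s) * norm (v s)))"
      using assms unfolding control_def by (intro Bochner_Integration.integrable_add integrable_mult_right) auto
    show "(\<lambda>s. exp (- lam * s) * norm (c *\<^sub>R u s + d *\<^sub>R v s)) \<in> borel_measurable (lebesgue_on {0..})"
      by measurable
    show "AE s in lebesgue_on {0..}. norm (exp (- lam * s) * norm (c *\<^sub>R u s + d *\<^sub>R v s)) \<le>
        norm (\<bar>c\<bar> * (exp (- lam * s) * norm (u s)) + \<bar>d\<bar> * (exp (- lam * s) * norm (v s)))"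
    proof (rule AE_I2)
      fix s
      have "exp (- lam * s) * norm (c *\<^sub>R u s + d *\<^sub>R v s) \<le> exp (- lam * s) * (\<bar>c\<bar> * norm (u s) + \<bar>d\<bar> * norm (v s))"
        using norm_triangle_ineq[of "c *\<^sub>R u s" "d *\<^sub>R v s"] by (intro mult_left_mono) auto
      then show "norm (exp (- lam * s) * norm (c *\<^sub>R u s + d *\<^sub>R v s)) \<le>
        norm (\<bar>c\<bar> * (exp (- lam * s) * norm (u s)) + \<bar>d\<bar> * (exp (- lam * s) * norm (v s)))"
        by (simp add: abs_mult algebra_simps)
    qed
  qed
  with m show ?thesis unfolding control_def by blast
qed

definition conv :: "(real \<Rightarrow> 'u) \<Rightarrow> real \<Rightarrow> ('v \<Rightarrow>\<^sub>L real)" where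
  "conv u t = strong_integral (lebesgue_on {0..t}) (\<lambda>s. S (t - s) (B (u s)))"

lemma trajectory_eq: "trajectory S B x u t = S t x + conv u t"
  by (simp add: trajectory_def conv_def)

text \<open>The time variable of the semigroup is discretized from below simultaneously with \<open>u\<close>.\<close>

lemma strongly_measurable_conv:
  assumes u: "control u" and t: "0 \<le> t"
  shows "strongly_measurable (lebesgue_on {0..t}) (\<lambda>s. S (t - s) (B (u s)))"
proof -
  obtain s where s: "\<And>i. simple_function lborel (s i)"
    "AE x in lborel. 0 \<le> x \<longrightarrow> (\<lambda>i. s i x) \<longlonglongrightarrow> u x"
    using control_approx[OF u] by blast
  define c where "c n x = max 0 (min t (real_of_int \<lfloor>real (Suc n) * x\<rfloor> / real (Suc n)))" for n x
  have c_range: "c n x \<in> {0..t}" for n x using t by (auto simp: c_def)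
  have c_simple: "simple_function lborel (c n)" for n
  proof (rule simple_function_borel_measurable)
    show "c n \<in> borel_measurable lborel" unfolding c_def by measurable
    have "c n x \<in> {0, t} \<union> (\<lambda>k::int. real_of_int k / real (Suc n)) ` {0..\<lceil>real (Suc n) * t\<rceil>}" for x
    proof (cases "c n x \<in> {0, t}")
      case False
      let ?k = "\<lfloor>real (Suc n) * x\<rfloor>"
      have eq: "c n x = real_of_int ?k / real (Suc n)" and pos: "0 < c n x" and le: "c n x < t"
        using False c_range[of n x] by (auto simp: c_def max_def min_def split: if_splits)
      have "0 < real_of_int ?k" using pos unfolding eq by (simp add: zero_less_divide_iff)
      moreover have "real_of_int ?k < real (Suc n) * t"
        using le unfolding eq by (simp add: pos_divide_less_eq mult.commute)
      ultimately have "?k \<in> {0..\<lceil>real (Suc n) * t\<rceil>}" by (auto intro: less_imp_le simp: le_ceiling_iff)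
      then show ?thesis unfolding eq by blast
    qed auto
    then have "c n ` space lborel \<subseteq> {0, t} \<union> (\<lambda>k::int. real_of_int k / real (Suc n)) ` {0..\<lceil>real (Suc n) * t\<rceil>}"
      by blast
    then show "finite (c n ` space lborel)" by (rule finite_subset) simp
  qed
  have c_lim: "(\<lambda>n. c n x) \<longlonglongrightarrow> x" if x: "x \<in> {0..t}" for x
  proof (rule tendsto_sandwich[of "\<lambda>n. x - 1 / real (Suc n)" _ _ "\<lambda>_. x"])
    have "x - 1 / real (Suc n) \<le> c n x \<and> c n x \<le> x" for n
    proof -
      let ?k = "\<lfloor>real (Suc n) * x\<rfloor>"
      have "real_of_int ?k \<le> real (Suc n) * x" "real (Suc n) * x - 1 \<le> real_of_int ?k" by linarith+
      then have "real_of_int ?k / real (Suc n) \<le> x"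
        "(real (Suc n) * x - 1) / real (Suc n) \<le> real_of_int ?k / real (Suc n)"
        by (auto simp: pos_divide_le_eq mult.commute intro!: divide_right_mono)
      moreover have "(real (Suc n) * x - 1) / real (Suc n) = x - 1 / real (Suc n)"
        by (simp add: diff_divide_distrib)
      ultimately have "real_of_int ?k / real (Suc n) \<le> x"
        "x - 1 / real (Suc n) \<le> real_of_int ?k / real (Suc n)" by auto
      then show ?thesis using x by (auto simp: c_def)
    qed
    then show "\<forall>\<^sub>F n in sequentially. x - 1 / real (Suc n) \<le> c n x" "\<forall>\<^sub>F n in sequentially. c n x \<le> x"
      by auto
    show "(\<lambda>n. x - 1 / real (Suc n)) \<longlonglongrightarrow> x"
      using tendsto_diff[OF tendsto_const LIMSEQ_Suc[OF lim_1_over_n], of x] by simp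
  qed simp
  have "AE x in lborel. x \<in> {0..t} \<longrightarrow> (\<lambda>i. S (t - c i x) (B (s i x))) \<longlonglongrightarrow> S (t - x) (B (u x))"
    using s(2)
  proof eventually_elim
    case (elim x)
    show ?case
    proof
      assume x: "x \<in> {0..t}"
      let ?y = "B (u x)"
      \<comment> \<open>The limit is split: the time varies at a fixed vector, where strong
        continuity applies, and the vector varies under operators that are uniformly bounded because
        \<open>c\<close> stays in [0, t].\<close>
      have 1: "(\<lambda>i. S (t - c i x) ?y) \<longlonglongrightarrow> S (t - x) ?y"
      proof -
        have "continuous_on {0..t} (\<lambda>r. S (t - r) ?y)"
          by (intro S_continuous_on_compose continuous_intros) auto
        then show ?thesis
          by (rule continuous_on_tendsto_compose[OF _ c_lim[OF x] x]) (use c_range in simp)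
      qed
      have 2: "(\<lambda>i. S (t - c i x) (B (s i x) - ?y)) \<longlonglongrightarrow> 0"
      proof (rule Lim_null_comparison)
        show "\<forall>\<^sub>F i in sequentially. norm (S (t - c i x) (B (s i x) - ?y)) \<le> exp (\<omega> * t) * norm (B (s i x) - ?y)"
          using c_range by (intro always_eventually allI growth_le) auto
        have "(\<lambda>i. exp (\<omega> * t) * norm (B (s i x) - ?y)) \<longlonglongrightarrow> exp (\<omega> * t) * norm (?y - ?y)"
          using elim x by (intro tendsto_intros) auto
        then show "(\<lambda>i. exp (\<omega> * t) * norm (B (s i x) - ?y)) \<longlonglongrightarrow> 0" by simp
      qed
      show "(\<lambda>i. S (t - c i x) (B (s i x))) \<longlonglongrightarrow> S (t - x) ?y"
        using tendsto_add[OF 1 2] by (simp add: blinfun.diff_right)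
    qed
  qed
  moreover have "simple_function lborel (\<lambda>x. S (t - c i x) (B (s i x)))" for i
    using c_simple s(1) by (rule simple_function_compose2)
  ultimately show ?thesis
    by (subst strongly_measurable_lebesgue_on_iff) (auto intro!: exI[of _ "\<lambda>i x. S (t - c i x) (B (s i x))"])
qed

lemma norm_conv_integrand_le:
  assumes "s \<in> {0..t}"
  shows "norm (S (t - s) (B (u s))) \<le> exp (\<omega> * t) * norm B * norm (u s)"
proof -
  have "norm (S (t - s) (B (u s))) \<le> exp (\<omega> * t) * norm (B (u s))"
    using assms by (intro growth_le) auto
  also have "\<dots> \<le> exp (\<omega> * t) * (norm B * norm (u s))"
    by (intro mult_left_mono norm_blinfun) simp
  finally show ?thesis by (simp add: mult_ac)
qed

lemma conv_functional:
  assumes u: "control u" and t: "0 \<le> t" and F: "bounded_linear F"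
  shows "has_bochner_integral (lebesgue_on {0..t}) (\<lambda>s. F (S (t - s) (B (u s)))) (F (conv u t) :: real)"
  unfolding conv_def
proof (rule strong_integral_functional[OF complete_measure_lebesgue_on strongly_measurable_conv[OF u t] _ F])
  have i: "integrable (lebesgue_on {0..t}) (\<lambda>s. exp (\<omega> * t) * norm B * norm (u s))"
    by (intro integrable_mult_right control_integrable_norm u t)
  have "(\<integral>\<^sup>+x. norm (S (t - x) (B (u x))) \<partial>lebesgue_on {0..t}) \<le>
      (\<integral>\<^sup>+x. norm (exp (\<omega> * t) * norm B * norm (u x)) \<partial>lebesgue_on {0..t})"
    using norm_conv_integrand_le by (intro nn_integral_mono ennreal_leI) (auto intro: order_trans)
  also have "\<dots> < \<infinity>" using i unfolding integrable_iff_bounded by (rule conjunct2)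
  finally show "(\<integral>\<^sup>+x. norm (S (t - x) (B (u x))) \<partial>lebesgue_on {0..t}) < \<infinity>" .
qed simp

lemma conv_apply:
  assumes "control u" "0 \<le> t"
  shows "has_bochner_integral (lebesgue_on {0..t}) (\<lambda>s. S (t - s) (B (u s)) q) (conv u t q)"
  by (rule conv_functional[OF assms blinfun.bounded_linear_left])

lemma norm_conv_le:
  assumes u: "control u" and t: "0 \<le> t"
  shows "norm (conv u t) \<le> exp (\<omega> * t) * norm B * (\<integral>s. norm (u s) \<partial>lebesgue_on {0..t})"
proof -
  have "norm (conv u t) \<le> (\<integral>s. exp (\<omega> * t) * norm B * norm (u s) \<partial>lebesgue_on {0..t})"
    unfolding conv_def
    by (rule norm_strong_integral_le[OF complete_measure_lebesgue_on strongly_measurable_conv[OF u t]])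
      (auto intro!: integrable_mult_right control_integrable_norm u t norm_conv_integrand_le)
  then show ?thesis by simp
qed

lemma conv_add_scale:
  assumes "control u" "control v" "0 \<le> t"
  shows "conv (\<lambda>s. c *\<^sub>R u s + d *\<^sub>R v s) t = c *\<^sub>R conv u t + d *\<^sub>R conv v t"
proof (rule blinfun_eqI)
  fix q
  have "has_bochner_integral (lebesgue_on {0..t})
      (\<lambda>s. c * S (t - s) (B (u s)) q + d * S (t - s) (B (v s)) q) (c * conv u t q + d * conv v t q)"
    using assms by (intro has_bochner_integral_add has_bochner_integral_mult_right conv_apply) auto
  moreover have "has_bochner_integral (lebesgue_on {0..t})
      (\<lambda>s. c * S (t - s) (B (u s)) q + d * S (t - s) (B (v s)) q) (conv (\<lambda>s. c *\<^sub>R u s + d *\<^sub>R v s) t q)"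
    using conv_apply[OF control_add_scale[OF assms(1,2)] assms(3)]
    by (simp add: blinfun.add_right blinfun.scaleR_right blinfun.add_left blinfun.scaleR_left)
  ultimately show "conv (\<lambda>s. c *\<^sub>R u s + d *\<^sub>R v s) t q = (c *\<^sub>R conv u t + d *\<^sub>R conv v t) q"
    by (simp add: has_bochner_integral_eq blinfun.add_left blinfun.scaleR_left)
qed

lemma conv_shift:
  assumes u: "control u" and t: "0 \<le> t" and r: "0 \<le> r"
  shows "conv u (t + r) = S r (conv u t) + conv (\<lambda>s. u (t + s)) r"
proof (rule blinfun_eqI)
  fix q
  have "bounded_linear (\<lambda>\<phi>. S r \<phi> q)"
    by (rule bounded_linear_compose[OF blinfun.bounded_linear_left blinfun.bounded_linear_right])
  from conv_functional[OF u t this]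
  have "has_bochner_integral (lebesgue_on {0..t}) (\<lambda>s. S r (S (t - s) (B (u s))) q) (S r (conv u t) q)" .
  also have "?this \<longleftrightarrow> has_bochner_integral (lebesgue_on {0..t}) (\<lambda>s. S (t + r - s) (B (u s)) q) (S r (conv u t) q)"
    using S_add[of r "t - _"] r by (intro has_bochner_integral_cong) (auto simp: algebra_simps)
  finally have 1: "has_bochner_integral (lebesgue_on {0..t}) (\<lambda>s. S (t + r - s) (B (u s)) q) (S r (conv u t) q)" .
  have 2: "has_bochner_integral (lebesgue_on {0..r}) (\<lambda>s. S (t + r - (t + s)) (B (u (t + s))) q) (conv (\<lambda>s. u (t + s)) r q)"
    using conv_apply[OF control_shift[OF u t] r, of q] by simp
  show "conv u (t + r) q = (S r (conv u t) + conv (\<lambda>s. u (t + s)) r) q"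
    using has_bochner_integral_split[OF t 1 2 r] conv_apply[OF u, of "t + r" q] t r
    by (auto simp: blinfun.add_left intro: has_bochner_integral_eq)
qed

lemma trajectory_shift:
  assumes "control u" "0 \<le> t" "0 \<le> r"
  shows "trajectory S B x u (t + r) = trajectory S B (trajectory S B x u t) (\<lambda>s. u (t + s)) r"
proof -
  have "S (t + r) x = S r (S t x)" using S_add[of r t x] assms by (simp add: add.commute)
  then show ?thesis using assms by (simp add: trajectory_eq conv_shift blinfun.add_right)
qed

lemma trajectory_add:
  "trajectory S B (x + h) u t = trajectory S B x u t + S t h"
  by (simp add: trajectory_eq blinfun.add_right)

end

context control_system
begin

text \<open>Restarting at time t leaves the orbit of the reached state plus a convolution over
  [0, r], whose norm is bounded by a multiple of the integral of |u (t + s)| over that interval and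
  so vanishes with r.\<close>

lemma trajectory_right_continuous:
  assumes u: "control u" and t: "0 \<le> t"
  shows "(trajectory S B x u \<longlongrightarrow> trajectory S B x u t) (at_right t)"
proof -
  define y where "y = trajectory S B x u t"
  let ?v = "\<lambda>s. u (t + s)"
  have v: "control ?v" by (rule control_shift[OF u t])
  let ?N = "\<lambda>r. integral {0..r} (\<lambda>s. norm (?v s))"
  have Ni: "integrable (lebesgue_on {0..r}) (\<lambda>s. norm (?v s))" if "0 \<le> r" for r
    by (rule control_integrable_norm[OF v that])
  have N_eq: "(\<integral>s. norm (?v s) \<partial>lebesgue_on {0..r}) = ?N r" if "0 \<le> r" for r
    using Ni[OF that] by (rule lebesgue_integral_eq_integral) simp
  have "(\<lambda>s. norm (?v s)) integrable_on {0..1}"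
    using Ni[of 1] by (simp add: integrable_on_lebesgue_on)
  then have "continuous_on {0..1} ?N" by (rule indefinite_integral_continuous_1)
  then have "(?N \<longlongrightarrow> ?N 0) (at 0 within {0..1})"
    unfolding continuous_on_def by (rule bspec) simp
  then have "(?N \<longlongrightarrow> 0) (at_right 0)"
    by (simp add: at_within_Icc_at_right)
  then have N_lim: "((\<lambda>r. exp (\<omega> * r) * norm B * ?N r) \<longlongrightarrow> exp (\<omega> * 0) * norm B * 0) (at_right 0)"
    by (intro tendsto_intros)
  have "((\<lambda>r. conv ?v r) \<longlongrightarrow> 0) (at_right 0)"
  proof (rule Lim_null_comparison)
    show "\<forall>\<^sub>F r in at_right 0. norm (conv ?v r) \<le> exp (\<omega> * r) * norm B * ?N r"
      unfolding eventually_at_right_field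
      using norm_conv_le[OF v] N_eq by (intro exI[of _ 1]) (auto simp: less_imp_le)
  qed (use N_lim in simp)
  then have "((\<lambda>r. S r y + conv ?v r) \<longlongrightarrow> y + 0) (at_right 0)"
    by (intro tendsto_add S_tendsto)
  moreover have "\<forall>\<^sub>F r in at_right 0. S r y + conv ?v r = trajectory S B x u (t + r)"
    unfolding eventually_at_right_field y_def
    using trajectory_shift[OF u t] by (intro exI[of _ 1]) (auto simp: trajectory_eq less_imp_le)
  ultimately have "((\<lambda>r. trajectory S B x u (t + r)) \<longlongrightarrow> y) (at_right 0)"
    by (auto intro: Lim_transform_eventually)
  then show ?thesis
    unfolding y_def filterlim_at_right_to_0[of _ _ t] by (simp add: add.commute)
qed

lemma trajectory_measurable:
  "control u \<Longrightarrow> trajectory S B x u \<in> borel_measurable (lebesgue_on {0..})"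
  by (intro right_continuous_borel_measurable trajectory_right_continuous)

section \<open>Discounted integrals and the adjoint resolvent\<close>

lemma norm_S_apply_le:
  assumes "0 \<le> t"
  shows "\<bar>S t \<phi> q\<bar> \<le> exp (\<omega> * t) * norm \<phi> * norm q"
  using norm_blinfun[of "S t \<phi>" q] mult_right_mono[OF growth[OF assms, of \<phi>], of "norm q"]
  by (simp add: mult_ac)

lemma exp_discount:
  assumes "\<omega>' < lam"
  shows "has_bochner_integral (lebesgue_on {0..}) (\<lambda>s. exp (- lam * s) * exp (\<omega>' * s)) (1 / (lam - \<omega>'))"
  using has_bochner_integral_exp_atLeast[of "lam - \<omega>'" 0] assms
  by (simp add: left_diff_distrib flip: exp_add)

lemma continuous_S_apply: "continuous_on {0..} (\<lambda>t. S t \<phi> q)"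
  by (intro bounded_linear.continuous_on[OF blinfun.bounded_linear_left] S_continuous_on)

lemma discounted_measurable [measurable]:
  "(\<lambda>s::real. exp (- lam * s)) \<in> borel_measurable (lebesgue_on {0..})"
  by (intro measurable_restrict_space1 measurable_completion) simp

lemma S_apply_measurable [measurable]:
  "(\<lambda>s. S s \<phi> q) \<in> borel_measurable (lebesgue_on {0..})"
  by (rule continuous_imp_measurable_on_sets_lebesgue[OF continuous_S_apply]) simp

lemma resolvent_integrable:
  "integrable (lebesgue_on {0..}) (\<lambda>s. exp (- lam * s) * S s \<phi> q)"
proof (rule Bochner_Integration.integrable_bound)
  show "integrable (lebesgue_on {0..}) (\<lambda>s. norm \<phi> * norm q * (exp (- lam * s) * exp (\<omega> * s)))"
    using exp_discount[OF lam_gt] by (intro integrable_mult_right) (auto simp: integrable.simps)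
  show "(\<lambda>s. exp (- lam * s) * S s \<phi> q) \<in> borel_measurable (lebesgue_on {0..})" by measurable
  show "AE s in lebesgue_on {0..}. norm (exp (- lam * s) * S s \<phi> q) \<le>
      norm (norm \<phi> * norm q * (exp (- lam * s) * exp (\<omega> * s)))"
  proof (rule AE_I2)
    fix s :: real assume "s \<in> space (lebesgue_on {0..})"
    then show "norm (exp (- lam * s) * S s \<phi> q) \<le> norm (norm \<phi> * norm q * (exp (- lam * s) * exp (\<omega> * s)))"
      using norm_S_apply_le[of s \<phi> q] by (simp add: abs_mult mult_ac)
  qed
qed

text \<open>The resolvent of the adjoint semigroup, \<open>(\<lambda> - A\<^sup>*)\<^sup>-\<^sup>1\<close> on \<open>V\<close>, as a Laplace transform.\<close>

definition resolvent_adj :: "'v \<Rightarrow> 'v" where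
  "resolvent_adj q = (SOME p. \<forall>\<phi>. blinfun_apply \<phi> p = (\<integral>s. exp (- lam * s) * S s \<phi> q \<partial>lebesgue_on {0..}))"

lemma norm_resolvent_le:
  "norm (\<integral>s. exp (- lam * s) * S s \<phi> q \<partial>lebesgue_on {0..}) \<le> norm \<phi> * (norm q / (lam - \<omega>))"
proof -
  have "norm (\<integral>s. exp (- lam * s) * S s \<phi> q \<partial>lebesgue_on {0..}) \<le>
      (\<integral>s. norm (exp (- lam * s) * S s \<phi> q) \<partial>lebesgue_on {0..})"
    by (rule integral_norm_bound)
  also have "\<dots> \<le> (\<integral>s. norm \<phi> * norm q * (exp (- lam * s) * exp (\<omega> * s)) \<partial>lebesgue_on {0..})"
  proof (rule integral_mono)
    show "integrable (lebesgue_on {0..}) (\<lambda>s. norm (exp (- lam * s) * S s \<phi> q))"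
      by (intro integrable_norm resolvent_integrable)
    show "integrable (lebesgue_on {0..}) (\<lambda>s. norm \<phi> * norm q * (exp (- lam * s) * exp (\<omega> * s)))"
      using exp_discount[OF lam_gt] by (intro integrable_mult_right) (auto simp: integrable.simps)
    fix s :: real assume "s \<in> space (lebesgue_on {0..})"
    then show "norm (exp (- lam * s) * S s \<phi> q) \<le> norm \<phi> * norm q * (exp (- lam * s) * exp (\<omega> * s))"
      using norm_S_apply_le[of s \<phi> q] by (simp add: abs_mult mult_ac)
  qed
  also have "\<dots> = norm \<phi> * norm q * (1 / (lam - \<omega>))"
    using has_bochner_integral_integral_eq[OF exp_discount[OF lam_gt]] by simp
  finally show ?thesis by simp
qed

text \<open>The Laplace transform is a bounded functional of \<phi> on V', so reflexivity supplies
  the element of V that the choice operator selects.\<close>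

lemma resolvent_adj_apply:
  "blinfun_apply \<phi> (resolvent_adj q) = (\<integral>s. exp (- lam * s) * S s \<phi> q \<partial>lebesgue_on {0..})"
proof -
  have "bounded_linear (\<lambda>\<phi>. \<integral>s. exp (- lam * s) * S s \<phi> q \<partial>lebesgue_on {0..})"
  proof (rule bounded_linear_intro[OF _ _ norm_resolvent_le])
    show "(\<integral>s. exp (- lam * s) * S s (\<phi> + \<psi>) q \<partial>lebesgue_on {0..}) =
      (\<integral>s. exp (- lam * s) * S s \<phi> q \<partial>lebesgue_on {0..}) + (\<integral>s. exp (- lam * s) * S s \<psi> q \<partial>lebesgue_on {0..})" for \<phi> \<psi>
      using resolvent_integrable by (simp add: blinfun.add_right blinfun.add_left distrib_left)
    show "(\<integral>s. exp (- lam * s) * S s (r *\<^sub>R \<phi>) q \<partial>lebesgue_on {0..}) =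
      r *\<^sub>R (\<integral>s. exp (- lam * s) * S s \<phi> q \<partial>lebesgue_on {0..})" for r \<phi>
      by (simp add: blinfun.scaleR_right blinfun.scaleR_left mult.left_commute)
  qed
  then obtain p where "\<And>\<phi>. (\<integral>s. exp (- lam * s) * S s \<phi> q \<partial>lebesgue_on {0..}) = blinfun_apply \<phi> p"
    by (rule hilbert_reflexive) blast
  then have "\<exists>p. \<forall>\<phi>. blinfun_apply \<phi> p = (\<integral>s. exp (- lam * s) * S s \<phi> q \<partial>lebesgue_on {0..})"
    by metis
  from someI_ex[OF this] show ?thesis unfolding resolvent_adj_def by blast
qed

lemma norm_resolvent_adj_diff_le:
  "norm (resolvent_adj q - resolvent_adj q') \<le> norm (q - q') / (lam - \<omega>)"
proof (rule dual_norm_le)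
  fix \<phi> :: "'v \<Rightarrow>\<^sub>L real"
  have "\<phi> (resolvent_adj q - resolvent_adj q') = (\<integral>s. exp (- lam * s) * S s \<phi> (q - q') \<partial>lebesgue_on {0..})"
    using resolvent_integrable
    by (simp add: blinfun.diff_right resolvent_adj_apply right_diff_distrib)
  also have "\<dots> \<le> norm \<phi> * (norm (q - q') / (lam - \<omega>))"
    using norm_resolvent_le[of \<phi> "q - q'"] by simp
  finally show "\<phi> (resolvent_adj q - resolvent_adj q') \<le> norm (q - q') / (lam - \<omega>) * norm \<phi>"
    by (simp add: mult.commute)
qed (use lam_gt in simp)

text \<open>As B w = - A x, the convolution is minus the integral of S s (A x), hence x - S t x,
  which cancels the motion of the free orbit.\<close>

lemma trajectory_equilibrium:
  assumes gen: "is_generator D A S" and x: "x \<in> D" and eq: "A x + B w = 0" and t: "0 \<le> t"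
  shows "trajectory S B x (\<lambda>_. w) t = x"
proof (rule blinfun_eqI)
  fix q
  have "B w = - A x" using eq by (simp add: eq_neg_iff_add_eq_0 add.commute)
  have "((\<lambda>s. S s (A x) q) has_integral S t x q - x q) {0..t}"
    by (rule S_integral[OF gen x t blinfun.bounded_linear_left])
  then have "((\<lambda>s. S (-1 *\<^sub>R s + t) (A x) q) has_integral (1 / \<bar>-1\<bar> ^ DIM(real)) *\<^sub>R (S t x q - x q))
      ((\<lambda>s. (1 / -1) *\<^sub>R s + - ((1 / -1) *\<^sub>R t)) ` cbox 0 t)"
    by (intro has_integral_affinity) simp_all
  moreover have "(\<lambda>s. t - s) ` {0..t} = {0..t}"
    by (auto intro!: image_eqI[of _ "\<lambda>s. t - s" "t - _"])
  ultimately have i: "((\<lambda>s. S (t - s) (A x) q) has_integral S t x q - x q) {0..t}"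
    by (simp add: algebra_simps)
  have "has_bochner_integral (lebesgue_on {0..t}) (\<lambda>s. - S (t - s) (A x) q) (conv (\<lambda>_. w) t q)"
    using conv_apply[OF control_const[of w] t, of q] \<open>B w = - A x\<close>
    by (simp add: blinfun.minus_right blinfun.minus_left)
  then have "((\<lambda>s. - S (t - s) (A x) q) has_integral conv (\<lambda>_. w) t q) {0..t}"
    using has_integral_integral_lebesgue_on[of "{0..t}" "\<lambda>s. - S (t - s) (A x) q"]
    by (simp add: has_bochner_integral_iff)
  with has_integral_neg[OF i] have "conv (\<lambda>_. w) t q = - (S t x q - x q)"
    by (rule has_integral_unique[rotated])
  then show "trajectory S B x (\<lambda>_. w) t q = x q"
    by (simp add: trajectory_eq blinfun.add_left)
qed


text \<open>Fubini on the triangle s \<le> t: the discounted pairing of the convolution with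
  \<open>q\<close> equals the discounted pairing of B u with the resolvent of \<open>q\<close>. This
  moves the adjoint from states to controls. The difficulty is joint measurability of the
  integrand.\<close>

lemma conv_laplace:
  assumes u: "control u"
  shows "integrable (lebesgue_on {0..}) (\<lambda>t. exp (- lam * t) * conv u t q)"
    and "has_bochner_integral (lebesgue_on {0..}) (\<lambda>s. exp (- lam * s) * B (u s) (resolvent_adj q))
      (\<integral>t. exp (- lam * t) * conv u t q \<partial>lebesgue_on {0..})"
proof -
  obtain s where s: "\<And>i. simple_function lborel (s i)"
    "AE x in lborel. 0 \<le> x \<longrightarrow> (\<lambda>i. s i x) \<longlonglongrightarrow> u x"
    using control_approx[OF u] by blast
  \<comment> \<open>The integrand with the control frozen at the value \<open>w\<close>, measurable
    in both times for each \<open>w\<close>. The \<open>max 0\<close> keeps the argument of S in the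
    half-line on which orbits are continuous.\<close>
  define k where "k w x = (if 0 \<le> fst x \<and> fst x \<le> snd x
    then exp (- lam * snd x) * S (max 0 (snd x - fst x)) (B w) q else 0)" for w and x :: "real \<times> real"
  have k_meas [measurable]: "k w \<in> borel_measurable (lborel \<Otimes>\<^sub>M lborel)" for w
  proof -
    have "continuous_on UNIV (\<lambda>x::real \<times> real. S (max 0 (snd x - fst x)) (B w) q)"
      by (intro continuous_on_compose2[OF continuous_S_apply] continuous_intros) auto
    then have "(\<lambda>x::real \<times> real. S (max 0 (snd x - fst x)) (B w) q) \<in> borel_measurable borel"
      by (rule borel_measurable_continuous_onI)
    then have [measurable]: "(\<lambda>x::real \<times> real. S (max 0 (snd x - fst x)) (B w) q) \<in> borel_measurable (lborel \<Otimes>\<^sub>M lborel)"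
      by (simp add: borel_prod lborel_prod)
    show ?thesis unfolding k_def by measurable
  qed
  define ki where "ki i x = k (s i (fst x)) x" for i x
  have ki_meas: "ki i \<in> borel_measurable (lborel \<Otimes>\<^sub>M lborel)" for i
  proof -
    have fin: "finite (range (s i))" using simple_functionD(1)[OF s(1)] by simp
    have [measurable]: "s i -` {w} \<in> sets borel" for w using simple_functionD(2)[OF s(1), of i "{w}"] by simp
    have "ki i = (\<lambda>x. \<Sum>w\<in>range (s i). indicator (s i -` {w}) (fst x) * k w x)"
    proof
      fix x
      have "(\<Sum>w\<in>range (s i). indicator (s i -` {w}) (fst x) * k w x) =
          (\<Sum>w\<in>range (s i). if w = s i (fst x) then k w x else 0)"
        by (intro sum.cong) (auto simp: indicator_def)
      then show "ki i x = (\<Sum>w\<in>range (s i). indicator (s i -` {w}) (fst x) * k w x)"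
        using fin by (simp add: ki_def)
    qed
    moreover have "(\<lambda>x. \<Sum>w\<in>range (s i). indicator (s i -` {w}) (fst x) * k w x) \<in> borel_measurable (lborel \<Otimes>\<^sub>M lborel)"
      by measurable
    ultimately show ?thesis by (simp only:)
  qed
  \<comment> \<open>A product measurable representative of the true integrand. The default value of
    \<open>lim\<close> can occur only for r in a null set; for every other r the limit exists for
    all t.\<close>
  define K where "K x = lim (\<lambda>i. ki i x)" for x
  have K_meas [measurable]: "K \<in> borel_measurable (lborel \<Otimes>\<^sub>M lborel)"
    unfolding K_def[abs_def] by (rule borel_measurable_lim_metric[OF ki_meas])
  have K_eq: "AE r in lborel. \<forall>t. K (r, t) = k (u r) (r, t)"
    using s(2)
  proof eventually_elim
    case (elim r)
    show ?case
    proof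
      fix t
      have "(\<lambda>i. ki i (r, t)) \<longlonglongrightarrow> k (u r) (r, t)"
      proof (cases "0 \<le> r")
        case True
        then have lim: "(\<lambda>i. s i r) \<longlonglongrightarrow> u r" using elim by blast
        show ?thesis
          unfolding ki_def k_def by (auto intro!: tendsto_intros lim)
      qed (simp add: ki_def k_def)
      then show "K (r, t) = k (u r) (r, t)" unfolding K_def by (rule limI)
    qed
  qed
  define C where "C = norm B * norm q"
  have C: "0 \<le> C" by (simp add: C_def)
  define e where "e r t = indicator {r..} t * exp (- (lam - \<omega>) * t)" for r t :: real
  have e_int: "has_bochner_integral lborel (e r) (exp (- (lam - \<omega>) * r) / (lam - \<omega>))" for r
  proof -
    have "has_bochner_integral lebesgue (\<lambda>t. indicator {r..} t *\<^sub>R exp (- (lam - \<omega>) * t)) (exp (- (lam - \<omega>) * r) / (lam - \<omega>))"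
      using has_bochner_integral_exp_atLeast[of "lam - \<omega>" r] lam_gt
      by (simp add: has_bochner_integral_restrict_space)
    then show ?thesis
      unfolding e_def[abs_def] has_bochner_integral_iff by (simp add: integrable_completion integral_completion)
  qed
  \<comment> \<open>The exponents are regrouped so that integration over t \<ge> r returns exactly
    the weight exp (- lam * r), against which |u| is integrable.\<close>
  have k_bound: "norm (k (u r) (r, t)) \<le> C * norm (u r) * (indicator {0..} r * exp (- \<omega> * r)) * e r t" for r t
  proof (cases "0 \<le> r \<and> r \<le> t")
    case True
    then have "norm (k (u r) (r, t)) = exp (- lam * t) * \<bar>S (t - r) (B (u r)) q\<bar>"
      by (simp add: k_def abs_mult)
    also have "\<dots> \<le> exp (- lam * t) * (exp (\<omega> * (t - r)) * norm (B (u r)) * norm q)"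
      using True by (intro mult_left_mono norm_S_apply_le) auto
    also have "\<dots> \<le> exp (- lam * t) * (exp (\<omega> * (t - r)) * (norm B * norm (u r)) * norm q)"
      by (intro mult_left_mono mult_right_mono norm_blinfun) auto
    also have "\<dots> = C * norm (u r) * (exp (- lam * t) * exp (\<omega> * (t - r)))" by (simp add: C_def mult_ac)
    also have "exp (- lam * t) * exp (\<omega> * (t - r)) = exp (- \<omega> * r) * exp (- (lam - \<omega>) * t)"
      by (simp add: algebra_simps flip: exp_add)
    finally show ?thesis using True by (simp add: e_def mult_ac)
  qed (auto simp: k_def e_def C_def intro!: mult_nonneg_nonneg)
  have Kr_meas: "(\<lambda>t. K (r, t)) \<in> borel_measurable lborel" for r
    by (rule measurable_compose[OF _ K_meas]) simp
  have good: "integrable lborel (\<lambda>t. K (r, t))"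
    "(\<integral>t. norm (K (r, t)) \<partial>lborel) \<le> C / (lam - \<omega>) * (indicator {0..} r * (exp (- lam * r) * norm (u r)))"
    "(\<integral>t. K (r, t) \<partial>lborel) = indicator {0..} r * (exp (- lam * r) * B (u r) (resolvent_adj q))"
    if r: "\<forall>t. K (r, t) = k (u r) (r, t)" for r
  proof -
    let ?c = "C * norm (u r) * (indicator {0..} r * exp (- \<omega> * r))"
    have ei: "integrable lborel (\<lambda>t. ?c * e r t)"
      using e_int[of r] by (intro integrable_mult_right) (auto simp: has_bochner_integral_iff)
    have e0: "0 \<le> e r t" for t by (simp add: e_def)
    show i: "integrable lborel (\<lambda>t. K (r, t))"
      by (rule Bochner_Integration.integrable_bound[OF ei Kr_meas])
        (use r k_bound[of r] in \<open>auto intro: order_trans[OF _ abs_ge_self]\<close>)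
    have "(\<integral>t. norm (K (r, t)) \<partial>lborel) \<le> (\<integral>t. ?c * e r t \<partial>lborel)"
      by (rule integral_mono) (use i ei r k_bound[of r] in auto)
    also have "\<dots> = ?c * (exp (- (lam - \<omega>) * r) / (lam - \<omega>))"
      using e_int[of r] by (simp add: has_bochner_integral_iff)
    also have "\<dots> = C / (lam - \<omega>) * (indicator {0..} r * ((exp (- \<omega> * r) * exp (- (lam - \<omega>) * r)) * norm (u r)))"
      by simp
    also have "exp (- \<omega> * r) * exp (- (lam - \<omega>) * r) = exp (- lam * r)"
      by (simp add: algebra_simps flip: exp_add)
    finally show "(\<integral>t. norm (K (r, t)) \<partial>lborel) \<le> C / (lam - \<omega>) * (indicator {0..} r * (exp (- lam * r) * norm (u r)))" .
    \<comment> \<open>Shifting t by r leaves exp (- lam * r) times the Laplace transform of the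
      orbit of B (u r), which \<open>resolvent_adj\<close> represents.\<close>
    have "(\<integral>t. K (r, t) \<partial>lborel) = (\<integral>t. K (r, r + t) \<partial>lborel)"
      using lborel_integral_real_affine[of 1 "\<lambda>t. K (r, t)" r] by simp
    also have "\<dots> = (\<integral>t. indicator {0..} r * exp (- lam * r) * (indicator {0..} t *\<^sub>R (exp (- lam * t) * S t (B (u r)) q)) \<partial>lborel)"
      by (intro Bochner_Integration.integral_cong refl)
        (auto simp: r k_def indicator_def max_def algebra_simps simp flip: exp_add)
    also have "\<dots> = (\<integral>t. indicator {0..} r * exp (- lam * r) * (indicator {0..} t *\<^sub>R (exp (- lam * t) * S t (B (u r)) q)) \<partial>lebesgue)"
    proof (rule integral_completion[symmetric])
      have "(\<lambda>t. indicator {0..} t *\<^sub>R S t (B (u r)) q) \<in> borel_measurable borel"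
        by (rule borel_measurable_continuous_on_indicator[OF _ continuous_S_apply]) simp
      then have [measurable]: "(\<lambda>t. indicator {0..} t * S t (B (u r)) q) \<in> borel_measurable borel" by simp
      have "(\<lambda>t. indicator {0..} r * exp (- lam * r) * (exp (- lam * t) * (indicator {0..} t * S t (B (u r)) q))) \<in> borel_measurable lborel"
        by measurable
      then show "(\<lambda>t. indicator {0..} r * exp (- lam * r) * (indicator {0..} t *\<^sub>R (exp (- lam * t) * S t (B (u r)) q))) \<in> borel_measurable lborel"
        by (simp add: mult_ac)
    qed
    also have "\<dots> = indicator {0..} r * (exp (- lam * r) * B (u r) (resolvent_adj q))"
      by (simp add: resolvent_adj_apply integral_restrict_space)
    finally show "(\<integral>t. K (r, t) \<partial>lborel) = indicator {0..} r * (exp (- lam * r) * B (u r) (resolvent_adj q))" .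
  qed
  have u_int: "integrable lebesgue (\<lambda>r. indicator {0..} r * (exp (- lam * r) * norm (u r)))"
    using u unfolding control_def by (simp add: integrable_restrict_space)
  have "integrable lborel (\<lambda>r. \<integral>t. norm (K (r, t)) \<partial>lborel)"
  proof (rule integrableI_bounded)
    show "(\<lambda>r. \<integral>t. norm (K (r, t)) \<partial>lborel) \<in> borel_measurable lborel" by measurable
    have "(\<integral>\<^sup>+r. norm (\<integral>t. norm (K (r, t)) \<partial>lborel) \<partial>lborel) \<le>
        (\<integral>\<^sup>+r. norm (C / (lam - \<omega>) * (indicator {0..} r * (exp (- lam * r) * norm (u r)))) \<partial>lborel)"
    proof (rule nn_integral_mono_AE)
      show "AE r in lborel. ennreal (norm (\<integral>t. norm (K (r, t)) \<partial>lborel)) \<le>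
        ennreal (norm (C / (lam - \<omega>) * (indicator {0..} r * (exp (- lam * r) * norm (u r)))))"
        using K_eq
      proof eventually_elim
        case (elim r)
        then have "norm (\<integral>t. norm (K (r, t)) \<partial>lborel) \<le> C / (lam - \<omega>) * (indicator {0..} r * (exp (- lam * r) * norm (u r)))"
          using good(2)[OF elim] by simp
        also have "\<dots> \<le> norm (C / (lam - \<omega>) * (indicator {0..} r * (exp (- lam * r) * norm (u r))))"
          unfolding real_norm_def by (rule abs_ge_self)
        finally show ?case by (rule ennreal_leI)
      qed
    qed
    also have "\<dots> = (\<integral>\<^sup>+r. norm (C / (lam - \<omega>) * (indicator {0..} r * (exp (- lam * r) * norm (u r)))) \<partial>lebesgue)"
      by (simp add: nn_integral_completion)
    also have "\<dots> < \<infinity>"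
      using integrable_mult_right[OF u_int, of "C / (lam - \<omega>)"] unfolding integrable_iff_bounded by (rule conjunct2)
    finally show "(\<integral>\<^sup>+r. norm (\<integral>t. norm (K (r, t)) \<partial>lborel) \<partial>lborel) < \<infinity>" .
  qed
  then have K_int: "integrable (lborel \<Otimes>\<^sub>M lborel) K"
    by (rule lborel_pair.Fubini_integrable[OF K_meas]) (use K_eq in eventually_elim, rule good(1))
  have fubini: "(\<integral>t. (\<integral>r. K (r, t) \<partial>lborel) \<partial>lborel) = (\<integral>r. (\<integral>t. K (r, t) \<partial>lborel) \<partial>lborel)"
    using lborel_pair.Fubini_integral[of "\<lambda>r t. K (r, t)"] K_int by simp
  have inner: "(\<integral>r. K (r, t) \<partial>lborel) = indicator {0..} t *\<^sub>R (exp (- lam * t) * conv u t q)" for t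
  proof (cases "0 \<le> t")
    case False
    have "(\<integral>r. K (r, t) \<partial>lborel) = (\<integral>r. 0 \<partial>(lborel :: real measure))"
    proof (rule Bochner_Integration.integral_cong_AE)
      show "(\<lambda>r. K (r, t)) \<in> borel_measurable lborel" by (rule measurable_compose[OF _ K_meas]) simp
      show "AE r in lborel. K (r, t) = 0"
        using K_eq by eventually_elim (use False in \<open>simp add: k_def\<close>)
    qed simp
    then show ?thesis using False by simp
  next
    case True
    have Kt [measurable]: "(\<lambda>r. K (r, t)) \<in> borel_measurable lborel" by (rule measurable_compose[OF _ K_meas]) simp
    have bi: "has_bochner_integral lebesgue (\<lambda>r. indicator {0..t} r *\<^sub>R (exp (- lam * t) * S (t - r) (B (u r)) q)) (exp (- lam * t) * conv u t q)"
      using has_bochner_integral_mult_right[OF conv_apply[OF u True, of q], of "exp (- lam * t)"]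
      by (simp add: has_bochner_integral_restrict_space)
    have "(\<integral>r. K (r, t) \<partial>lborel) = (\<integral>r. K (r, t) \<partial>lebesgue)"
      by (rule integral_completion[symmetric]) (rule Kt)
    also have "\<dots> = (\<integral>r. indicator {0..t} r *\<^sub>R (exp (- lam * t) * S (t - r) (B (u r)) q) \<partial>lebesgue)"
    proof (rule Bochner_Integration.integral_cong_AE)
      show "(\<lambda>r. K (r, t)) \<in> borel_measurable lebesgue" by (intro measurable_completion Kt)
      show "(\<lambda>r. indicator {0..t} r *\<^sub>R (exp (- lam * t) * S (t - r) (B (u r)) q)) \<in> borel_measurable lebesgue"
        using bi by (rule borel_measurable_has_bochner_integral)
      show "AE r in lebesgue. K (r, t) = indicator {0..t} r *\<^sub>R (exp (- lam * t) * S (t - r) (B (u r)) q)"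
        using AE_completion[OF K_eq] by eventually_elim (simp add: k_def indicator_def)
    qed
    also have "\<dots> = exp (- lam * t) * conv u t q" by (rule has_bochner_integral_integral_eq[OF bi])
    finally show ?thesis using True by simp
  qed
  have "integrable lborel (\<lambda>t. \<integral>r. K (r, t) \<partial>lborel)"
    using lborel_pair.integrable_snd[of "\<lambda>r t. K (r, t)"] K_int by simp
  then have l_int: "integrable lborel (\<lambda>t. indicator {0..} t *\<^sub>R (exp (- lam * t) * conv u t q))"
    unfolding inner .
  then have "integrable lebesgue (\<lambda>t. indicator {0..} t *\<^sub>R (exp (- lam * t) * conv u t q))"
    by (subst integrable_completion) (auto dest: borel_measurable_integrable)
  then show "integrable (lebesgue_on {0..}) (\<lambda>t. exp (- lam * t) * conv u t q)"
    by (simp add: integrable_restrict_space)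
  let ?h = "\<lambda>r. indicator {0..} r *\<^sub>R (exp (- lam * r) * B (u r) (resolvent_adj q))"
  let ?g = "\<lambda>r. \<integral>t. K (r, t) \<partial>lborel"
  have g_int: "integrable lborel ?g"
    using lborel_pair.integrable_fst[of "\<lambda>r t. K (r, t)"] K_int by simp
  have gh: "AE r in lebesgue. ?h r = ?g r"
    using AE_completion[OF K_eq] by eventually_elim (subst good(3), assumption, simp)
  have g_leb: "has_bochner_integral lebesgue ?g (integral\<^sup>L lborel ?g)"
    using g_int by (simp add: has_bochner_integral_iff integrable_completion integral_completion)
  have "?h \<in> borel_measurable lebesgue"
    by (rule completion.borel_measurable_cong_AE_imp[OF borel_measurable_has_bochner_integral[OF g_leb] gh])
  then have "has_bochner_integral lebesgue ?h (integral\<^sup>L lborel ?g)"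
    using g_leb gh by (subst has_bochner_integral_cong_AE) (auto dest: borel_measurable_has_bochner_integral)
  moreover have "integral\<^sup>L lborel ?g = (\<integral>t. exp (- lam * t) * conv u t q \<partial>lebesgue_on {0..})"
  proof -
    have "integral\<^sup>L lborel ?g = (\<integral>t. indicator {0..} t *\<^sub>R (exp (- lam * t) * conv u t q) \<partial>lborel)"
      using fubini by (simp only: inner)
    also have "\<dots> = (\<integral>t. indicator {0..} t *\<^sub>R (exp (- lam * t) * conv u t q) \<partial>lebesgue)"
      by (rule integral_completion[symmetric]) (rule borel_measurable_integrable[OF l_int])
    finally show ?thesis by (simp add: integral_restrict_space)
  qed
  ultimately show "has_bochner_integral (lebesgue_on {0..}) (\<lambda>s. exp (- lam * s) * B (u s) (resolvent_adj q))
      (\<integral>t. exp (- lam * t) * conv u t q \<partial>lebesgue_on {0..})"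
    by (simp add: has_bochner_integral_restrict_space)
qed

end

section \<open>Convex functions with Lipschitz gradient\<close>

lemma lip_const_bound:
  assumes "lip_const f < \<infinity>"
  shows "norm (f x - f y) \<le> enn2real (lip_const f) * norm (x - y)"
proof (cases "x = y")
  case False
  have "ennreal (norm (f x - f y) / norm (x - y)) \<le> lip_const f"
    unfolding lip_const_def by (rule SUP_upper2[of "(x, y)"]) (use False in auto)
  also have "lip_const f = ennreal (enn2real (lip_const f))" using assms by simp
  finally have "norm (f x - f y) / norm (x - y) \<le> enn2real (lip_const f)" by simp
  then show ?thesis using False by (simp add: pos_divide_le_eq)
qed simp

lemma lip_const_le:
  assumes "\<And>x y. norm (f x - f y) \<le> norm (g x - g y)"
  shows "lip_const f \<le> lip_const g"
  unfolding lip_const_def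
proof (rule SUP_mono)
  fix p assume "p \<in> {(x :: 'a, y). x \<noteq> y}"
  then show "\<exists>q\<in>{(x, y). x \<noteq> y}. (case p of (x, y) \<Rightarrow> ennreal (norm (f x - f y) / norm (x - y))) \<le>
      (case q of (x, y) \<Rightarrow> ennreal (norm (g x - g y) / norm (x - y)))"
    by (intro bexI[of _ p]) (auto intro!: ennreal_leI divide_right_mono assms)
qed

lemma Sigma0_frechet:
  assumes "w \<in> Sigma0"
  shows "(w has_derivative blinfun_apply (frechet w x)) (at x)"
proof -
  have d: "(w has_derivative frechet_derivative w (at x)) (at x)"
    using assms unfolding Sigma0_def by (auto simp: frechet_derivative_works)
  then show ?thesis
    unfolding frechet_def using has_derivative_bounded_linear[OF d]
    by (simp add: bounded_linear_Blinfun_apply)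
qed

lemma Sigma0_gradient:
  fixes w :: "'u::{real_inner, complete_space} \<Rightarrow> real"
  assumes "w \<in> Sigma0"
  shows "frechet w x = dual_vec (gradient w x)"
proof -
  obtain d where d: "frechet w x = dual_vec d" by (rule dual_vec_surj)
  have "blinfun_apply (dual_vec d) = (\<lambda>h. inner h d)" by (auto simp: inner_commute)
  then have gd: "GDERIV w x :> d"
    using Sigma0_frechet[OF assms, of x] unfolding d gderiv_def by simp
  have "gradient w x = d"
    unfolding gradient_def
  proof (rule the_equality[where P = "\<lambda>d. GDERIV w x :> d", OF gd])
    fix d' assume "GDERIV w x :> d'"
    then have "(\<lambda>h. inner h d') = (\<lambda>h. inner h d)"
      using gd unfolding gderiv_def by (rule has_derivative_unique)
    from fun_cong[OF this] have "\<forall>h. inner h d' = inner h d" by blast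
    then show "d' = d" by (simp only: vector_eq_ldot)
  qed
  then show ?thesis using d by simp
qed

lemma predual_gradient_eqI:
  fixes f :: "('v::real_inner \<Rightarrow>\<^sub>L real) \<Rightarrow> real"
  assumes "(f has_derivative (\<lambda>\<phi>. blinfun_apply \<phi> v)) (at x)"
  shows "predual_gradient f x = v"
  unfolding predual_gradient_def
proof (rule the_equality[where P = "\<lambda>v. (f has_derivative (\<lambda>\<phi>. blinfun_apply \<phi> v)) (at x)", OF assms])
  fix v' assume "(f has_derivative (\<lambda>\<phi>. blinfun_apply \<phi> v')) (at x)"
  then have "(\<lambda>\<phi> :: 'v \<Rightarrow>\<^sub>L real. blinfun_apply \<phi> v') = (\<lambda>\<phi>. blinfun_apply \<phi> v)"
    using assms by (rule has_derivative_unique)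
  from fun_cong[OF this] show "v' = v" by (rule dual_eqI)
qed

text \<open>By reflexivity every Frechet derivative on V' is evaluation at an element of V, so the
  definite description denotes at each point of differentiability.\<close>

lemma has_predual_gradient:
  fixes f :: "('v::{real_inner, complete_space} \<Rightarrow>\<^sub>L real) \<Rightarrow> real"
  assumes "(f has_derivative F) (at x)"
  shows "F \<phi> = \<phi> (predual_gradient f x)"
    and "(f has_derivative (\<lambda>\<phi>. blinfun_apply \<phi> (predual_gradient f x))) (at x)"
proof -
  obtain v where v: "\<And>\<phi>. F \<phi> = blinfun_apply \<phi> v"
    by (rule hilbert_reflexive[OF has_derivative_bounded_linear[OF assms]]) blast
  then have "F = (\<lambda>\<phi>. blinfun_apply \<phi> v)" by blast
  moreover have "predual_gradient f x = v"
    using assms unfolding calculation by (rule predual_gradient_eqI)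
  ultimately show "F \<phi> = \<phi> (predual_gradient f x)"
    "(f has_derivative (\<lambda>\<phi>. blinfun_apply \<phi> (predual_gradient f x))) (at x)"
    using assms by simp_all
qed

lemma Sigma0_lip_gradient:
  fixes w :: "'u::{real_inner, complete_space} \<Rightarrow> real"
  assumes "w \<in> Sigma0"
  shows "lip_const (gradient w) < \<infinity>"
proof -
  have "lip_const (gradient w) \<le> lip_const (frechet w)"
    by (rule lip_const_le) (simp add: Sigma0_gradient[OF assms] flip: dual_vec_diff)
  then show ?thesis using assms unfolding Sigma0_def by (auto intro: le_less_trans)
qed

lemma Sigma0_lip_predual_gradient:
  fixes w :: "('v::{real_inner, complete_space} \<Rightarrow>\<^sub>L real) \<Rightarrow> real"
  assumes "w \<in> Sigma0"
  shows "lip_const (predual_gradient w) < \<infinity>"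
proof -
  have "lip_const (predual_gradient w) \<le> lip_const (frechet w)"
  proof (rule lip_const_le)
    fix x y
    show "norm (predual_gradient w x - predual_gradient w y) \<le> norm (frechet w x - frechet w y)"
    proof (rule dual_norm_le)
      fix \<phi> :: "'v \<Rightarrow>\<^sub>L real"
      have "\<phi> (predual_gradient w x - predual_gradient w y) = (frechet w x - frechet w y) \<phi>"
        by (simp add: blinfun.diff_right blinfun.diff_left
            has_predual_gradient(1)[OF Sigma0_frechet[OF assms]])
      also have "\<dots> \<le> norm (frechet w x - frechet w y) * norm \<phi>"
        using norm_blinfun[of "frechet w x - frechet w y" \<phi>] by simp
      finally show "\<phi> (predual_gradient w x - predual_gradient w y) \<le> norm (frechet w x - frechet w y) * norm \<phi>" .
    qed simp
  qed
  then show ?thesis using assms unfolding Sigma0_def by (auto intro: le_less_trans)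
qed

lemma convex_above_tangent:
  fixes f :: "'a::real_normed_vector \<Rightarrow> real"
  assumes conv: "convex_on UNIV f" and d: "(f has_derivative F) (at x)"
  shows "f x + F h \<le> f (x + h)"
proof -
  interpret F: bounded_linear F by (rule has_derivative_bounded_linear[OF d])
  have "((\<lambda>t. f (x + t *\<^sub>R h)) has_derivative (\<lambda>t. F (t *\<^sub>R h))) (at 0)"
    by (rule has_derivative_compose[of "\<lambda>t. x + t *\<^sub>R h" "\<lambda>t. t *\<^sub>R h" 0 UNIV f F])
      (use d in \<open>auto intro!: derivative_eq_intros\<close>)
  then have "((\<lambda>t. f (x + t *\<^sub>R h)) has_real_derivative F h) (at 0)"
    by (simp add: has_field_derivative_def F.scaleR mult_commute_abs)
  then have "((\<lambda>t. (f (x + t *\<^sub>R h) - f x) / t) \<longlongrightarrow> F h) (at 0)"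
    by (simp add: DERIV_def)
  then have "((\<lambda>t. (f (x + t *\<^sub>R h) - f x) / t) \<longlongrightarrow> F h) (at_right 0)"
    by (rule tendsto_mono[rotated]) (simp add: at_le)
  moreover have "\<forall>\<^sub>F t in at_right 0. (f (x + t *\<^sub>R h) - f x) / t \<le> f (x + h) - f x"
    unfolding eventually_at_right_field
  proof (intro exI[of _ 1] conjI allI impI)
    fix t :: real assume t: "0 < t" "t < 1"
    have "f ((1 - t) *\<^sub>R x + t *\<^sub>R (x + h)) \<le> (1 - t) * f x + t * f (x + h)"
      using conv t by (intro convex_onD) auto
    moreover have "(1 - t) *\<^sub>R x + t *\<^sub>R (x + h) = x + t *\<^sub>R h" by (simp add: algebra_simps)
    ultimately have "f (x + t *\<^sub>R h) - f x \<le> (f (x + h) - f x) * t" by (simp add: algebra_simps)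
    then show "(f (x + t *\<^sub>R h) - f x) / t \<le> f (x + h) - f x" using t by (simp add: pos_divide_le_eq)
  qed simp
  ultimately have "F h \<le> f (x + h) - f x"
    by (rule tendsto_upperbound) simp
  then show ?thesis by simp
qed

text \<open>The tangent inequality is used at the far point x + h instead of integrating the
  derivative along the segment; the price is the constant L in place of L / 2.\<close>

lemma Sigma0_quadratic_bound:
  assumes "w \<in> Sigma0"
  shows "w (x + h) \<le> w x + frechet w x h + enn2real (lip_const (frechet w)) * (norm h)\<^sup>2"
proof -
  have "w (x + h) + frechet w (x + h) (- h) \<le> w (x + h + - h)"
    using assms by (intro convex_above_tangent Sigma0_frechet) (auto simp: Sigma0_def)
  then have "w (x + h) \<le> w x + frechet w (x + h) h" by (simp add: blinfun.minus_right)
  also have "frechet w (x + h) h = frechet w x h + (frechet w (x + h) - frechet w x) h"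
    by (simp add: blinfun.diff_left)
  also have "(frechet w (x + h) - frechet w x) h \<le> norm (frechet w (x + h) - frechet w x) * norm h"
    using norm_blinfun[of "frechet w (x + h) - frechet w x" h] by simp
  also have "\<dots> \<le> (enn2real (lip_const (frechet w)) * norm (x + h - x)) * norm h"
    using assms by (intro mult_right_mono lip_const_bound) (auto simp: Sigma0_def)
  finally show ?thesis by (simp add: power2_eq_square mult_ac)
qed

text \<open>Slopes of a convex function increase along a ray, so the increment over k is at most 1/N
  times the increment over N k. Linear growth bounds the latter by C |k| as N tends to infinity,
  uniformly in y.\<close>

lemma convex_growth_class_1_lipschitz:
  assumes conv: "convex_on UNIV w" and gr: "w \<in> growth_class 1"
  obtains C where "0 \<le> C" "\<And>y k. w (y + k) - w y \<le> C * norm k"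
proof -
  obtain C where "\<And>x. \<bar>w x\<bar> / (1 + norm x powr 1) \<le> C"
    using gr unfolding growth_class_def bdd_above_def by auto
  then have C: "\<bar>w x\<bar> \<le> C * (1 + norm x)" for x
    by (simp add: pos_divide_le_eq add_pos_nonneg)
  have C0: "0 \<le> C" using C[of 0] by simp
  have "w (y + k) - w y \<le> C * norm k" for y k
  proof (rule LIMSEQ_le_const)
    have "(\<lambda>n. 2 * C * (1 + norm y) * (1 / real (Suc n)) + C * norm k) \<longlonglongrightarrow> 2 * C * (1 + norm y) * 0 + C * norm k"
      by (intro tendsto_intros LIMSEQ_Suc[OF lim_1_over_n])
    then show "(\<lambda>n. 2 * C * (1 + norm y) * (1 / real (Suc n)) + C * norm k) \<longlonglongrightarrow> C * norm k" by simp
    have "w (y + k) - w y \<le> 2 * C * (1 + norm y) * (1 / real (Suc n)) + C * norm k" for n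
    proof -
      let ?N = "real (Suc n)"
      have "w ((1 - 1 / ?N) *\<^sub>R y + (1 / ?N) *\<^sub>R (y + ?N *\<^sub>R k)) \<le> (1 - 1 / ?N) * w y + (1 / ?N) * w (y + ?N *\<^sub>R k)"
        using conv by (intro convex_onD) auto
      moreover have "(1 - 1 / ?N) *\<^sub>R y + (1 / ?N) *\<^sub>R (y + ?N *\<^sub>R k) = y + k"
        by (simp add: scaleR_diff_left scaleR_add_right)
      ultimately have "w (y + k) - w y \<le> (1 / ?N) * (w (y + ?N *\<^sub>R k) - w y)"
        by (simp add: algebra_simps)
      also have "\<dots> \<le> (1 / ?N) * (2 * C * (1 + norm y) + C * (?N * norm k))"
      proof (intro mult_left_mono)
        have "w (y + ?N *\<^sub>R k) \<le> C * (1 + norm (y + ?N *\<^sub>R k))" using C[of "y + ?N *\<^sub>R k"] by simp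
        also have "\<dots> \<le> C * (1 + (norm y + ?N * norm k))"
          using C0 norm_triangle_ineq[of y "?N *\<^sub>R k"] by (intro mult_left_mono add_left_mono) auto
        finally show "w (y + ?N *\<^sub>R k) - w y \<le> 2 * C * (1 + norm y) + C * (?N * norm k)"
          using C[of y] by (simp add: algebra_simps)
      qed simp
      also have "\<dots> = 2 * C * (1 + norm y) * (1 / ?N) + C * norm k"
      proof -
        have "(1 / N) * (e + C * (N * r)) = e * (1 / N) + C * r" if "0 < N" for N e r :: real
          using that by (simp add: field_simps)
        then show ?thesis by simp
      qed
      finally show ?thesis .
    qed
    then show "\<exists>N. \<forall>n\<ge>N. w (y + k) - w y \<le> 2 * C * (1 + norm y) * (1 / real (Suc n)) + C * norm k"
      by blast
  qed
  then show thesis using that C0 by blast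
qed

text \<open>Interpolating between the quadratic and the linear bound on the Taylor remainder gives the
  power that is still integrable against the discount factor.\<close>

lemma Sigma0_holder_remainder:
  assumes w: "w \<in> Sigma0" and om: "0 \<le> \<omega>"
    and alt: "lam > 2 * \<omega> \<or> (lam > \<omega> \<and> w \<in> growth_class 1)"
  obtains \<theta> C where "0 < \<theta>" "0 \<le> C" "(1 + \<theta>) * \<omega> < lam"
    "\<And>x h. w (x + h) \<le> w x + frechet w x h + C * norm h powr (1 + \<theta>)"
proof (cases "lam > 2 * \<omega>")
  case True
  have "norm h powr (1 + 1) = (norm h)\<^sup>2" for h :: 'a
    by (cases "h = 0") (simp_all add: powr_realpow[of _ 2, simplified])
  then show thesis
    using that[of 1 "enn2real (lip_const (frechet w))"] True Sigma0_quadratic_bound[OF w] by simp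
next
  case False
  then have lam: "lam > \<omega>" and gr: "w \<in> growth_class 1" using alt by auto
  have om_pos: "0 < \<omega>" using False lam om by simp
  obtain C where C: "0 \<le> C" "\<And>y k. w (y + k) - w y \<le> C * norm k"
    using convex_growth_class_1_lipschitz[OF _ gr] w unfolding Sigma0_def by blast
  define L where "L = enn2real (lip_const (frechet w))"
  have L: "0 \<le> L" by (simp add: L_def)
  \<comment> \<open>This puts (1 + \<theta>) \<omega> halfway between \<omega> and lam; since lam
    \<le> 2 \<omega> in this case, \<theta> is at most 1.\<close>
  define \<theta> where "\<theta> = (lam - \<omega>) / (2 * \<omega>)"
  have th: "0 < \<theta>" "(1 + \<theta>) * \<omega> < lam" "\<theta> \<le> 1"
    using om_pos lam False by (simp_all add: \<theta>_def field_simps)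
  have "w (x + h) \<le> w x + frechet w x h + (L + 2 * C) * norm h powr (1 + \<theta>)" for x h
  proof (cases "norm h \<le> 1")
    case True
    have "(norm h)\<^sup>2 \<le> norm h powr (1 + \<theta>)"
    proof (cases "h = 0")
      case False
      have "norm h powr 2 \<le> norm h powr (1 + \<theta>)"
        using True False th by (intro powr_mono') auto
      then show ?thesis using False by (simp add: powr_realpow[of _ 2, simplified])
    qed simp
    then have "L * (norm h)\<^sup>2 \<le> (L + 2 * C) * norm h powr (1 + \<theta>)"
      using L C(1) by (intro mult_mono) auto
    then show ?thesis using Sigma0_quadratic_bound[OF w, of x h] unfolding L_def by linarith
  next
    case False
    have "norm h powr 1 \<le> norm h powr (1 + \<theta>)"
      using False th by (intro powr_mono) auto
    then have "(2 * C) * norm h \<le> (L + 2 * C) * norm h powr (1 + \<theta>)"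
      using False L C(1) by (intro mult_mono) auto
    \<comment> \<open>The tangent inequality in direction -h bounds the negative of the linear term
      by C |h|; with the increment of w itself this gives the factor 2 C.\<close>
    moreover have "w x + frechet w x (- h) \<le> w (x + - h)"
      using w by (intro convex_above_tangent Sigma0_frechet) (auto simp: Sigma0_def)
    moreover have "w (x + - h) - w x \<le> C * norm h" "w (x + h) - w x \<le> C * norm h"
      using C(2)[of x "- h"] C(2)[of x h] by auto
    ultimately show ?thesis by (simp add: blinfun.minus_right)
  qed
  then show thesis using that[of \<theta> "L + 2 * C"] th L C(1) by simp
qed

lemma has_derivative_of_powr_remainder:
  fixes f :: "'a::real_normed_vector \<Rightarrow> real"
  assumes F: "bounded_linear F" and th: "0 < \<theta>"
    and rem: "\<And>h. \<bar>f (x + h) - f x - F h\<bar> \<le> C * norm h powr (1 + \<theta>)"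
  shows "(f has_derivative F) (at x)"
  unfolding has_derivative_at
proof (intro conjI F)
  show "(\<lambda>h. norm (f (x + h) - f x - F h) / norm h) \<midarrow>0\<rightarrow> 0"
  proof (rule Lim_null_comparison)
    show "\<forall>\<^sub>F h in at 0. norm (norm (f (x + h) - f x - F h) / norm h) \<le> C * norm h powr \<theta>"
      unfolding eventually_at
    proof (intro exI[of _ 1] conjI ballI impI)
      fix h :: 'a assume "h \<noteq> 0 \<and> dist h 0 < 1"
      then have h: "0 < norm h" by simp
      have "\<bar>f (x + h) - f x - F h\<bar> \<le> (C * norm h powr \<theta>) * norm h"
        using rem[of h] h by (simp add: powr_add mult_ac)
      then show "norm (norm (f (x + h) - f x - F h) / norm h) \<le> C * norm h powr \<theta>"
        using h by (simp add: pos_divide_le_eq)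
    qed simp
    have "((\<lambda>h::'a. norm h powr \<theta>) \<longlongrightarrow> 0) (at 0)"
      using th by (intro tendsto_zero_powrI[where b = \<theta>] tendsto_norm_zero tendsto_const) auto
    then show "((\<lambda>h::'a. C * norm h powr \<theta>) \<longlongrightarrow> 0) (at 0)" by (rule tendsto_mult_right_zero)
  qed
qed

text \<open>Difference quotients decrease to a directional derivative \<open>d\<close>, sublinear by
  convexity. Semiconcavity with a power above 1 gives d h + d (-h) \<le> 0, so \<open>d\<close> is
  odd and therefore linear; the local lower bound makes it continuous. The same two inequalities
  bound the remainder uniformly in the direction, whence the derivative is Frechet.\<close>

theorem convex_semiconcave_differentiable:
  fixes f :: "'a::real_normed_vector \<Rightarrow> real"
  assumes conv: "convex_on UNIV f" and th: "0 < \<theta>" and C0: "0 \<le> C"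
    and semi: "\<And>h. f (x + h) + f (x - h) - 2 * f x \<le> C * norm h powr (1 + \<theta>)"
    and below: "\<And>h. norm h \<le> 1 \<Longrightarrow> c \<le> f (x + h)"
  obtains F where "(f has_derivative F) (at x)"
proof -
  define Q where "Q h t = (f (x + t *\<^sub>R h) - f x) / t" for h t
  define d where "d h = (INF t\<in>{0<..}. Q h t)" for h
  \<comment> \<open>\<open>x\<close> is a convex combination of the two points, with weight s / (s +
    t) on the first. Hence backward slopes lie below forward slopes, and the infimum defining
    \<open>d\<close> is finite.\<close>
  have mid: "f x \<le> (s * f (x + t *\<^sub>R h) + t * f (x - s *\<^sub>R h)) / (s + t)" if "0 < s" "0 < t" for h s t
  proof -
    let ?r = "t / (s + t)"
    have r: "0 \<le> ?r" "?r \<le> 1" "1 - ?r = s / (s + t)" using that by (auto simp: field_simps)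
    have "f ((1 - ?r) *\<^sub>R (x + t *\<^sub>R h) + ?r *\<^sub>R (x - s *\<^sub>R h)) \<le> (1 - ?r) * f (x + t *\<^sub>R h) + ?r * f (x - s *\<^sub>R h)"
      using conv r by (intro convex_onD) auto
    moreover have "(1 - ?r) *\<^sub>R (x + t *\<^sub>R h) + ?r *\<^sub>R (x - s *\<^sub>R h) = x"
      unfolding r(3) using that
      by (simp add: scaleR_add_right scaleR_diff_right mult.commute flip: add_divide_distrib)
        (metis add_divide_distrib add_pos_pos divide_self_if less_irrefl scaleR_left_distrib scaleR_one add.commute)
    ultimately show ?thesis unfolding r(3) by (simp add: add_divide_distrib)
  qed
  have Q_ge: "- Q (- h) s \<le> Q h t" if "0 < s" "0 < t" for h s t
  proof -
    have "(s + t) * f x \<le> s * f (x + t *\<^sub>R h) + t * f (x - s *\<^sub>R h)"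
      using mid[OF that, of h] that by (simp add: pos_le_divide_eq mult.commute)
    then have "t * (f x - f (x - s *\<^sub>R h)) \<le> s * (f (x + t *\<^sub>R h) - f x)" by (simp add: algebra_simps)
    then show ?thesis unfolding Q_def using that by (simp add: field_simps)
  qed
  have bdd: "bdd_below (Q h ` {0<..})" for h
    using Q_ge[of 1 _ h] by (intro bdd_belowI[of _ "- Q (- h) 1"]) auto
  have d_le: "d h \<le> Q h t" if "0 < t" for h t
    unfolding d_def using that bdd by (intro cINF_lower) auto
  have d_greatest: "a \<le> d h" if "\<And>t. 0 < t \<Longrightarrow> a \<le> Q h t" for a h
    unfolding d_def using that by (intro cINF_greatest) auto
  have Q_mono: "Q h s \<le> Q h t" if "0 < s" "s \<le> t" for h s t
  proof -
    have t: "0 < t" using that by simp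
    have "f ((1 - s / t) *\<^sub>R x + (s / t) *\<^sub>R (x + t *\<^sub>R h)) \<le> (1 - s / t) * f x + (s / t) * f (x + t *\<^sub>R h)"
      using conv that by (intro convex_onD) auto
    moreover have "(1 - s / t) *\<^sub>R x + (s / t) *\<^sub>R (x + t *\<^sub>R h) = x + s *\<^sub>R h"
      using t by (simp add: algebra_simps)
    ultimately have "f (x + s *\<^sub>R h) \<le> (1 - s / t) * f x + (s / t) * f (x + t *\<^sub>R h)"
      by (simp only:)
    then have "f (x + s *\<^sub>R h) - f x \<le> (s / t) * (f (x + t *\<^sub>R h) - f x)"
      by (simp add: left_diff_distrib right_diff_distrib)
    then have "(f (x + s *\<^sub>R h) - f x) / s \<le> (s / t) * (f (x + t *\<^sub>R h) - f x) / s"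
      using that by (intro divide_right_mono) auto
    then show ?thesis unfolding Q_def using that t by simp
  qed
  have neg_le: "d h + d (- h) \<le> 0" for h
  proof (rule tendsto_lowerbound)
    have "((\<lambda>t. C * (t powr \<theta> * norm h powr (1 + \<theta>))) \<longlongrightarrow> C * (0 * norm h powr (1 + \<theta>))) (at_right 0)"
      using th by (intro tendsto_intros tendsto_zero_powrI[where b = \<theta>])
        (auto simp: eventually_at_right_field intro: exI[of _ 1])
    then show "((\<lambda>t. C * (t powr \<theta> * norm h powr (1 + \<theta>))) \<longlongrightarrow> 0) (at_right 0)" by simp
    show "\<forall>\<^sub>F t in at_right 0. d h + d (- h) \<le> C * (t powr \<theta> * norm h powr (1 + \<theta>))"
      unfolding eventually_at_right_field
    proof (intro exI[of _ 1] conjI allI impI)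
      fix t :: real assume t: "0 < t"
      have "d h + d (- h) \<le> Q h t + Q (- h) t" using d_le[OF t] by (intro add_mono) auto
      also have "\<dots> = (f (x + t *\<^sub>R h) + f (x - t *\<^sub>R h) - 2 * f x) / t"
        unfolding Q_def by (simp add: diff_divide_distrib add_divide_distrib)
      also have "\<dots> \<le> (C * norm (t *\<^sub>R h) powr (1 + \<theta>)) / t"
        using t by (intro divide_right_mono semi) auto
      also have "\<dots> = C * (t powr \<theta> * norm h powr (1 + \<theta>))"
        using t by (simp add: powr_mult powr_add)
      finally show "d h + d (- h) \<le> C * (t powr \<theta> * norm h powr (1 + \<theta>))" .
    qed simp
  qed simp
  have "- d (- h) \<le> d h" for h
  proof (rule d_greatest)
    fix t :: real assume "0 < t"
    have "- Q h t \<le> d (- h)" using Q_ge[of t _ "- h"] \<open>0 < t\<close> by (intro d_greatest) auto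
    then show "- d (- h) \<le> Q h t" by simp
  qed
  with neg_le have d_minus: "d (- h) = - d h" for h by (smt (verit))
  have d_add_le: "d (h + k) \<le> d h + d k" for h k
  proof (rule field_le_epsilon)
    fix e :: real assume e: "0 < e"
    have "\<exists>t>0. Q h t < d h + e / 2" for h
      using cInf_lessD[of "Q h ` {0<..}" "d h + e / 2"] e unfolding d_def by auto
    then obtain s t where s: "0 < s" "Q h s < d h + e / 2" and t: "0 < t" "Q k t < d k + e / 2" by metis
    \<comment> \<open>A common step for both directions; the midpoint of the two displaced points
      has displacement r / 2 along h + k.\<close>
    define r where "r = min s t"
    have r: "0 < r" "r \<le> s" "r \<le> t" using s t by (auto simp: r_def)
    have "f ((1 - 1/2) *\<^sub>R (x + r *\<^sub>R h) + (1/2) *\<^sub>R (x + r *\<^sub>R k)) \<le> (1 - 1/2) * f (x + r *\<^sub>R h) + (1/2) * f (x + r *\<^sub>R k)"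
      using conv by (intro convex_onD) auto
    moreover have "(1 - 1/2) *\<^sub>R (x + r *\<^sub>R h) + (1/2) *\<^sub>R (x + r *\<^sub>R k) = x + (r / 2) *\<^sub>R (h + k)"
    proof -
      have "x = (1/2) *\<^sub>R x + (1/2) *\<^sub>R x" by (simp flip: scaleR_left_distrib)
      then show ?thesis by (simp add: scaleR_add_right)
    qed
    ultimately have "f (x + (r / 2) *\<^sub>R (h + k)) \<le> (1/2) * f (x + r *\<^sub>R h) + (1/2) * f (x + r *\<^sub>R k)" by simp
    then have "(f (x + (r / 2) *\<^sub>R (h + k)) - f x) * 2 / r \<le>
        ((f (x + r *\<^sub>R h) - f x) + (f (x + r *\<^sub>R k) - f x)) / r"
      using r(1) by (intro divide_right_mono) auto
    then have "Q (h + k) (r / 2) \<le> Q h r + Q k r"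
      unfolding Q_def by (simp only: add_divide_distrib divide_divide_eq_right)
    also have "\<dots> \<le> Q h s + Q k t" using r by (intro add_mono Q_mono)
    finally show "d (h + k) \<le> d h + d k + e"
      using d_le[of "r / 2" "h + k"] r(1) s(2) t(2) by simp
  qed
  have d_add: "d (h + k) = d h + d k" for h k
  proof (rule antisym[OF d_add_le])
    have "- h + - k = - (h + k)" by simp
    then show "d h + d k \<le> d (h + k)"
      using d_add_le[of "- h" "- k"] d_minus[of h] d_minus[of k] d_minus[of "h + k"] by simp
  qed
  have scale_le: "d (r *\<^sub>R h) \<le> r * d h" if r: "0 < r" for r h
  proof -
    have "d (r *\<^sub>R h) / r \<le> d h"
    proof (rule d_greatest)
      fix t :: real assume t: "0 < t"
      have "d (r *\<^sub>R h) \<le> Q (r *\<^sub>R h) (t / r)" using t r by (intro d_le) auto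
      also have "\<dots> = r * Q h t" unfolding Q_def using r t by simp
      finally show "d (r *\<^sub>R h) / r \<le> Q h t" using r by (simp add: pos_divide_le_eq mult.commute)
    qed
    then show ?thesis using r by (simp add: pos_divide_le_eq mult.commute)
  qed
  have scale_pos: "d (r *\<^sub>R h) = r * d h" if r: "0 < r" for r h
  proof (rule antisym[OF scale_le[OF r]])
    have "d ((1 / r) *\<^sub>R (r *\<^sub>R h)) \<le> (1 / r) * d (r *\<^sub>R h)" using r by (intro scale_le) simp
    then show "r * d h \<le> d (r *\<^sub>R h)" using r by (simp add: pos_le_divide_eq mult.commute)
  qed
  have d_0: "d 0 = 0" using d_minus[of 0] by simp
  have scale: "d (r *\<^sub>R h) = r * d h" for r h
  proof (cases r "0::real" rule: linorder_cases)
    case less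
    then have "d ((- r) *\<^sub>R (- h)) = (- r) * d (- h)" by (intro scale_pos) simp
    then show ?thesis by (simp add: d_minus)
  qed (use scale_pos d_0 in auto)
  \<comment> \<open>On the unit ball semiconcavity turns the lower bound at x - h into an upper
    bound at x + h.\<close>
  define M where "M = \<bar>f x\<bar> + C + \<bar>c\<bar>"
  have unit: "d h \<le> M" if h: "norm h \<le> 1" for h
  proof -
    have "norm h powr (1 + \<theta>) \<le> 1 powr (1 + \<theta>)" using h th by (intro powr_mono2) auto
    then have "C * norm h powr (1 + \<theta>) \<le> C" using C0 mult_left_mono[of "norm h powr (1 + \<theta>)" 1 C] by simp
    moreover have "c \<le> f (x + - h)" by (rule below) (simp add: h)
    ultimately have "f (x + h) \<le> C + 2 * f x - c" using semi[of h] by simp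
    then show ?thesis using d_le[of 1 h] unfolding Q_def M_def by simp
  qed
  have bound: "norm (d h) \<le> norm h * M" for h
  proof (cases "h = 0")
    case False
    have "d (k /\<^sub>R norm h) \<le> M" if "norm k = norm h" for k using that False by (intro unit) simp
    from this[of h] this[of "- h"] have "\<bar>d h\<bar> / norm h \<le> M"
      using False by (simp add: scale d_minus abs_if divide_inverse mult.commute)
    then show ?thesis using False by (simp add: pos_divide_le_eq mult.commute)
  qed (simp add: d_0)
  have "bounded_linear d"
    by (rule bounded_linear_intro[where K = M]) (auto simp: d_add scale bound[unfolded real_norm_def])
  moreover have "\<bar>f (x + h) - f x - d h\<bar> \<le> C * norm h powr (1 + \<theta>)" for h
    using d_le[of 1 h] d_le[of 1 "- h"] semi[of h] d_minus[of h] unfolding Q_def by simp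
  ultimately have "(f has_derivative d) (at x)"
    by (rule has_derivative_of_powr_remainder[OF _ th])
  then show thesis by (rule that)
qed

section \<open>Conjugate functions and the cost functional\<close>

lemma lower_semicontinuous_borel_measurable:
  fixes h :: "'a::metric_space \<Rightarrow> ereal"
  assumes "lower_semicontinuous h"
  shows "h \<in> borel_measurable borel"
proof (rule borel_measurableI_greater)
  fix y
  have "open {x. y < h x}"
    unfolding open_dist
  proof
    fix x assume x: "x \<in> {x. y < h x}"
    then have "y < Liminf (at x) h"
      using assms unfolding lower_semicontinuous_def by (auto intro: less_le_trans)
    then have "\<forall>\<^sub>F z in at x. y < h z" by (rule less_LiminfD)
    then obtain d where d: "0 < d" "\<And>z. z \<noteq> x \<Longrightarrow> dist z x < d \<Longrightarrow> y < h z"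
      unfolding eventually_at by auto
    then show "\<exists>e>0. \<forall>z. dist z x < e \<longrightarrow> z \<in> {x. y < h x}"
      using x by (metis mem_Collect_eq)
  qed
  then show "{x \<in> space borel. y < h x} \<in> sets borel" by simp
qed

locale conjugate_pair =
  fixes h0 :: "'u::{real_inner, complete_space} \<Rightarrow> ereal" and hstar :: "'u \<Rightarrow> real"
  assumes h0_proper: "\<And>u. h0 u \<noteq> - \<infinity>"
    and h0_lsc: "lower_semicontinuous h0"
    and conj: "\<And>q. convex_conjugate h0 q = ereal (hstar q)"
    and hstar: "hstar \<in> Sigma0"
begin

lemma h0_ge: "ereal (inner q v - hstar q) \<le> h0 v"
proof -
  have "ereal (inner q v) - h0 v \<le> ereal (hstar q)"
    unfolding conj[symmetric] convex_conjugate_def by (rule SUP_upper) simp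
  then show ?thesis using h0_proper[of v] by (cases "h0 v") auto
qed

text \<open>Strong convexity modulus of \<open>h0\<close>, dual to the Lipschitz constant of the gradient of its
  conjugate.\<close>

definition modulus :: real where
  "modulus = 1 / (4 * max 1 (enn2real (lip_const (frechet hstar))))"

lemma modulus_pos: "0 < modulus" by (simp add: modulus_def less_max_iff_disj)

text \<open>In the Fenchel inequality the slope \<open>q\<close> is replaced by q + s (v - u), u
  being the gradient at q. The gain is linear in s, the loss from the quadratic bound on the
  conjugate is L s^2, and optimizing in s leaves the modulus.\<close>

lemma h0_strongly_convex:
  "ereal (inner q v - hstar q + modulus * (norm (v - gradient hstar q))\<^sup>2) \<le> h0 v"
proof -
  define u where "u = gradient hstar q"
  \<comment> \<open>The lower limit 1 keeps 1 / (2 L) meaningful when the gradient is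
    constant.\<close>
  define L where "L = max 1 (enn2real (lip_const (frechet hstar)))"
  have L: "0 < L" "enn2real (lip_const (frechet hstar)) \<le> L" by (auto simp: L_def less_max_iff_disj)
  \<comment> \<open>The maximizer of s - L s^2, with maximum 1 / (4 L).\<close>
  define s where "s = 1 / (2 * L)"
  let ?w = "v - u"
  have "hstar (q + s *\<^sub>R ?w) \<le> hstar q + frechet hstar q (s *\<^sub>R ?w) +
      enn2real (lip_const (frechet hstar)) * (norm (s *\<^sub>R ?w))\<^sup>2"
    by (rule Sigma0_quadratic_bound[OF hstar])
  also have "\<dots> \<le> hstar q + frechet hstar q (s *\<^sub>R ?w) + L * (norm (s *\<^sub>R ?w))\<^sup>2"
    using L by (intro add_left_mono mult_right_mono) auto
  also have "\<dots> = hstar q + s * inner u ?w + L * s\<^sup>2 * (norm ?w)\<^sup>2"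
    unfolding Sigma0_gradient[OF hstar] u_def by (simp add: power_mult_distrib)
  finally have "inner q v - hstar q + (s - L * s\<^sup>2) * (norm ?w)\<^sup>2 \<le>
      inner (q + s *\<^sub>R ?w) v - hstar (q + s *\<^sub>R ?w)"
    by (simp add: inner_add_left inner_diff_left inner_diff_right power2_norm_eq_inner
        inner_commute algebra_simps)
  moreover have "s - L * s\<^sup>2 = modulus"
    using L(1) unfolding s_def modulus_def L_def[symmetric] by (simp add: field_simps power2_eq_square)
  ultimately show ?thesis
    using h0_ge[of "q + s *\<^sub>R ?w" v] unfolding u_def by (auto intro: order_trans[rotated])
qed

text \<open>Near-maximizers in the definition of the conjugate converge to the gradient by strong
  convexity, so lower semicontinuity yields the equality case without biconjugation.\<close>

lemma h0_gradient: "h0 (gradient hstar q) = ereal (inner q (gradient hstar q) - hstar q)"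
proof (rule antisym[OF _ h0_ge])
  define u where "u = gradient hstar q"
  show "h0 (gradient hstar q) \<le> ereal (inner q (gradient hstar q) - hstar q)"
    unfolding u_def[symmetric]
  proof (rule ccontr)
    assume "\<not> h0 u \<le> ereal (inner q u - hstar q)"
    then obtain d where d: "inner q u - hstar q < d" "ereal d < h0 u"
      using ereal_dense2[of "ereal (inner q u - hstar q)" "h0 u"] by (auto simp: not_le)
    have "ereal d < Liminf (at u) h0"
      using d(2) h0_lsc unfolding lower_semicontinuous_def by (auto intro: less_le_trans)
    then have "\<forall>\<^sub>F z in at u. ereal d < h0 z" by (rule less_LiminfD)
    then obtain r where r: "0 < r" "\<And>z. z \<noteq> u \<Longrightarrow> dist z u < r \<Longrightarrow> ereal d < h0 z"
      unfolding eventually_at by auto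
    define e0 where "e0 = (d - (inner q u - hstar q)) / 2"
    have e0: "0 < e0" using d(1) by (simp add: e0_def)
    define r' where "r' = min r (e0 / (norm q + 1))"
    have r': "0 < r'" "r' \<le> r" using r(1) e0 by (auto simp: r'_def add_nonneg_pos)
    \<comment> \<open>The second entry forces an e-maximizer z within r' of u by strong convexity,
      and r' makes (q | z - u) at most e0. With e \<le> e0 the total excess of \<open>h0 z\<close>
      stays below 2 e0, the distance to d.\<close>
    define e where "e = min e0 (modulus * r'\<^sup>2)"
    have e: "0 < e" using e0 r' modulus_pos by (simp add: e_def)
    obtain z where z: "ereal (hstar q - e) < ereal (inner q z) - h0 z"
    proof -
      have "ereal (hstar q - e) < (SUP u. ereal (inner q u) - h0 u)"
        using conj[of q] e unfolding convex_conjugate_def by simp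
      then show thesis using that unfolding less_SUP_iff by blast
    qed
    then obtain hz where hz: "h0 z = ereal hz" using h0_proper[of z] by (cases "h0 z") auto
    have 1: "hz < inner q z - hstar q + e" using z hz by simp
    have "modulus * (norm (z - u))\<^sup>2 < e"
      using h0_strongly_convex[of q z] 1 unfolding hz u_def by simp
    also have "\<dots> \<le> modulus * r'\<^sup>2" by (simp add: e_def)
    finally have "(norm (z - u))\<^sup>2 < r'\<^sup>2" using modulus_pos by simp
    then have near: "norm (z - u) < r'" by (rule power2_less_imp_less) (use r' in simp)
    have "inner q z - inner q u \<le> norm q * norm (z - u)"
      using norm_cauchy_schwarz[of q "z - u"] by (simp add: inner_diff_right)
    also have "\<dots> \<le> (norm q + 1) * (e0 / (norm q + 1))"
      using near by (intro mult_mono) (auto simp: r'_def)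
    also have "\<dots> = e0" using norm_ge_zero[of q] by (simp add: add_nonneg_eq_0_iff)
    finally have "inner q z - inner q u \<le> e0" .
    moreover have "2 * e0 = d - (inner q u - hstar q)" by (simp add: e0_def)
    moreover have "e \<le> e0" by (simp add: e_def)
    ultimately have "hz < d" using 1 by linarith
    moreover have "ereal d < h0 z"
      using r(2)[of z] d(2) near r'(2) by (cases "z = u") (auto simp: dist_norm)
    ultimately show False using hz by simp
  qed
qed

end

text \<open>The integrable minorant makes the negative part finite, so the extended integral never
  subtracts infinities: it is infinite or an ordinary Bochner integral.\<close>

lemma ereal_integral_cases:
  assumes F: "F \<in> borel_measurable M" and l: "integrable M l" and le: "\<And>x. x \<in> space M \<Longrightarrow> ereal (l x) \<le> F x"
  shows "ereal_integral M F = \<infinity> \<or>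
    (AE x in M. F x \<noteq> \<infinity>) \<and> (\<exists>c. ereal_integral M F = ereal c \<and> has_bochner_integral M (\<lambda>x. real_of_ereal (F x)) c)"
    (is "_ \<or> ?fin")
    and "(AE x in M. F x \<noteq> \<infinity>) \<Longrightarrow> has_bochner_integral M (\<lambda>x. real_of_ereal (F x)) c \<Longrightarrow>
      ereal_integral M F = ereal c"
proof -
  let ?P = "\<integral>\<^sup>+x. e2ennreal (F x) \<partial>M" and ?N = "\<integral>\<^sup>+x. e2ennreal (- F x) \<partial>M"
  let ?f = "\<lambda>x. real_of_ereal (F x)"
  note [measurable] = F
  have N: "?N < \<infinity>"
  proof -
    have "?N \<le> (\<integral>\<^sup>+x. norm (l x) \<partial>M)"
    proof (rule nn_integral_mono)
      fix x assume "x \<in> space M"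
      have "- F x \<le> - ereal (l x)" using le[OF \<open>x \<in> space M\<close>] ereal_minus_le_minus by blast
      also have "\<dots> \<le> ereal (norm (l x))" by simp
      finally have "e2ennreal (- F x) \<le> e2ennreal (ereal (norm (l x)))" by (rule e2ennreal_mono)
      then show "e2ennreal (- F x) \<le> ennreal (norm (l x))" by simp
    qed
    also have "\<dots> < \<infinity>" using l unfolding integrable_iff_bounded by (rule conjunct2)
    finally show ?thesis .
  qed
  have not_minf: "F x \<noteq> - \<infinity>" if "x \<in> space M" for x using le[OF that] by (cases "F x") auto
  have parts: "?P = (\<integral>\<^sup>+x. ennreal (?f x) \<partial>M)" "?N = (\<integral>\<^sup>+x. ennreal (- ?f x) \<partial>M)"
    if ae: "AE x in M. F x \<noteq> \<infinity>"
  proof -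
    have *: "AE x in M. e2ennreal (F x) = ennreal (?f x) \<and> e2ennreal (- F x) = ennreal (- ?f x)"
      using ae AE_space
    proof eventually_elim
      case (elim x)
      then obtain r where "F x = ereal r" using not_minf[of x] by (cases "F x") auto
      then show ?case by simp
    qed
    show "?P = (\<integral>\<^sup>+x. ennreal (?f x) \<partial>M)" "?N = (\<integral>\<^sup>+x. ennreal (- ?f x) \<partial>M)"
      by (rule nn_integral_cong_AE; use * in eventually_elim; simp)+
  qed
  show fin: "ereal_integral M F = ereal c"
    if ae: "AE x in M. F x \<noteq> \<infinity>" and bi: "has_bochner_integral M ?f c" for c
  proof -
    have i: "integrable M ?f" and c: "integral\<^sup>L M ?f = c" using bi by (auto simp: has_bochner_integral_iff)
    have "?P < \<infinity>" "?N < \<infinity>"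
      using i unfolding parts[OF ae] real_integrable_def by (auto simp: less_top)
    then obtain P N where PN: "?P = ennreal P" "0 \<le> P" "?N = ennreal N" "0 \<le> N"
      by (cases ?P; cases ?N) auto
    have "c = P - N"
      using real_lebesgue_integral_def[OF i] c PN unfolding parts[OF ae, symmetric] by simp
    then show ?thesis using PN by (simp add: ereal_integral_def)
  qed
  show "ereal_integral M F = \<infinity> \<or> ?fin"
  proof (cases "?P = \<infinity>")
    case True
    then show ?thesis using N by (cases ?N) (auto simp: ereal_integral_def)
  next
    case False
    have "AE x in M. e2ennreal (F x) \<noteq> \<infinity>"
      by (rule nn_integral_noteq_infinite) (use False in auto)
    then have ae: "AE x in M. F x \<noteq> \<infinity>" by eventually_elim auto
    have "integrable M ?f"
      unfolding real_integrable_def using False N parts[OF ae] by (auto simp: less_top)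
    then have "has_bochner_integral M ?f (integral\<^sup>L M ?f)" by (rule has_bochner_integral_integrable)
    with fin[OF ae this] ae show ?thesis by blast
  qed
qed

text \<open>The two growth alternatives enter only through the exponent 1 + \<theta> and the
  constant \<open>Cg\<close>, as provided by \<open>Sigma0_holder_remainder\<close>.\<close>

locale control_problem = control_system S B \<omega> lam + conjugate_pair h0 hstar
  for S :: "real \<Rightarrow> ('v::{real_inner, complete_space} \<Rightarrow>\<^sub>L real) \<Rightarrow>\<^sub>L ('v \<Rightarrow>\<^sub>L real)"
    and B :: "'u::{real_inner, complete_space} \<Rightarrow>\<^sub>L ('v \<Rightarrow>\<^sub>L real)"
    and \<omega> lam :: real and h0 :: "'u \<Rightarrow> ereal" and hstar :: "'u \<Rightarrow> real" +
  fixes g0 :: "('v \<Rightarrow>\<^sub>L real) \<Rightarrow> real" and a b p \<theta> Cg :: real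
  assumes g0: "g0 \<in> Sigma0"
    and theta: "0 < \<theta>" and Cg: "0 \<le> Cg" and theta_lam: "(1 + \<theta>) * \<omega> < lam"
    and g0_remainder: "\<And>y k. g0 (y + k) \<le> g0 y + frechet g0 y k + Cg * norm k powr (1 + \<theta>)"
    and h0_convex: "ereal_convex h0"
    and a_pos: "0 < a" and p_ge: "2 \<le> p" and coercive: "\<And>u. ereal (a * norm u powr p + b) \<le> h0 u"
begin

definition g' :: "('v \<Rightarrow>\<^sub>L real) \<Rightarrow> 'v" where "g' = predual_gradient g0"

lemma frechet_g0: "frechet g0 y k = blinfun_apply k (g' y)"
  unfolding g'_def by (rule has_predual_gradient(1)[OF Sigma0_frechet[OF g0]])

lemma g0_ge: "g0 y + blinfun_apply k (g' y) \<le> g0 (y + k)"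
  using convex_above_tangent[OF _ Sigma0_frechet[OF g0], of y k] g0
  by (simp add: Sigma0_def frechet_g0)

lemma g0_le: "g0 (y + k) \<le> g0 y + blinfun_apply k (g' y) + Cg * norm k powr (1 + \<theta>)"
  using g0_remainder[of y k] by (simp add: frechet_g0)

lemma g0_measurable: "g0 \<in> borel_measurable borel"
  by (intro borel_measurable_continuous_onI differentiable_imp_continuous_on)
    (use g0 in \<open>auto simp: Sigma0_def differentiable_on_def\<close>)

section \<open>Finite costs and the value as a real infimum\<close>

lemma weighted_Lp_norm:
  "norm (exp (- lam * t / p) *\<^sub>R w) powr p = exp (- lam * t) * norm w powr p"
  using p_ge by (simp add: powr_mult exp_powr_real)

lemma weighted_Lp_iff:
  "v \<in> weighted_Lp p lam \<longleftrightarrow> strongly_measurable (lebesgue_on {0..}) v \<and>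
    integrable (lebesgue_on {0..}) (\<lambda>t. exp (- lam * t) * norm (v t) powr p)"
proof -
  have "integrable (lebesgue_on {0..}) (\<lambda>t. exp (- lam * t) * norm (v t) powr p) \<longleftrightarrow>
      (\<integral>\<^sup>+t. ennreal (exp (- lam * t) * norm (v t) powr p) \<partial>lebesgue_on {0..}) < \<infinity>"
    if "strongly_measurable (lebesgue_on {0..}) v"
  proof -
    have [measurable]: "v \<in> borel_measurable (lebesgue_on {0..})"
      by (intro complete_measure.strongly_measurable_imp_borel complete_measure_lebesgue_on that) simp
    have "(\<lambda>t. exp (- lam * t) * norm (v t) powr p) \<in> borel_measurable (lebesgue_on {0..})"
      by measurable
    then show ?thesis unfolding integrable_iff_bounded by simp
  qed
  then show ?thesis unfolding weighted_Lp_def mem_Collect_eq weighted_Lp_norm by blast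
qed

lemma exp_integrable: "integrable (lebesgue_on {0..}) (\<lambda>t. exp (- lam * t))"
  and exp_integral: "(\<integral>t. exp (- lam * t) \<partial>lebesgue_on {0..}) = 1 / lam"
  using has_bochner_integral_exp_atLeast[OF lam_pos, of 0] by (auto simp: has_bochner_integral_iff)

lemma weighted_Lp_control:
  assumes "v \<in> weighted_Lp p lam"
  shows "control v"
proof -
  have v: "strongly_measurable (lebesgue_on {0..}) v"
    and i: "integrable (lebesgue_on {0..}) (\<lambda>t. exp (- lam * t) * norm (v t) powr p)"
    using assms by (auto simp: weighted_Lp_iff)
  have [measurable]: "v \<in> borel_measurable (lebesgue_on {0..})"
    by (intro complete_measure.strongly_measurable_imp_borel complete_measure_lebesgue_on v) simp
  have "integrable (lebesgue_on {0..}) (\<lambda>t. exp (- lam * t) * norm (v t))"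
  proof (rule Bochner_Integration.integrable_bound[OF Bochner_Integration.integrable_add[OF exp_integrable i]])
    show "AE t in lebesgue_on {0..}. norm (exp (- lam * t) * norm (v t)) \<le>
        norm (exp (- lam * t) + exp (- lam * t) * norm (v t) powr p)"
    proof (rule AE_I2)
      fix t
      have "norm (v t) \<le> 1 + norm (v t) powr p"
      proof (cases "norm (v t) \<le> 1")
        case False
        then have "norm (v t) powr 1 \<le> norm (v t) powr p" using p_ge by (intro powr_mono) auto
        then show ?thesis by simp
      qed (simp add: add_increasing2)
      then have "exp (- lam * t) * norm (v t) \<le> exp (- lam * t) * (1 + norm (v t) powr p)"
        by (rule mult_left_mono) simp
      then show "norm (exp (- lam * t) * norm (v t)) \<le> norm (exp (- lam * t) + exp (- lam * t) * norm (v t) powr p)"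
        by (simp add: abs_mult distrib_left)
    qed
  qed measurable
  with v show ?thesis unfolding control_def by blast
qed

lemma weighted_Lp_const: "(\<lambda>_. w) \<in> weighted_Lp p lam"
  unfolding weighted_Lp_iff using exp_integrable by (auto intro!: strongly_measurable_simple)

abbreviation "traj \<equiv> trajectory S B"

definition running :: "('v \<Rightarrow>\<^sub>L real) \<Rightarrow> (real \<Rightarrow> 'u) \<Rightarrow> real \<Rightarrow> real" where
  "running x v t = exp (- lam * t) * (g0 (traj x v t) + real_of_ereal (h0 (v t)))"

text \<open>The real counterpart of \<open>cost\<close>: by \<open>cost_cases\<close> a control in
  \<open>weighted_Lp\<close> has either infinite cost or a cost in this sense, so later estimates
  are made in the reals.\<close>

definition has_cost :: "('v \<Rightarrow>\<^sub>L real) \<Rightarrow> (real \<Rightarrow> 'u) \<Rightarrow> real \<Rightarrow> bool" where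
  "has_cost x v c \<longleftrightarrow> v \<in> weighted_Lp p lam \<and> (AE t in lebesgue_on {0..}. h0 (v t) \<noteq> \<infinity>) \<and>
     has_bochner_integral (lebesgue_on {0..}) (running x v) c"

abbreviation \<Psi> :: "('v \<Rightarrow>\<^sub>L real) \<Rightarrow> real" where
  "\<Psi> \<equiv> value_function S B g0 h0 lam p"

lemma h0_measurable: "h0 \<in> borel_measurable borel"
  by (rule lower_semicontinuous_borel_measurable[OF h0_lsc])

lemma g0_traj_measurable: "control v \<Longrightarrow> (\<lambda>t. g0 (traj x v t)) \<in> borel_measurable (lebesgue_on {0..})"
  by (rule measurable_compose[OF trajectory_measurable g0_measurable])

lemma h0_control_measurable: "control v \<Longrightarrow> (\<lambda>t. h0 (v t)) \<in> borel_measurable (lebesgue_on {0..})"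
  by (rule measurable_compose[OF control_measurable h0_measurable])

lemma running_measurable:
  assumes "control v"
  shows "running x v \<in> borel_measurable (lebesgue_on {0..})"
proof -
  note [measurable] = g0_traj_measurable[OF assms, of x] h0_control_measurable[OF assms]
  show ?thesis unfolding running_def[abs_def] by measurable
qed

lemma traj_apply_integrable:
  assumes "control v"
  shows "integrable (lebesgue_on {0..}) (\<lambda>t. exp (- lam * t) * traj x v t q)"
  using Bochner_Integration.integrable_add[OF resolvent_integrable[of x q] conv_laplace(1)[OF assms, of q]]
  by (simp add: trajectory_eq blinfun.add_left distrib_left)

lemma h0_ge_b: "ereal b \<le> h0 u"
proof -
  have "ereal b \<le> ereal (a * norm u powr p + b)" using a_pos by simp
  then show ?thesis using coercive[of u] by (rule order_trans)
qed

lemma real_h0_ge_b: "h0 u \<noteq> \<infinity> \<Longrightarrow> b \<le> real_of_ereal (h0 u)"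
  using h0_ge_b[of u] by (cases "h0 u") auto

text \<open>The discounted tangent of \<open>g0\<close> at 0 plus the constant lower bound of
  \<open>h0\<close>. It is an integrable minorant of the running cost for every control and supplies
  half of each integrability argument.\<close>

definition lower :: "('v \<Rightarrow>\<^sub>L real) \<Rightarrow> (real \<Rightarrow> 'u) \<Rightarrow> real \<Rightarrow> real" where
  "lower x v t = exp (- lam * t) * (g0 0 + b) + exp (- lam * t) * traj x v t (g' 0)"

lemma lower_integrable: "control v \<Longrightarrow> integrable (lebesgue_on {0..}) (lower x v)"
  unfolding lower_def[abs_def]
  by (intro Bochner_Integration.integrable_add integrable_mult_left exp_integrable traj_apply_integrable)

lemma lower_le:
  assumes "b \<le> r"
  shows "lower x v t \<le> exp (- lam * t) * (g0 (traj x v t) + r)"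
proof -
  have "g0 0 + traj x v t (g' 0) \<le> g0 (traj x v t)" using g0_ge[of 0 "traj x v t"] by simp
  then have "exp (- lam * t) * (g0 0 + b + traj x v t (g' 0)) \<le> exp (- lam * t) * (g0 (traj x v t) + r)"
    using assms by (intro mult_left_mono) auto
  then show ?thesis by (simp add: lower_def distrib_left)
qed

lemma cost_cases:
  assumes v: "v \<in> weighted_Lp p lam"
  shows "cost S B g0 h0 lam x v = \<infinity> \<or> (\<exists>c. cost S B g0 h0 lam x v = ereal c \<and> has_cost x v c)"
    and "has_cost x v c \<Longrightarrow> cost S B g0 h0 lam x v = ereal c"
proof -
  let ?F = "\<lambda>t. ereal (exp (- lam * t)) * (ereal (g0 (traj x v t)) + h0 (v t))"
  have c: "control v" by (rule weighted_Lp_control[OF v])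
  note [measurable] = g0_traj_measurable[OF c, of x] h0_control_measurable[OF c]
  have F: "?F \<in> borel_measurable (lebesgue_on {0..})" by measurable
  have le: "ereal (lower x v t) \<le> ?F t" for t
  proof (cases "h0 (v t)")
    case (real r)
    then show ?thesis using lower_le[of r x v t] h0_ge_b[of "v t"] by simp
  qed (use h0_proper in auto)
  have F_inf: "?F t \<noteq> \<infinity> \<longleftrightarrow> h0 (v t) \<noteq> \<infinity>" for t
    using h0_proper[of "v t"] by (cases "h0 (v t)") auto
  have real_F: "has_bochner_integral (lebesgue_on {0..}) (\<lambda>t. real_of_ereal (?F t)) c \<longleftrightarrow>
      has_bochner_integral (lebesgue_on {0..}) (running x v) c"
    if ae: "AE t in lebesgue_on {0..}. h0 (v t) \<noteq> \<infinity>" for c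
  proof (rule has_bochner_integral_cong_AE)
    show "(\<lambda>t. real_of_ereal (?F t)) \<in> borel_measurable (lebesgue_on {0..})" using F by measurable
    show "running x v \<in> borel_measurable (lebesgue_on {0..})" by (rule running_measurable[OF c])
    show "AE t in lebesgue_on {0..}. real_of_ereal (?F t) = running x v t"
      using ae
    proof eventually_elim
      case (elim t)
      then show ?case
        unfolding running_def using h0_proper[of "v t"] by (cases "h0 (v t)") auto
    qed
  qed
  show "cost S B g0 h0 lam x v = \<infinity> \<or> (\<exists>c. cost S B g0 h0 lam x v = ereal c \<and> has_cost x v c)"
    using ereal_integral_cases(1)[OF F lower_integrable[OF c, of x] le] v real_F
    unfolding cost_def has_cost_def F_inf by blast
  show "cost S B g0 h0 lam x v = ereal c" if "has_cost x v c"
    using ereal_integral_cases(2)[OF F lower_integrable[OF c, of x] le] that real_F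
    unfolding cost_def has_cost_def F_inf by blast
qed

text \<open>One control of finite cost and one lower bound make the extended infimum finite, so the
  conversion by \<open>real_of_ereal\<close> is faithful. Both are later supplied by the fixed
  point.\<close>

lemma value_eq_Inf:
  assumes ne: "has_cost x v0 c0" and bdd: "\<And>v c. has_cost x v c \<Longrightarrow> m \<le> c"
  shows "\<Psi> x = Inf {c. \<exists>v. has_cost x v c}"
proof -
  let ?X = "{c. \<exists>v. has_cost x v c}"
  let ?e = "INF v \<in> weighted_Lp p lam. cost S B g0 h0 lam x v"
  have bX: "bdd_below ?X" using bdd by (intro bdd_belowI[of _ m]) auto
  have "ereal (Inf ?X) \<le> ?e"
  proof (rule INF_greatest)
    fix v :: "real \<Rightarrow> 'u" assume "v \<in> weighted_Lp p lam"
    from cost_cases(1)[OF this, of x] show "ereal (Inf ?X) \<le> cost S B g0 h0 lam x v"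
      by (auto intro!: cInf_lower bX)
  qed
  moreover have e_le: "?e \<le> ereal c" if "has_cost x v c" for v c
  proof -
    have v: "v \<in> weighted_Lp p lam" using that by (simp add: has_cost_def)
    then show ?thesis using cost_cases(2)[OF v that] by (metis INF_lower)
  qed
  ultimately obtain r where r: "?e = ereal r" using ne by (cases ?e) (auto dest: e_le)
  then have "Inf ?X \<le> r" using \<open>ereal (Inf ?X) \<le> ?e\<close> by simp
  moreover have "r \<le> Inf ?X"
    by (rule cInf_greatest) (use ne e_le r in auto)
  ultimately show ?thesis using r by (simp add: value_function_def)
qed

lemma value_le:
  assumes bdd: "\<And>v c. has_cost x v c \<Longrightarrow> m \<le> c" and c: "has_cost x v c"
  shows "\<Psi> x \<le> c"
proof -
  have "\<Psi> x = Inf {c. \<exists>v. has_cost x v c}" using c bdd by (rule value_eq_Inf)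
  moreover have "bdd_below {c. \<exists>v. has_cost x v c}" by (rule bdd_belowI[of _ m]) (use bdd in auto)
  ultimately show ?thesis using c by (auto intro!: cInf_lower)
qed

lemma value_ge:
  assumes bdd: "\<And>v c. has_cost x v c \<Longrightarrow> m \<le> c" and c: "has_cost x v c"
  shows "m \<le> \<Psi> x"
proof -
  have "\<Psi> x = Inf {c. \<exists>v. has_cost x v c}" using c bdd by (rule value_eq_Inf)
  moreover have "m \<le> Inf {c. \<exists>v. has_cost x v c}" by (rule cInf_greatest) (use c bdd in auto)
  ultimately show ?thesis by simp
qed

lemma value_approx:
  assumes bdd: "\<And>v c. has_cost x v c \<Longrightarrow> m \<le> c" and c: "has_cost x v0 c0" and e: "0 < e"
  obtains v c where "has_cost x v c" "c < \<Psi> x + e"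
proof -
  have "\<Psi> x = Inf {c. \<exists>v. has_cost x v c}" using c bdd by (rule value_eq_Inf)
  then have "\<exists>c\<in>{c. \<exists>v. has_cost x v c}. c < \<Psi> x + e"
    using c e by (intro cInf_lessD) auto
  then show thesis using that by blast
qed

end

section \<open>Equilibria and costates\<close>

context control_problem
begin

text \<open>\<open>Cg\<close> times the discounted integral of exp ((1 + \<theta>) \<omega> t): the
  constant left when the remainder of \<open>g0\<close> along S t h is integrated.\<close>

definition semi :: real where "semi = Cg / (lam - (1 + \<theta>) * \<omega>)"

lemma semi_nonneg: "0 \<le> semi"
  using Cg theta_lam by (simp add: semi_def)

definition rem :: "('v \<Rightarrow>\<^sub>L real) \<Rightarrow> real \<Rightarrow> real" where
  "rem h t = Cg * norm h powr (1 + \<theta>) * (exp (- lam * t) * exp ((1 + \<theta>) * \<omega> * t))"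

lemma rem_integral: "has_bochner_integral (lebesgue_on {0..}) (rem h) (semi * norm h powr (1 + \<theta>))"
  using has_bochner_integral_mult_right[OF exp_discount[OF theta_lam], of "Cg * norm h powr (1 + \<theta>)"]
  unfolding rem_def[abs_def] semi_def by simp

lemma remainder_le_rem:
  assumes t: "0 \<le> t"
  shows "exp (- lam * t) * (Cg * norm (S t h) powr (1 + \<theta>)) \<le> rem h t"
proof -
  have "norm (S t h) powr (1 + \<theta>) \<le> (exp (\<omega> * t) * norm h) powr (1 + \<theta>)"
    using growth[OF t] theta by (intro powr_mono2) auto
  also have "\<dots> = exp ((1 + \<theta>) * \<omega> * t) * norm h powr (1 + \<theta>)"
    by (simp add: powr_mult exp_powr_real mult_ac)
  finally have "exp (- lam * t) * (Cg * norm (S t h) powr (1 + \<theta>)) \<le>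
      exp (- lam * t) * (Cg * (exp ((1 + \<theta>) * \<omega> * t) * norm h powr (1 + \<theta>)))"
    using Cg by (intro mult_left_mono) auto
  then show ?thesis by (simp add: rem_def mult_ac)
qed

lemma running_ge_lower:
  "h0 (v t) \<noteq> \<infinity> \<Longrightarrow> lower x v t \<le> running x v t"
  unfolding running_def by (intro lower_le real_h0_ge_b)

text \<open>The same control is kept from x + h and x - h. The trajectories are displaced by S t h
  in opposite directions, so the linear terms of \<open>g0\<close> cancel and two remainders are
  left.\<close>

lemma has_cost_perturb:
  assumes c: "has_cost x v c"
  obtains c1 c2 where "has_cost (x + h) v c1" "has_cost (x - h) v c2"
    "c1 + c2 - 2 * c \<le> 2 * semi * norm h powr (1 + \<theta>)"
proof -
  have v: "v \<in> weighted_Lp p lam" and fin: "AE t in lebesgue_on {0..}. h0 (v t) \<noteq> \<infinity>"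
    and bi: "has_bochner_integral (lebesgue_on {0..}) (running x v) c"
    using c by (auto simp: has_cost_def)
  have u: "control v" by (rule weighted_Lp_control[OF v])
  define up where "up t = 2 * running x v t + 2 * rem h t" for t
  have up_bi: "has_bochner_integral (lebesgue_on {0..}) up (2 * c + 2 * (semi * norm h powr (1 + \<theta>)))"
    unfolding up_def[abs_def] by (intro has_bochner_integral_add has_bochner_integral_mult_right bi rem_integral)
  have up: "running (x + h) v t + running (x - h) v t \<le> up t" if t: "0 \<le> t" for t
  proof -
    let ?y = "traj x v t" and ?k = "S t h"
    have "g0 (?y + ?k) + g0 (?y + - ?k) \<le> 2 * g0 ?y + 2 * (Cg * norm ?k powr (1 + \<theta>))"
      using g0_le[of ?y ?k] g0_le[of ?y "- ?k"] by (simp add: blinfun.minus_left)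
    then have "exp (- lam * t) * (g0 (?y + ?k) + g0 (?y + - ?k)) \<le>
        exp (- lam * t) * (2 * g0 ?y + 2 * (Cg * norm ?k powr (1 + \<theta>)))"
      by (rule mult_left_mono) simp
    then have "exp (- lam * t) * g0 (?y + ?k) + exp (- lam * t) * g0 (?y - ?k) \<le>
        2 * (exp (- lam * t) * g0 ?y) + 2 * (exp (- lam * t) * (Cg * norm ?k powr (1 + \<theta>)))"
      by (simp add: distrib_left)
    moreover have "traj (x - h) v t = ?y - ?k"
      using trajectory_add[of x "- h" v t] by (simp add: blinfun.minus_right)
    ultimately show ?thesis
      using remainder_le_rem[OF t, of h]
      unfolding up_def running_def trajectory_add by (simp add: distrib_left)
  qed
  \<comment> \<open>\<open>up\<close> bounds only the sum of the two running costs; an upper bound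
    for one of them comes from the minorant \<open>lower\<close> of the other.\<close>
  have int: "integrable (lebesgue_on {0..}) (running (x + k) v)" if "k = h \<or> k = - h" for k
  proof (rule Bochner_Integration.integrable_bound)
    show "integrable (lebesgue_on {0..}) (\<lambda>t. norm (lower (x + k) v t) + norm (up t - lower (x - k) v t))"
      using up_bi lower_integrable[OF u]
      by (intro Bochner_Integration.integrable_add integrable_norm Bochner_Integration.integrable_diff)
        (auto simp: has_bochner_integral_iff)
    show "running (x + k) v \<in> borel_measurable (lebesgue_on {0..})" by (rule running_measurable[OF u])
    show "AE t in lebesgue_on {0..}. norm (running (x + k) v t) \<le> norm (norm (lower (x + k) v t) + norm (up t - lower (x - k) v t))"
      using fin AE_space
    proof eventually_elim
      case (elim t)
      have "running (x + k) v t + running (x - k) v t \<le> up t"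
        using up[of t] that elim by auto
      then show ?case
        using running_ge_lower[of v t "x + k"] running_ge_lower[of v t "x - k"] elim(1) by simp
    qed
  qed
  have i1: "integrable (lebesgue_on {0..}) (running (x + h) v)" using int[of h] by simp
  have i2: "integrable (lebesgue_on {0..}) (running (x - h) v)" using int[of "- h"] by simp
  let ?c1 = "integral\<^sup>L (lebesgue_on {0..}) (running (x + h) v)"
  let ?c2 = "integral\<^sup>L (lebesgue_on {0..}) (running (x - h) v)"
  have "?c1 + ?c2 = (\<integral>t. running (x + h) v t + running (x - h) v t \<partial>lebesgue_on {0..})"
    using i1 i2 by simp
  also have "\<dots> \<le> integral\<^sup>L (lebesgue_on {0..}) up"
    using i1 i2 up_bi up by (intro integral_mono) (auto simp: has_bochner_integral_iff)
  also have "\<dots> = 2 * c + 2 * (semi * norm h powr (1 + \<theta>))"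
    by (rule has_bochner_integral_integral_eq[OF up_bi])
  finally have "?c1 + ?c2 - 2 * c \<le> 2 * semi * norm h powr (1 + \<theta>)" by simp
  moreover have "has_cost (x + h) v ?c1" "has_cost (x - h) v ?c2"
    using v fin i1 i2 by (auto simp: has_cost_def has_bochner_integral_iff)
  ultimately show thesis using that by blast
qed

lemma exp_const_integral:
  "has_bochner_integral (lebesgue_on {0..}) (\<lambda>t. exp (- lam * t) * r) (r / lam)"
  using has_bochner_integral_mult_left[OF has_bochner_integral_exp_atLeast[OF lam_pos, of 0], of r]
  by simp

lemma resolvent_integral:
  "has_bochner_integral (lebesgue_on {0..}) (\<lambda>t. exp (- lam * t) * S t \<phi> q) (\<phi> (resolvent_adj q))"
  unfolding resolvent_adj_apply by (rule has_bochner_integral_integrable[OF resolvent_integrable])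

text \<open>Under the constant control the trajectory from x + h is x + S t h. The linear term of
  \<open>g0\<close> integrates to the pairing of h with the resolvent of g' x, the remainder to the
  \<open>semi\<close> term.\<close>

lemma stationary_cost:
  assumes gen: "is_generator D A S" and x: "x \<in> D" and eq: "A x + B w = 0" and r: "h0 w = ereal r"
  obtains c where "has_cost (x + h) (\<lambda>_. w) c"
    "c \<le> (g0 x + r) / lam + h (resolvent_adj (g' x)) + semi * norm h powr (1 + \<theta>)"
proof -
  let ?M = "lebesgue_on {0::real..}"
  let ?run = "running (x + h) (\<lambda>_. w)"
  define lo where "lo t = exp (- lam * t) * (g0 x + r) + exp (- lam * t) * S t h (g' x)" for t
  have lo_bi: "has_bochner_integral ?M lo ((g0 x + r) / lam + h (resolvent_adj (g' x)))"
    unfolding lo_def[abs_def] by (intro has_bochner_integral_add exp_const_integral resolvent_integral)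
  have run: "?run t = exp (- lam * t) * (g0 (x + S t h) + r)" if "0 \<le> t" for t
    using trajectory_equilibrium[OF gen x eq that] r by (simp add: running_def trajectory_add)
  have run_ge: "lo t \<le> ?run t" if "0 \<le> t" for t
  proof -
    have "exp (- lam * t) * (g0 x + S t h (g' x) + r) \<le> exp (- lam * t) * (g0 (x + S t h) + r)"
      using g0_ge[of x "S t h"] by (intro mult_left_mono) auto
    then show ?thesis unfolding run[OF that] lo_def by (simp add: distrib_left)
  qed
  have run_le: "?run t \<le> lo t + rem h t" if "0 \<le> t" for t
  proof -
    have "exp (- lam * t) * (g0 (x + S t h) + r) \<le>
        exp (- lam * t) * (g0 x + S t h (g' x) + Cg * norm (S t h) powr (1 + \<theta>) + r)"
      using g0_le[of x "S t h"] by (intro mult_left_mono) auto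
    then show ?thesis using remainder_le_rem[OF that, of h]
      unfolding run[OF that] lo_def by (simp add: distrib_left)
  qed
  have i: "integrable ?M ?run"
  proof (rule Bochner_Integration.integrable_bound)
    show "integrable ?M (\<lambda>t. norm (lo t) + norm (lo t + rem h t))"
      using lo_bi rem_integral[of h]
      by (intro Bochner_Integration.integrable_add integrable_norm) (auto simp: has_bochner_integral_iff)
    show "?run \<in> borel_measurable ?M" by (rule running_measurable[OF control_const])
    show "AE t in ?M. norm (?run t) \<le> norm (norm (lo t) + norm (lo t + rem h t))"
    proof (rule AE_I2)
      fix t assume "t \<in> space ?M"
      then show "norm (?run t) \<le> norm (norm (lo t) + norm (lo t + rem h t))"
        using run_ge[of t] run_le[of t] by simp
    qed
  qed
  have bi: "has_bochner_integral ?M (\<lambda>t. lo t + rem h t)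
      ((g0 x + r) / lam + h (resolvent_adj (g' x)) + semi * norm h powr (1 + \<theta>))"
    by (intro has_bochner_integral_add lo_bi rem_integral)
  have "integral\<^sup>L ?M ?run \<le> (\<integral>t. lo t + rem h t \<partial>?M)"
    using i bi run_le by (intro integral_mono) (auto simp: has_bochner_integral_iff)
  also have "\<dots> = (g0 x + r) / lam + h (resolvent_adj (g' x)) + semi * norm h powr (1 + \<theta>)"
    by (rule has_bochner_integral_integral_eq[OF bi])
  finally have le: "integral\<^sup>L ?M ?run \<le> (g0 x + r) / lam + h (resolvent_adj (g' x)) + semi * norm h powr (1 + \<theta>)" .
  have "has_cost (x + h) (\<lambda>_. w) (integral\<^sup>L ?M ?run)"
    using i r weighted_Lp_const by (auto simp: has_cost_def has_bochner_integral_iff)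
  then show thesis using le by (rule that)
qed

text \<open>Sufficiency of the maximum principle at an equilibrium: the costate is constant in time, and
  by convexity it provides an affine minorant of every cost.\<close>

lemma costate_minorant:
  assumes gen: "is_generator D A S" and x: "x \<in> D" and eq: "A x + B w = 0"
    and w: "w = gradient hstar (- adjoint_to_dual B (resolvent_adj (g' x)))"
    and r: "h0 w = ereal r" and c: "has_cost z v c"
  shows "(g0 x + r) / lam + (z - x) (resolvent_adj (g' x)) \<le> c"
proof -
  let ?M = "lebesgue_on {0::real..}"
  let ?q = "g' x"
  let ?p = "resolvent_adj ?q"
  have v: "v \<in> weighted_Lp p lam" and fin: "AE t in ?M. h0 (v t) \<noteq> \<infinity>"
    and bi: "has_bochner_integral ?M (running z v) c"
    using c by (auto simp: has_cost_def)
  have u: "control v" by (rule weighted_Lp_control[OF v])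
  define d where "d s = 1 *\<^sub>R v s + (-1) *\<^sub>R w" for s
  have d: "control d" unfolding d_def by (rule control_add_scale[OF u control_const])
  have traj_d: "traj z v t - x = S t (z - x) + conv d t" if t: "0 \<le> t" for t
  proof -
    have "conv d t = 1 *\<^sub>R conv v t + (-1) *\<^sub>R conv (\<lambda>_. w) t"
      unfolding d_def by (rule conv_add_scale[OF u control_const t])
    moreover have "x = S t x + conv (\<lambda>_. w) t"
      using trajectory_equilibrium[OF gen x eq t] by (simp add: trajectory_eq)
    ultimately show ?thesis
      unfolding trajectory_eq blinfun.diff_right by (metis (no_types, lifting) add_diff_add scaleR_minus1_left scaleR_one diff_conv_add_uminus)
  qed
  \<comment> \<open>Tangent inequality for \<open>g0\<close> at x plus Fenchel inequality for
    \<open>h0\<close>. The last bracket holds the effect of the control deviation on state and on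
    control cost; its integrals cancel by \<open>conv_laplace\<close>.\<close>
  define lo where "lo t = exp (- lam * t) * (g0 x + r) + exp (- lam * t) * S t (z - x) ?q +
    (exp (- lam * t) * conv d t ?q - exp (- lam * t) * B (d t) ?p)" for t
  have "has_bochner_integral ?M lo ((g0 x + r) / lam + (z - x) ?p +
      ((\<integral>t. exp (- lam * t) * conv d t ?q \<partial>?M) - (\<integral>t. exp (- lam * t) * conv d t ?q \<partial>?M)))"
    unfolding lo_def[abs_def]
    by (intro has_bochner_integral_add has_bochner_integral_diff exp_const_integral resolvent_integral
        has_bochner_integral_integrable conv_laplace d)
  then have lo_bi: "has_bochner_integral ?M lo ((g0 x + r) / lam + (z - x) ?p)" by simp
  have "(\<integral>t. lo t \<partial>?M) \<le> (\<integral>t. running z v t \<partial>?M)"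
  proof (rule integral_mono_AE)
    show "integrable ?M lo" "integrable ?M (running z v)"
      using lo_bi bi by (auto simp: has_bochner_integral_iff)
    show "AE t in ?M. lo t \<le> running z v t"
      using fin AE_space
    proof eventually_elim
      case (elim t)
      then have t: "0 \<le> t" by simp
      let ?k = "- adjoint_to_dual B ?p"
      have "r = inner ?k w - hstar ?k" using r h0_gradient[of ?k] w by simp
      moreover have "inner ?k (v t) - hstar ?k \<le> real_of_ereal (h0 (v t))"
        using h0_ge[of ?k "v t"] elim(1) h0_proper[of "v t"] by (cases "h0 (v t)") auto
      moreover have "inner ?k (v t) - inner ?k w = - B (d t) ?p"
        by (simp add: d_def adjoint_to_dual_apply blinfun.diff_right blinfun.diff_left)
      ultimately have h: "r - B (d t) ?p \<le> real_of_ereal (h0 (v t))" by simp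
      have "g0 x + (traj z v t - x) ?q \<le> g0 (traj z v t)" using g0_ge[of x "traj z v t - x"] by simp
      then have "g0 x + S t (z - x) ?q + conv d t ?q \<le> g0 (traj z v t)"
        unfolding traj_d[OF t] by (simp add: blinfun.add_left)
      with h have "exp (- lam * t) * (g0 x + S t (z - x) ?q + conv d t ?q + (r - B (d t) ?p)) \<le>
          exp (- lam * t) * (g0 (traj z v t) + real_of_ereal (h0 (v t)))"
        by (intro mult_left_mono) auto
      then show ?case unfolding lo_def running_def by (simp add: distrib_left right_diff_distrib)
    qed
  qed
  then show ?thesis
    using lo_bi bi by (simp add: has_bochner_integral_iff)
qed

end

section \<open>Dynamic programming\<close>

context control_system
begin

text \<open>The adjoint semigroup on \<open>V\<close> is weakly continuous, hence strongly continuous, because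
  quasi-contractivity bounds \<open>|T p - p|\<^sup>2 = |T p|\<^sup>2 + |p|\<^sup>2 - 2 (T p | p)\<close>.\<close>

lemma adjoint_strongly_continuous:
  assumes e: "0 < e"
  obtains d where "0 < d" "\<And>s \<phi>. 0 \<le> s \<Longrightarrow> s \<le> d \<Longrightarrow> \<bar>S s \<phi> p - \<phi> p\<bar> \<le> e * norm \<phi>"
proof -
  define eta where "eta s = (exp (\<omega> * s) * norm p)\<^sup>2 + (norm p)\<^sup>2 - 2 * S s (dual_vec p) p" for s
  have bound: "\<bar>S s \<phi> p - \<phi> p\<bar> \<le> e * norm \<phi>" if s: "0 \<le> s" and le: "eta s \<le> e\<^sup>2" for s \<phi>
  proof -
    have "bounded_linear (\<lambda>\<phi>. S s \<phi> p)"
      by (rule bounded_linear_compose[OF blinfun.bounded_linear_left blinfun.bounded_linear_right])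
    then obtain Tp where Tp: "\<And>\<phi>. S s \<phi> p = blinfun_apply \<phi> Tp" by (rule hilbert_reflexive) blast
    have "norm Tp \<le> exp (\<omega> * s) * norm p"
    proof (rule dual_norm_le)
      show "blinfun_apply \<phi> Tp \<le> exp (\<omega> * s) * norm p * norm \<phi>" for \<phi>
        using norm_S_apply_le[OF s, of \<phi> p] by (simp add: Tp mult_ac)
    qed simp
    then have "(norm Tp)\<^sup>2 \<le> (exp (\<omega> * s) * norm p)\<^sup>2" by (rule power_mono) simp
    moreover have "(norm (Tp - p))\<^sup>2 = (norm Tp)\<^sup>2 + (norm p)\<^sup>2 - 2 * S s (dual_vec p) p"
      by (simp add: Tp power2_norm_eq_inner inner_diff_left inner_diff_right inner_commute)
    ultimately have "(norm (Tp - p))\<^sup>2 \<le> e\<^sup>2" using le unfolding eta_def by linarith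
    then have "norm (Tp - p) \<le> e" by (rule power2_le_imp_le) (use e in simp)
    then have "norm \<phi> * norm (Tp - p) \<le> norm \<phi> * e" by (intro mult_left_mono) auto
    then show ?thesis
      using norm_blinfun[of \<phi> "Tp - p"] by (simp add: Tp blinfun.diff_right mult.commute)
  qed
  have "continuous_on {0..} eta"
    unfolding eta_def by (intro continuous_intros continuous_S_apply)
  moreover have "eta 0 = 0" by (simp add: eta_def power2_norm_eq_inner)
  ultimately obtain d where d: "0 < d" "\<And>s. s \<in> {0..} \<Longrightarrow> dist s 0 < d \<Longrightarrow> dist (eta s) 0 < e\<^sup>2"
    unfolding continuous_on_iff using e by (metis atLeast_iff order_refl zero_less_power)
  have "eta s \<le> e\<^sup>2" if "0 \<le> s" "s \<le> d / 2" for s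
    using d(2)[of s] d(1) that by (simp add: dist_norm abs_less_iff)
  then show thesis using that[of "d / 2"] bound d(1) by simp
qed

end

context control_problem
begin

text \<open>The trajectory is affine in initial state and control jointly, so convexity of
  \<open>g0\<close> and \<open>h0\<close> passes to the running cost. Integrability follows from
  \<open>lower\<close> below and the convex combination above.\<close>

lemma has_cost_convex:
  assumes c1: "has_cost x1 v1 c1" and c2: "has_cost x2 v2 c2" and s: "0 \<le> s" "s \<le> 1"
  obtains v c where "has_cost ((1 - s) *\<^sub>R x1 + s *\<^sub>R x2) v c" "c \<le> (1 - s) * c1 + s * c2"
proof -
  let ?M = "lebesgue_on {0::real..}"
  let ?x = "(1 - s) *\<^sub>R x1 + s *\<^sub>R x2"
  define v where "v t = (1 - s) *\<^sub>R v1 t + s *\<^sub>R v2 t" for t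
  have v1: "v1 \<in> weighted_Lp p lam" and fin1: "AE t in ?M. h0 (v1 t) \<noteq> \<infinity>"
    and bi1: "has_bochner_integral ?M (running x1 v1) c1"
    and v2: "v2 \<in> weighted_Lp p lam" and fin2: "AE t in ?M. h0 (v2 t) \<noteq> \<infinity>"
    and bi2: "has_bochner_integral ?M (running x2 v2) c2"
    using c1 c2 by (auto simp: has_cost_def)
  note u1 = weighted_Lp_control[OF v1] and u2 = weighted_Lp_control[OF v2]
  have u: "control v" unfolding v_def by (rule control_add_scale[OF u1 u2])
  have vp: "norm (v t) powr p \<le> norm (v1 t) powr p + norm (v2 t) powr p" for t
  proof -
    have "norm (v t) \<le> (1 - s) * norm (v1 t) + s * norm (v2 t)"
      using norm_triangle_ineq[of "(1 - s) *\<^sub>R v1 t" "s *\<^sub>R v2 t"] s by (simp add: v_def)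
    also have "\<dots> \<le> max (norm (v1 t)) (norm (v2 t))"
      using s by (intro convex_bound_le) auto
    finally have "norm (v t) powr p \<le> max (norm (v1 t)) (norm (v2 t)) powr p"
      using p_ge by (intro powr_mono2) auto
    also have "\<dots> \<le> norm (v1 t) powr p + norm (v2 t) powr p" by (simp add: max_def)
    finally show ?thesis .
  qed
  have v: "v \<in> weighted_Lp p lam"
    unfolding weighted_Lp_iff
  proof
    show "strongly_measurable ?M v" using u by (simp add: control_def)
    note [measurable] = control_measurable[OF u]
    show "integrable ?M (\<lambda>t. exp (- lam * t) * norm (v t) powr p)"
    proof (rule Bochner_Integration.integrable_bound)
      show "integrable ?M (\<lambda>t. exp (- lam * t) * norm (v1 t) powr p + exp (- lam * t) * norm (v2 t) powr p)"
        using v1 v2 by (intro Bochner_Integration.integrable_add) (auto simp: weighted_Lp_iff)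
      show "AE t in ?M. norm (exp (- lam * t) * norm (v t) powr p) \<le>
          norm (exp (- lam * t) * norm (v1 t) powr p + exp (- lam * t) * norm (v2 t) powr p)"
      proof (rule AE_I2)
        fix t
        have "exp (- lam * t) * norm (v t) powr p \<le> exp (- lam * t) * (norm (v1 t) powr p + norm (v2 t) powr p)"
          by (intro mult_left_mono vp) simp
        then show "norm (exp (- lam * t) * norm (v t) powr p) \<le>
          norm (exp (- lam * t) * norm (v1 t) powr p + exp (- lam * t) * norm (v2 t) powr p)"
          by (simp add: distrib_left abs_mult)
      qed
    qed measurable
  qed
  define up where "up t = (1 - s) * running x1 v1 t + s * running x2 v2 t" for t
  have up_bi: "has_bochner_integral ?M up ((1 - s) * c1 + s * c2)"
    unfolding up_def[abs_def] by (intro has_bochner_integral_add has_bochner_integral_mult_right bi1 bi2)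
  have tr: "traj ?x v t = (1 - s) *\<^sub>R traj x1 v1 t + s *\<^sub>R traj x2 v2 t" if "0 \<le> t" for t
    using conv_add_scale[OF u1 u2 that, of "1 - s" s]
    by (simp add: trajectory_eq v_def[abs_def] blinfun.add_right blinfun.scaleR_right scaleR_add_right add_ac)
  have run: "AE t in ?M. h0 (v t) \<noteq> \<infinity> \<and> running ?x v t \<le> up t"
    using fin1 fin2 AE_space
  proof eventually_elim
    case (elim t)
    then have t: "0 \<le> t" by simp
    obtain r1 r2 where r: "h0 (v1 t) = ereal r1" "h0 (v2 t) = ereal r2"
      using elim h0_proper[of "v1 t"] h0_proper[of "v2 t"] by (cases "h0 (v1 t)"; cases "h0 (v2 t)") auto
    have "h0 (v t) \<le> ereal ((1 - s) * r1 + s * r2)"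
      using h0_convex s unfolding ereal_convex_def v_def by (metis r plus_ereal.simps(1) times_ereal.simps(1))
    then obtain r3 where r3: "h0 (v t) = ereal r3" "r3 \<le> (1 - s) * r1 + s * r2"
      using h0_proper[of "v t"] by (cases "h0 (v t)") auto
    have "g0 (traj ?x v t) \<le> (1 - s) * g0 (traj x1 v1 t) + s * g0 (traj x2 v2 t)"
      unfolding tr[OF t] using g0 s by (intro convex_onD) (auto simp: Sigma0_def)
    then have "exp (- lam * t) * (g0 (traj ?x v t) + r3) \<le>
        exp (- lam * t) * ((1 - s) * g0 (traj x1 v1 t) + s * g0 (traj x2 v2 t) + ((1 - s) * r1 + s * r2))"
      using r3(2) by (intro mult_left_mono) auto
    also have "\<dots> = up t" by (simp add: up_def running_def r algebra_simps)
    finally show ?case by (simp add: running_def r3)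
  qed
  have i: "integrable ?M (running ?x v)"
  proof (rule Bochner_Integration.integrable_bound)
    show "integrable ?M (\<lambda>t. norm (lower ?x v t) + norm (up t))"
      using up_bi lower_integrable[OF u]
      by (intro Bochner_Integration.integrable_add integrable_norm) (auto simp: has_bochner_integral_iff)
    show "running ?x v \<in> borel_measurable ?M" by (rule running_measurable[OF u])
    show "AE t in ?M. norm (running ?x v t) \<le> norm (norm (lower ?x v t) + norm (up t))"
      using run
    proof eventually_elim
      case (elim t)
      then have "running ?x v t \<le> up t" "lower ?x v t \<le> running ?x v t"
        using running_ge_lower[of v t ?x] by auto
      then show ?case unfolding real_norm_def by linarith
    qed
  qed
  have "integral\<^sup>L ?M (running ?x v) \<le> integral\<^sup>L ?M up"
    using i up_bi run by (intro integral_mono_AE) (auto simp: has_bochner_integral_iff elim: eventually_mono)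
  moreover have "has_cost ?x v (integral\<^sup>L ?M (running ?x v))"
    using v run i by (auto simp: has_cost_def has_bochner_integral_iff elim: eventually_mono)
  ultimately show thesis
    using that has_bochner_integral_integral_eq[OF up_bi] by metis
qed

text \<open>The tail of a control, restarted at the state reached, pays what remains, rescaled by
  the discount. Only this cutting half of dynamic programming is used, not the concatenation of
  controls.\<close>

lemma has_cost_shift:
  assumes c: "has_cost x v c" and t: "0 \<le> t"
  shows "integrable (lebesgue_on {0..t}) (running x v)"
    and "has_cost (traj x v t) (\<lambda>s. v (t + s)) (exp (lam * t) * (c - integral\<^sup>L (lebesgue_on {0..t}) (running x v)))"
proof -
  have v: "v \<in> weighted_Lp p lam" and fin: "AE t in lebesgue_on {0..}. h0 (v t) \<noteq> \<infinity>"
    and bi: "has_bochner_integral (lebesgue_on {0..}) (running x v) c"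
    using c by (auto simp: has_cost_def)
  have u: "control v" by (rule weighted_Lp_control[OF v])
  let ?v = "\<lambda>s. v (t + s)"
  have i: "integrable (lebesgue_on {0..}) (running x v)" using bi by (auto simp: has_bochner_integral_iff)
  show i1: "integrable (lebesgue_on {0..t}) (running x v)"
    by (rule integrable_lebesgue_on_subset[OF i]) (use t in auto)
  have i2: "integrable (lebesgue_on {t..}) (running x v)"
    by (rule integrable_lebesgue_on_subset[OF i]) (use t in auto)
  have "{0..t} \<union> {t..} = {0..}" "{0..t} \<inter> {t..} = {t}" using t by auto
  then have "has_bochner_integral (lebesgue_on {0..}) (running x v)
      (integral\<^sup>L (lebesgue_on {0..t}) (running x v) + integral\<^sup>L (lebesgue_on {t..}) (running x v))"
    using has_bochner_integral_lebesgue_on_Un[of "{0..t}" "{t..}",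
        OF _ _ _ has_bochner_integral_integrable[OF i1] has_bochner_integral_integrable[OF i2]] by simp
  from has_bochner_integral_eq[OF this bi]
  have "c - integral\<^sup>L (lebesgue_on {0..t}) (running x v) = integral\<^sup>L (lebesgue_on {t..}) (running x v)"
    by simp
  then have "has_bochner_integral (lebesgue_on {t..}) (running x v) (c - integral\<^sup>L (lebesgue_on {0..t}) (running x v))"
    using has_bochner_integral_integrable[OF i2] by (simp only:)
  then have "has_bochner_integral (lebesgue_on {0..}) (\<lambda>s. running x v (t + s)) (c - integral\<^sup>L (lebesgue_on {0..t}) (running x v))"
    using has_bochner_integral_lebesgue_on_shift[of "{t..}" "{0..}" t] by auto
  then have "has_bochner_integral (lebesgue_on {0..}) (\<lambda>s. exp (lam * t) * running x v (t + s))
      (exp (lam * t) * (c - integral\<^sup>L (lebesgue_on {0..t}) (running x v)))"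
    by (rule has_bochner_integral_mult_right)
  also have "?this \<longleftrightarrow> has_bochner_integral (lebesgue_on {0..}) (running (traj x v t) ?v)
      (exp (lam * t) * (c - integral\<^sup>L (lebesgue_on {0..t}) (running x v)))"
  proof (rule has_bochner_integral_cong)
    fix s :: real assume "s \<in> space (lebesgue_on {0..})"
    then have "traj x v (t + s) = traj (traj x v t) ?v s" using trajectory_shift[OF u t, of s x] by simp
    moreover have "exp (lam * t) * exp (- lam * (t + s)) = exp (- lam * s)"
      by (simp add: algebra_simps flip: exp_add)
    ultimately show "exp (lam * t) * running x v (t + s) = running (traj x v t) ?v s"
      unfolding running_def by (simp only: mult.assoc[symmetric])
  qed simp_all
  finally have bi': "has_bochner_integral (lebesgue_on {0..}) (running (traj x v t) ?v)
      (exp (lam * t) * (c - integral\<^sup>L (lebesgue_on {0..t}) (running x v)))" .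
  have v': "?v \<in> weighted_Lp p lam"
    unfolding weighted_Lp_iff
  proof
    show "strongly_measurable (lebesgue_on {0..}) ?v" using control_shift[OF u t] by (simp add: control_def)
    have "integrable (lebesgue_on {t..}) (\<lambda>s. exp (- lam * s) * norm (v s) powr p)"
      by (rule integrable_lebesgue_on_subset[of "{0..}"]) (use v t in \<open>auto simp: weighted_Lp_iff\<close>)
    then have "integrable (lebesgue_on {0..}) (\<lambda>s. exp (- lam * (t + s)) * norm (?v s) powr p)"
      using has_bochner_integral_lebesgue_on_shift[of "{t..}" "{0..}" t]
      by (auto simp: integrable.simps)
    then have "integrable (lebesgue_on {0..}) (\<lambda>s. exp (lam * t) * (exp (- lam * (t + s)) * norm (?v s) powr p))"
      by (rule integrable_mult_right)
    moreover have "exp (lam * t) * exp (- lam * (t + s)) = exp (- lam * s)" for s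
      by (simp add: algebra_simps flip: exp_add)
    ultimately show "integrable (lebesgue_on {0..}) (\<lambda>s. exp (- lam * s) * norm (?v s) powr p)"
      by (simp only: mult.assoc[symmetric])
  qed
  have fin': "AE s in lebesgue_on {0..}. h0 (?v s) \<noteq> \<infinity>"
  proof -
    have "AE s in lborel. 0 \<le> s \<longrightarrow> h0 (v s) \<noteq> \<infinity>"
      using fin by (simp add: AE_restrict_space_iff AE_completion_iff)
    then have "AE s in distr lborel borel ((+) t). 0 \<le> s \<longrightarrow> h0 (v s) \<noteq> \<infinity>"
      unfolding lborel_distr_plus .
    then have "AE s in lborel. 0 \<le> t + s \<longrightarrow> h0 (v (t + s)) \<noteq> \<infinity>"
      by (rule AE_distrD[rotated]) simp
    then have "AE s in lborel. 0 \<le> s \<longrightarrow> h0 (v (t + s)) \<noteq> \<infinity>" by eventually_elim (use t in auto)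
    then show ?thesis by (simp add: AE_restrict_space_iff AE_completion_iff)
  qed
  show "has_cost (traj x v t) ?v (exp (lam * t) * (c - integral\<^sup>L (lebesgue_on {0..t}) (running x v)))"
    using v' fin' bi' by (simp add: has_cost_def)
qed

end

context control_problem
begin

text \<open>The supersolution half of the Hamilton-Jacobi-Bellman equation at an equilibrium, in
  integrated form. The strong convexity of \<open>h0\<close> absorbs the errors that are linear in the
  deviation of the control.\<close>

lemma dynamic_programming_estimate:
  assumes gen: "is_generator D A S" and x: "x \<in> D" and eq: "A x + B w = 0"
    and w: "w = gradient hstar (- adjoint_to_dual B q)" and r: "h0 w = ereal r"
    and val: "\<And>z v c. has_cost z v c \<Longrightarrow> \<Psi> x + (z - x) q \<le> c"
    and near: "\<And>e. 0 < e \<Longrightarrow> \<exists>v c. has_cost x v c \<and> c < \<Psi> x + e"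
  shows "(g0 x + r) / lam \<le> \<Psi> x"
proof (rule ccontr)
  assume neg: "\<not> ?thesis"
  define gap where "gap = (g0 x + r) / lam - \<Psi> x"
  have gap: "0 < gap" using neg by (simp add: gap_def)
  \<comment> \<open>A lower bound for the discounted convexity modulus, valid for all times up to
    1.\<close>
  define \<kappa> where "\<kappa> = exp (- lam) * modulus"
  have kappa: "0 < \<kappa>" using modulus_pos by (simp add: \<kappa>_def)
  \<comment> \<open>Bounds the pairing of the displaced state with g' x, up to time 1, by C1 times
    the total deviation \<open>W\<close> of the control.\<close>
  define C1 where "C1 = exp \<omega> * norm B * norm (g' x)"
  have C1: "0 \<le> C1" by (simp add: C1_def)
  define N where "N = norm B + 1"
  have N: "0 < N" by (simp add: N_def add_nonneg_pos)
  define M where "M = 1 + N\<^sup>2 / (4 * \<kappa>)"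
  have M: "0 < M" using kappa by (simp add: M_def add_pos_nonneg)
  \<comment> \<open>All errors will add up to at most t * e * M: the 1 in \<open>M\<close> accounts
    for near-optimality, the rest for the completed square. The factor 2 leaves half of the gap for
    the contradiction.\<close>
  define e where "e = min 1 (lam * exp (- lam) * gap / (2 * M))"
  have e: "0 < e" "e \<le> 1" using gap M lam_pos by (simp_all add: e_def)
  obtain d where d: "0 < d" "\<And>s \<phi>. 0 \<le> s \<Longrightarrow> s \<le> d \<Longrightarrow> \<bar>S s \<phi> q - \<phi> q\<bar> \<le> e * norm \<phi>"
    by (rule adjoint_strongly_continuous[OF e(1)]) blast
  define den where "den = lam * norm q * norm B + C1 + 1"
  have den: "0 < den" using lam_pos C1 by (simp add: den_def add_nonneg_pos)
  \<comment> \<open>\<open>den\<close> collects the error coefficients that carry a factor t, so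
    their sum is at most e. Together with e * norm B, the coefficient linear in the deviation is
    then at most e * N.\<close>
  define t where "t = min (min d 1) (e / den)"
  have t: "0 < t" "t \<le> d" "t \<le> 1" using d(1) e(1) den by (auto simp: t_def)
  have "t * den \<le> e" using den by (simp add: t_def min_def pos_le_divide_eq[symmetric])
  moreover have "t * den = lam * t * norm q * norm B + C1 * t + t" by (simp add: den_def algebra_simps)
  ultimately have t_den: "lam * t * norm q * norm B + C1 * t \<le> e" using t(1) by linarith
  define \<eta> where "\<eta> = e * norm B + lam * t * norm q * norm B"
  have eta: "\<eta> + C1 * t \<le> e * N"
    using t_den by (simp add: \<eta>_def N_def distrib_left)
  have eta0: "0 \<le> \<eta> + C1 * t" using e lam_pos t C1 by (simp add: \<eta>_def)
  \<comment> \<open>The tolerance is proportional to t, since the gain over [0, t] is only of that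
    order.\<close>
  obtain v c where c: "has_cost x v c" "c < \<Psi> x + e * t" using near[of "e * t"] e(1) t(1) by auto
  have v: "v \<in> weighted_Lp p lam" and fin: "AE s in lebesgue_on {0..}. h0 (v s) \<noteq> \<infinity>"
    using c(1) by (auto simp: has_cost_def)
  have u: "control v" by (rule weighted_Lp_control[OF v])
  define dv where "dv s = 1 *\<^sub>R v s + (-1) *\<^sub>R w" for s
  have dv: "control dv" unfolding dv_def by (rule control_add_scale[OF u control_const])
  have traj_dv: "traj x v s = x + conv dv s" if s: "0 \<le> s" for s
  proof -
    have "conv dv s = 1 *\<^sub>R conv v s + (-1) *\<^sub>R conv (\<lambda>_. w) s"
      unfolding dv_def by (rule conv_add_scale[OF u control_const s])
    then have 1: "conv v s = conv (\<lambda>_. w) s + conv dv s" by (simp add: algebra_simps)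
    have 2: "S s x + conv (\<lambda>_. w) s = x"
      using trajectory_equilibrium[OF gen x eq s] by (simp add: trajectory_eq)
    show ?thesis unfolding trajectory_eq 1 by (simp only: add.assoc[symmetric] 2)
  qed
  let ?M = "lebesgue_on {0..t}"
  define W where "W = (\<integral>s. norm (dv s) \<partial>?M)"
  have dv_int: "integrable ?M (\<lambda>s. norm (dv s))" using t by (intro control_integrable_norm dv) simp
  define I where "I = integral\<^sup>L ?M (running x v)"
  have I_int: "integrable ?M (running x v)" by (rule has_cost_shift(1)[OF c(1)]) (use t in simp)
  define K where "K s = exp (- lam * t) * S (t - s) (B (dv s)) q" for s
  have K_bi: "has_bochner_integral ?M K (exp (- lam * t) * conv dv t q)"
    unfolding K_def[abs_def] using t by (intro has_bochner_integral_mult_right conv_apply dv) simp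
  \<comment> \<open>The term C1 t |dv s| is reserved out of the quadratic gain: integrated over
    [0, t] it cancels the constant loss C1 W exactly.\<close>
  define lo where "lo s = exp (- lam * s) * (g0 x + r) + (C1 * t * norm (dv s) - (C1 * W + (e * N)\<^sup>2 / (4 * \<kappa>)))" for s
  have exp_bi: "has_bochner_integral ?M (\<lambda>s. exp (- lam * s)) ((1 - exp (- lam * t)) / lam)"
  proof -
    have i: "integrable (lebesgue_on {0..t}) (\<lambda>s. exp (- lam * s))" "integrable (lebesgue_on {t..}) (\<lambda>s. exp (- lam * s))"
      by (rule integrable_lebesgue_on_subset[OF exp_integrable]; use t in auto)+
    have "{0..t} \<union> {t..} = {0..}" "{0..t} \<inter> {t..} = {t}" using t by auto
    then have "has_bochner_integral (lebesgue_on {0..}) (\<lambda>s. exp (- lam * s))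
        (integral\<^sup>L ?M (\<lambda>s. exp (- lam * s)) + exp (- lam * t) / lam)"
      using has_bochner_integral_lebesgue_on_Un[of "{0..t}" "{t..}", OF _ _ _
          has_bochner_integral_integrable[OF i(1)] has_bochner_integral_exp_atLeast[OF lam_pos]] by simp
    from has_bochner_integral_eq[OF this has_bochner_integral_exp_atLeast[OF lam_pos, of 0]]
    have "integral\<^sup>L ?M (\<lambda>s. exp (- lam * s)) = (1 - exp (- lam * t)) / lam"
      by (simp add: diff_divide_distrib)
    then show ?thesis using i(1) by (simp add: has_bochner_integral_iff)
  qed
  have lo_bi: "has_bochner_integral ?M lo
      ((1 - exp (- lam * t)) / lam * (g0 x + r) + (C1 * t * W - t * (C1 * W + (e * N)\<^sup>2 / (4 * \<kappa>))))"
  proof -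
    have "has_bochner_integral ?M (\<lambda>s. C1 * W + (e * N)\<^sup>2 / (4 * \<kappa>)) (t * (C1 * W + (e * N)\<^sup>2 / (4 * \<kappa>)))"
      using t by (simp add: has_bochner_integral_iff measure_restrict_space)
    moreover have "has_bochner_integral ?M (\<lambda>s. norm (dv s)) W"
      unfolding W_def by (rule has_bochner_integral_integrable[OF dv_int])
    ultimately show ?thesis
      unfolding lo_def[abs_def]
      by (intro has_bochner_integral_add has_bochner_integral_diff has_bochner_integral_mult_left
          has_bochner_integral_mult_right exp_bi)
  qed
  have W0: "0 \<le> W" unfolding W_def by simp
  have conv_le: "\<bar>conv dv s (g' x)\<bar> \<le> C1 * W" if s: "s \<in> {0..t}" for s
  proof -
    have "\<bar>conv dv s (g' x)\<bar> \<le> norm (conv dv s) * norm (g' x)"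
      using norm_blinfun[of "conv dv s" "g' x"] by simp
    also have "\<dots> \<le> (exp (\<omega> * s) * norm B * (\<integral>r. norm (dv r) \<partial>lebesgue_on {0..s})) * norm (g' x)"
      using s by (intro mult_right_mono norm_conv_le dv) auto
    also have "\<dots> \<le> (exp \<omega> * norm B * W) * norm (g' x)"
    proof (intro mult_right_mono mult_mono)
      have "\<omega> * s \<le> \<omega> * 1" using s t omega_nonneg by (intro mult_left_mono) auto
      then show "exp (\<omega> * s) \<le> exp \<omega>" by simp
      show "(\<integral>r. norm (dv r) \<partial>lebesgue_on {0..s}) \<le> W"
      proof -
        have i: "integrable (lebesgue_on {0..s}) (\<lambda>r. norm (dv r))" using s by (intro control_integrable_norm dv) simp
        have "(\<integral>r. norm (dv r) \<partial>lebesgue_on {0..s}) = integral {0..s} (\<lambda>r. norm (dv r))"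
          using i by (rule lebesgue_integral_eq_integral) simp
        also have "\<dots> \<le> integral {0..t} (\<lambda>r. norm (dv r))"
          using s i dv_int by (intro integral_subset_le) (auto simp: integrable_on_lebesgue_on)
        also have "\<dots> = W" unfolding W_def
          using dv_int by (rule lebesgue_integral_eq_integral[symmetric]) simp
        finally show ?thesis .
      qed
    qed (use W0 in auto)
    finally show ?thesis by (simp add: C1_def mult_ac)
  qed
  \<comment> \<open>Replacing S (t - s) by the identity costs e by strong continuity of the adjoint
    at q, and replacing the discount at t by that at s costs lam * t. Both errors are linear in the
    deviation.\<close>
  have K_ge: "- \<eta> * norm (dv s) \<le> K s - exp (- lam * s) * B (dv s) q" if s: "s \<in> {0..t}" for s
  proof -
    let ?\<phi> = "B (dv s)"
    have phi: "norm ?\<phi> \<le> norm B * norm (dv s)" by (rule norm_blinfun)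
    have "\<bar>exp (- lam * t) * (S (t - s) ?\<phi> q - ?\<phi> q)\<bar> \<le> 1 * (e * norm ?\<phi>)"
      unfolding abs_mult using s t lam_pos by (intro mult_mono d) auto
    moreover have "\<bar>(exp (- lam * t) - exp (- lam * s)) * ?\<phi> q\<bar> \<le> (lam * t) * (norm ?\<phi> * norm q)"
      unfolding abs_mult
    proof (rule mult_mono)
      have "1 + (- lam * t + lam * s) \<le> exp (- lam * t + lam * s)" by (rule exp_ge_add_one_self)
      then have "exp (- lam * s) * (1 + (- lam * t + lam * s)) \<le> exp (- lam * s) * exp (- lam * t + lam * s)"
        by (rule mult_left_mono) simp
      also have "\<dots> = exp (- lam * t)" by (simp flip: exp_add)
      finally have "exp (- lam * s) - exp (- lam * t) \<le> exp (- lam * s) * (lam * (t - s))"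
        by (simp add: algebra_simps)
      also have "\<dots> \<le> 1 * (lam * t)"
        using s lam_pos by (intro mult_mono) auto
      finally show "\<bar>exp (- lam * t) - exp (- lam * s)\<bar> \<le> lam * t"
        using s lam_pos by simp
      show "\<bar>?\<phi> q\<bar> \<le> norm ?\<phi> * norm q" using norm_blinfun[of ?\<phi> q] by simp
    qed (use lam_pos t in auto)
    ultimately have "- (e * norm ?\<phi> + lam * t * (norm ?\<phi> * norm q)) \<le>
        exp (- lam * t) * (S (t - s) ?\<phi> q - ?\<phi> q) + (exp (- lam * t) - exp (- lam * s)) * ?\<phi> q"
      by linarith
    also have "\<dots> = K s - exp (- lam * s) * ?\<phi> q" by (simp add: K_def algebra_simps)
    finally have "- ((e + lam * t * norm q) * norm ?\<phi>) \<le> K s - exp (- lam * s) * ?\<phi> q"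
      by (simp add: algebra_simps)
    moreover have "(e + lam * t * norm q) * norm ?\<phi> \<le> (e + lam * t * norm q) * (norm B * norm (dv s))"
      using e lam_pos t by (intro mult_left_mono phi) simp
    moreover have "(e + lam * t * norm q) * (norm B * norm (dv s)) = \<eta> * norm (dv s)"
      by (simp add: \<eta>_def algebra_simps)
    ultimately show ?thesis by linarith
  qed
  \<comment> \<open>Completing the square absorbs the linear errors and leaves a constant of order
    e^2, whatever the size of the deviation.\<close>
  have square: "- \<eta> * y + \<kappa> * y\<^sup>2 \<ge> C1 * t * y - (e * N)\<^sup>2 / (4 * \<kappa>)" for y
  proof -
    let ?b = "\<eta> + C1 * t"
    have "0 \<le> (2 * \<kappa> * y - ?b)\<^sup>2 / (4 * \<kappa>)" using kappa by simp
    also have "\<dots> = \<kappa> * y\<^sup>2 - ?b * y + ?b\<^sup>2 / (4 * \<kappa>)"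
      using kappa by (simp add: power2_diff field_simps power2_eq_square)
    finally have "?b * y - ?b\<^sup>2 / (4 * \<kappa>) \<le> \<kappa> * y\<^sup>2" by simp
    moreover have "?b\<^sup>2 / (4 * \<kappa>) \<le> (e * N)\<^sup>2 / (4 * \<kappa>)"
      using eta eta0 kappa by (intro divide_right_mono power_mono) auto
    ultimately show ?thesis by (simp add: distrib_right)
  qed
  have run_ge: "AE s in ?M. lo s \<le> running x v s + K s"
  proof -
    have "AE s in ?M. h0 (v s) \<noteq> \<infinity>"
      using fin t by (simp add: AE_restrict_space_iff) (auto elim: eventually_mono)
    then show ?thesis using AE_space
    proof eventually_elim
      case (elim s)
      then have s: "s \<in> {0..t}" by simp
      let ?k = "- adjoint_to_dual B q"
      have "r = inner ?k w - hstar ?k" using r h0_gradient[of ?k] w by simp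
      moreover have "inner ?k (v s) - hstar ?k + modulus * (norm (v s - w))\<^sup>2 \<le> real_of_ereal (h0 (v s))"
        using h0_strongly_convex[of ?k "v s"] elim(1) h0_proper[of "v s"] w by (cases "h0 (v s)") auto
      moreover have "inner ?k (v s) - inner ?k w = - B (dv s) q"
        by (simp add: dv_def adjoint_to_dual_apply blinfun.diff_right blinfun.diff_left)
      ultimately have h: "r - B (dv s) q + modulus * (norm (dv s))\<^sup>2 \<le> real_of_ereal (h0 (v s))"
        by (simp add: dv_def)
      have "g0 x + conv dv s (g' x) \<le> g0 (traj x v s)"
        using g0_ge[of x "conv dv s"] traj_dv[of s] s by simp
      with h have "exp (- lam * s) * ((g0 x + r) + conv dv s (g' x) - B (dv s) q + modulus * (norm (dv s))\<^sup>2) \<le> running x v s"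
        unfolding running_def by (intro mult_left_mono) auto
      then have 1: "exp (- lam * s) * (g0 x + r) + exp (- lam * s) * conv dv s (g' x) - exp (- lam * s) * B (dv s) q
          + exp (- lam * s) * (modulus * (norm (dv s))\<^sup>2) \<le> running x v s"
        by (simp add: distrib_left right_diff_distrib)
      have "exp (- lam * s) * \<bar>conv dv s (g' x)\<bar> \<le> 1 * (C1 * W)"
        using s lam_pos conv_le[OF s] by (intro mult_mono) auto
      then have "\<bar>exp (- lam * s) * conv dv s (g' x)\<bar> \<le> C1 * W" by (simp add: abs_mult)
      then have 2: "- (C1 * W) \<le> exp (- lam * s) * conv dv s (g' x)" by linarith
      have "exp (- lam) \<le> exp (- lam * s)" using s t lam_pos by simp
      then have 3: "\<kappa> * (norm (dv s))\<^sup>2 \<le> exp (- lam * s) * (modulus * (norm (dv s))\<^sup>2)"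
        using modulus_pos by (simp add: \<kappa>_def mult.assoc mult_right_mono)
      show ?case
        using 1 2 3 K_ge[OF s] square[of "norm (dv s)"] unfolding lo_def by linarith
    qed
  qed
  have "(1 - E) / lam * y + (C1 * t * W - t * (C1 * W + z)) = (1 - E) * (y / lam) - t * z" for E y z
    by (simp add: algebra_simps)
  then have "(1 - exp (- lam * t)) * ((g0 x + r) / lam) - t * ((e * N)\<^sup>2 / (4 * \<kappa>)) = integral\<^sup>L ?M lo"
    using has_bochner_integral_integral_eq[OF lo_bi] by (simp only:)
  also have "\<dots> \<le> (\<integral>s. running x v s + K s \<partial>?M)"
    using lo_bi K_bi I_int run_ge by (intro integral_mono_AE) (auto simp: has_bochner_integral_iff)
  also have "\<dots> = I + exp (- lam * t) * conv dv t q"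
    using K_bi I_int by (simp add: I_def has_bochner_integral_iff)
  finally have A: "(1 - exp (- lam * t)) * ((g0 x + r) / lam) - t * ((e * N)\<^sup>2 / (4 * \<kappa>)) \<le> I + exp (- lam * t) * conv dv t q" .
  \<comment> \<open>The affine minorant is evaluated at the state reached at time t, for the tail of
    the control.\<close>
  have "\<Psi> x + (traj x v t - x) q \<le> exp (lam * t) * (c - I)"
    unfolding I_def by (rule val[OF has_cost_shift(2)[OF c(1)]]) (use t in simp)
  then have "exp (- lam * t) * (\<Psi> x + conv dv t q) \<le> exp (- lam * t) * (exp (lam * t) * (c - I))"
    using traj_dv[of t] t by (intro mult_left_mono) auto
  also have "\<dots> = c - I" by (simp add: exp_minus field_simps)
  finally have "I + exp (- lam * t) * conv dv t q \<le> c - exp (- lam * t) * \<Psi> x" by (simp add: distrib_left)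
  moreover have "(1 - E) * (y - z) = (1 - E) * y - z + E * z" for E y z :: real
    by (simp add: algebra_simps)
  ultimately have "(1 - exp (- lam * t)) * gap \<le> e * t + t * ((e * N)\<^sup>2 / (4 * \<kappa>))"
    using A c(2) unfolding gap_def by (simp only:)
  also have "\<dots> \<le> t * e * M"
  proof -
    have "e\<^sup>2 \<le> e" using e by (simp add: power2_eq_square mult_left_le_one_le)
    then have "(e * N)\<^sup>2 / (4 * \<kappa>) \<le> e * (N\<^sup>2 / (4 * \<kappa>))"
      using kappa by (simp add: power_mult_distrib divide_right_mono mult_right_mono)
    then have "t * ((e * N)\<^sup>2 / (4 * \<kappa>)) \<le> t * (e * (N\<^sup>2 / (4 * \<kappa>)))"
      by (rule mult_left_mono) (use t in simp)
    moreover have "t * e * (1 + y) = e * t + t * (e * y)" for y by (simp add: algebra_simps)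
    ultimately show ?thesis unfolding M_def by (simp only: add_left_mono)
  qed
  finally have up: "(1 - exp (- lam * t)) * gap \<le> t * e * M" .
  \<comment> \<open>Makes 1 - exp (- lam * t) at least of order t, so that t cancels against the
    error bound.\<close>
  have "1 + lam * t \<le> exp (lam * t)" by (rule exp_ge_add_one_self)
  then have "exp (- lam * t) * (1 + lam * t) \<le> exp (- lam * t) * exp (lam * t)" by (rule mult_left_mono) simp
  then have "exp (- lam * t) * (lam * t) \<le> 1 - exp (- lam * t)"
    by (simp add: distrib_left flip: exp_add)
  moreover have "exp (- lam) * (lam * t) \<le> exp (- lam * t) * (lam * t)"
    using t lam_pos by (intro mult_right_mono) auto
  ultimately have "(exp (- lam) * (lam * t)) * gap \<le> (1 - exp (- lam * t)) * gap"
    using gap by (intro mult_right_mono) auto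
  with up have "t * (lam * exp (- lam) * gap) \<le> t * (e * M)" by (simp add: mult_ac)
  then have "lam * exp (- lam) * gap \<le> e * M" using t by simp
  also have "\<dots> \<le> (lam * exp (- lam) * gap / (2 * M)) * M"
    using M by (intro mult_right_mono) (auto simp: e_def)
  also have "\<dots> = lam * exp (- lam) * gap / 2" using M by simp
  finally show False using gap lam_pos by simp
qed

end

section \<open>The equilibrium of the closed loop\<close>

text \<open>Applied to \<phi> and -\<phi>, the bound makes a linear functional its own remainder of
  order above 1 at 0, so it has derivative 0 there and vanishes.\<close>

lemma affine_bound_imp_derivative_eq:
  fixes p q :: "'v::{real_inner, complete_space}"
  assumes th: "0 < \<theta>" and le: "\<And>\<phi> :: 'v \<Rightarrow>\<^sub>L real. blinfun_apply \<phi> p - blinfun_apply \<phi> q \<le> C * norm \<phi> powr (1 + \<theta>)"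
  shows "p = q"
proof (rule dual_eqI)
  fix \<phi> :: "'v \<Rightarrow>\<^sub>L real"
  let ?F = "\<lambda>\<phi> :: 'v \<Rightarrow>\<^sub>L real. blinfun_apply \<phi> (p - q)"
  have "\<bar>?F \<phi>\<bar> \<le> C * norm \<phi> powr (1 + \<theta>)" for \<phi>
    using le[of \<phi>] le[of "- \<phi>"] by (simp add: blinfun.diff_right blinfun.minus_left abs_le_iff)
  then have "(?F has_derivative (\<lambda>_. 0)) (at 0)"
    by (intro has_derivative_of_powr_remainder[OF bounded_linear_zero th]) simp
  moreover have "(?F has_derivative ?F) (at 0)"
    by (rule bounded_linear_imp_has_derivative[OF blinfun.bounded_linear_left])
  ultimately have "?F = (\<lambda>_. 0)" by (rule has_derivative_unique[rotated])
  from fun_cong[OF this, of \<phi>] show "blinfun_apply \<phi> p = blinfun_apply \<phi> q"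
    by (simp add: blinfun.diff_right)
qed

locale equilibrium_problem = control_problem S B \<omega> lam h0 hstar g0 a b p \<theta> Cg
  for S :: "real \<Rightarrow> ('v::{real_inner, complete_space} \<Rightarrow>\<^sub>L real) \<Rightarrow>\<^sub>L ('v \<Rightarrow>\<^sub>L real)"
    and B :: "'u::{real_inner, complete_space} \<Rightarrow>\<^sub>L ('v \<Rightarrow>\<^sub>L real)"
    and \<omega> lam :: real and h0 :: "'u \<Rightarrow> ereal" and hstar :: "'u \<Rightarrow> real"
    and g0 :: "('v \<Rightarrow>\<^sub>L real) \<Rightarrow> real" and a b p \<theta> Cg :: real +
  fixes D :: "('v \<Rightarrow>\<^sub>L real) set" and A :: "('v \<Rightarrow>\<^sub>L real) \<Rightarrow> ('v \<Rightarrow>\<^sub>L real)" and xs :: "'v \<Rightarrow>\<^sub>L real"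
  assumes gen: "is_generator D A S" and xs_in_D: "xs \<in> D"
    and xs_stationary: "A xs + B (gradient hstar (- adjoint_to_dual B (resolvent_adj (g' xs)))) = 0"
begin

abbreviation ks :: 'u where "ks \<equiv> - adjoint_to_dual B (resolvent_adj (g' xs))"
abbreviation ws :: 'u where "ws \<equiv> gradient hstar ks"
text \<open>The cost of resting at \<open>xs\<close> under the constant control; it turns out to be
  the value there.\<close>

definition cs :: real where "cs = (g0 xs + (inner ks ws - hstar ks)) / lam"

lemma minorant: "has_cost z v c \<Longrightarrow> cs + (z - xs) (resolvent_adj (g' xs)) \<le> c"
  unfolding cs_def by (rule costate_minorant[OF gen xs_in_D xs_stationary refl h0_gradient])

lemma cost_finite: "\<exists>v c. has_cost z v c"
proof -
  obtain c where "has_cost (xs + (z - xs)) (\<lambda>_. ws) c"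
    by (rule stationary_cost[OF gen xs_in_D xs_stationary h0_gradient])
  then show ?thesis by auto
qed

lemma value_le_cost: "has_cost z v c \<Longrightarrow> \<Psi> z \<le> c"
  by (rule value_le[OF minorant])

lemma value_minorant: "cs + (z - xs) (resolvent_adj (g' xs)) \<le> \<Psi> z"
proof -
  obtain v c where "has_cost z v c" using cost_finite by blast
  show ?thesis by (rule value_ge[OF _ \<open>has_cost z v c\<close>]) (rule minorant)
qed

lemma near_optimal:
  assumes "0 < e"
  shows "\<exists>v c. has_cost z v c \<and> c < \<Psi> z + e"
proof -
  obtain v0 c0 where c: "has_cost z v0 c0" using cost_finite by blast
  show ?thesis by (rule value_approx[OF _ c assms], rule minorant, assumption, blast)
qed

lemma value_stationary_le:
  assumes "x \<in> D" "A x + B w = 0" "h0 w = ereal r"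
  shows "\<Psi> (x + h) \<le> (g0 x + r) / lam + blinfun_apply h (resolvent_adj (g' x)) + semi * norm h powr (1 + \<theta>)"
proof -
  obtain c where "has_cost (x + h) (\<lambda>_. w) c"
    "c \<le> (g0 x + r) / lam + h (resolvent_adj (g' x)) + semi * norm h powr (1 + \<theta>)"
    by (rule stationary_cost[OF gen assms])
  then show ?thesis using value_le_cost by force
qed

lemma predual_gradient_equilibrium: "predual_gradient \<Psi> xs = resolvent_adj (g' xs)"
proof -
  have up: "\<Psi> (xs + h) \<le> cs + blinfun_apply h (resolvent_adj (g' xs)) + semi * norm h powr (1 + \<theta>)" for h
    unfolding cs_def by (rule value_stationary_le[OF xs_in_D xs_stationary h0_gradient])
  have lo: "cs + blinfun_apply h (resolvent_adj (g' xs)) \<le> \<Psi> (xs + h)" for h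
    using value_minorant[of "xs + h"] by simp
  have at: "\<Psi> xs = cs" using up[of 0] lo[of 0] by simp
  have "(\<Psi> has_derivative (\<lambda>\<phi>. blinfun_apply \<phi> (resolvent_adj (g' xs)))) (at xs)"
  proof (rule has_derivative_of_powr_remainder[OF blinfun.bounded_linear_left theta])
    show "\<bar>\<Psi> (xs + h) - \<Psi> xs - blinfun_apply h (resolvent_adj (g' xs))\<bar> \<le> semi * norm h powr (1 + \<theta>)" for h
      using up[of h] lo[of h] at by (simp add: abs_le_iff)
  qed
  then show ?thesis by (rule predual_gradient_eqI)
qed

lemma value_convex: "convex_on UNIV \<Psi>"
proof (rule convex_onI)
  fix s :: real and x y assume s: "0 < s" "s < 1"
  show "\<Psi> ((1 - s) *\<^sub>R x + s *\<^sub>R y) \<le> (1 - s) * \<Psi> x + s * \<Psi> y"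
  proof (rule field_le_epsilon)
    fix e :: real assume e: "0 < e"
    obtain v1 c1 v2 c2 where 1: "has_cost x v1 c1" "c1 < \<Psi> x + e" and 2: "has_cost y v2 c2" "c2 < \<Psi> y + e"
      using near_optimal[OF e] by metis
    obtain v c where c: "has_cost ((1 - s) *\<^sub>R x + s *\<^sub>R y) v c" "c \<le> (1 - s) * c1 + s * c2"
      using has_cost_convex[OF 1(1) 2(1), of s] s by (metis less_imp_le)
    have "(1 - s) * c1 + s * c2 \<le> (1 - s) * (\<Psi> x + e) + s * (\<Psi> y + e)"
      using 1(2) 2(2) s by (intro add_mono mult_left_mono) auto
    also have "\<dots> = (1 - s) * \<Psi> x + s * \<Psi> y + e" by (simp add: algebra_simps)
    finally show "\<Psi> ((1 - s) *\<^sub>R x + s *\<^sub>R y) \<le> (1 - s) * \<Psi> x + s * \<Psi> y + e"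
      using value_le_cost[OF c(1)] c(2) by simp
  qed
qed simp

lemma value_semiconcave:
  "\<Psi> (x + h) + \<Psi> (x - h) - 2 * \<Psi> x \<le> (2 * semi) * norm h powr (1 + \<theta>)"
proof -
  have "\<Psi> (x + h) + \<Psi> (x - h) \<le> 2 * \<Psi> x + (2 * semi) * norm h powr (1 + \<theta>)"
  proof (rule field_le_epsilon)
    fix e :: real assume "0 < e"
    then obtain v c where c: "has_cost x v c" "c < \<Psi> x + e / 2"
      using near_optimal by (meson half_gt_zero)
    obtain c1 c2 where "has_cost (x + h) v c1" "has_cost (x - h) v c2"
      "c1 + c2 - 2 * c \<le> 2 * semi * norm h powr (1 + \<theta>)"
      by (rule has_cost_perturb[OF c(1)])
    then show "\<Psi> (x + h) + \<Psi> (x - h) \<le> 2 * \<Psi> x + (2 * semi) * norm h powr (1 + \<theta>) + e"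
      using value_le_cost[of "x + h" v c1] value_le_cost[of "x - h" v c2] c(2) by simp
  qed
  then show ?thesis by simp
qed

lemma value_has_predual_gradient:
  "(\<Psi> has_derivative (\<lambda>\<phi>. blinfun_apply \<phi> (predual_gradient \<Psi> x))) (at x)"
proof -
  let ?p = "resolvent_adj (g' xs)"
  have below: "cs - (norm (x - xs) + 1) * norm ?p \<le> \<Psi> (x + h)" if h: "norm h \<le> 1" for h
  proof -
    have "norm (x + h - xs) \<le> norm (x - xs) + norm h"
      using norm_triangle_ineq[of "x - xs" h] by (simp add: algebra_simps)
    then have "norm (x + h - xs) * norm ?p \<le> (norm (x - xs) + 1) * norm ?p"
      using h by (intro mult_right_mono) auto
    moreover have "\<bar>(x + h - xs) ?p\<bar> \<le> norm (x + h - xs) * norm ?p"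
      using norm_blinfun[of "x + h - xs" ?p] by simp
    ultimately show ?thesis using value_minorant[of "x + h"] by linarith
  qed
  obtain F where "(\<Psi> has_derivative F) (at x)"
    using convex_semiconcave_differentiable[OF value_convex theta _ value_semiconcave below] semi_nonneg
    by auto
  then show ?thesis by (rule has_predual_gradient(2))
qed

lemma predual_gradient_stationary:
  assumes x: "x \<in> D" and eq: "A x + B (gradient hstar (- adjoint_to_dual B (predual_gradient \<Psi> x))) = 0"
  shows "predual_gradient \<Psi> x = resolvent_adj (g' x)"
proof -
  let ?q = "predual_gradient \<Psi> x"
  let ?k = "- adjoint_to_dual B ?q"
  let ?w = "gradient hstar ?k"
  define r where "r = inner ?k ?w - hstar ?k"
  have r: "h0 ?w = ereal r" unfolding r_def by (rule h0_gradient)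
  have tangent: "\<Psi> x + blinfun_apply h ?q \<le> \<Psi> (x + h)" for h
    by (rule convex_above_tangent[OF value_convex value_has_predual_gradient])
  have "\<Psi> x + (z - x) ?q \<le> c" if "has_cost z v c" for z v c
    using tangent[of "z - x"] value_le_cost[OF that] by simp
  then have opt: "(g0 x + r) / lam \<le> \<Psi> x"
    using near_optimal by (intro dynamic_programming_estimate[OF gen x eq refl r])
  \<comment> \<open>The tangent of \<Psi> with slope q lies below, the cost of the constant control
    above, and by \<open>opt\<close> the constant terms do not separate them.\<close>
  have "blinfun_apply h ?q - blinfun_apply h (resolvent_adj (g' x)) \<le> semi * norm h powr (1 + \<theta>)" for h
    using tangent[of h] value_stationary_le[OF x eq r, of h] opt by simp
  then show ?thesis by (rule affine_bound_imp_derivative_eq[OF theta])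
qed

end

theorem lemma4p2:
  fixes D0 :: "'h::{real_inner, complete_space} set"
    and A0 :: "'h \<Rightarrow> 'h"
    and S0 :: "real \<Rightarrow> 'h \<Rightarrow>\<^sub>L 'h"
    and J :: "'v::{real_inner, complete_space} \<Rightarrow> 'h"
    and D :: "('v \<Rightarrow>\<^sub>L real) set"
    and A :: "('v \<Rightarrow>\<^sub>L real) \<Rightarrow> ('v \<Rightarrow>\<^sub>L real)"
    and S :: "real \<Rightarrow> ('v \<Rightarrow>\<^sub>L real) \<Rightarrow>\<^sub>L ('v \<Rightarrow>\<^sub>L real)"
    and B :: "'u::{real_inner, complete_space} \<Rightarrow>\<^sub>L ('v \<Rightarrow>\<^sub>L real)"
    and g0 :: "('v \<Rightarrow>\<^sub>L real) \<Rightarrow> real"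
    and h0 :: "'u \<Rightarrow> ereal"
    and hstar :: "'u \<Rightarrow> real"
    and lam \<omega> a b p :: real
  assumes "C0_semigroup S0" and "is_generator D0 A0 S0"
    and "represents_dom J (adj_dom D0 A0) (adj_op D0 A0)"
    and "C0_semigroup S" and "is_generator D A S"
    and "\<And>t x. 0 \<le> t \<Longrightarrow> S t (embed_dual J x) = embed_dual J (S0 t x)"
    and "0 \<le> \<omega>" and "\<And>t x. 0 \<le> t \<Longrightarrow> norm (S t x) \<le> exp (\<omega> * t) * norm x"
    and "g0 \<in> Sigma0"
    and "\<And>u. h0 u \<noteq> - \<infinity>" and "ereal_convex h0" and "lower_semicontinuous h0"
    and "multi_injective (subdifferential h0)"
    and "\<And>q. convex_conjugate h0 q = ereal (hstar q)"
    and "hstar 0 = 0" and "hstar \<in> Sigma0"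
    and "0 < a" and "2 \<le> p" and "\<And>u. h0 u \<ge> ereal (a * norm u powr p + b)"
    and "(2 < p \<and> lam > 2 * \<omega>) \<or> (lam > \<omega> \<and> g0 \<in> growth_class 1)"
    and "0 \<in> resolvent_set (adj_dom D0 A0) (adj_op D0 A0)"
    and "ennreal (lam - \<omega>) >
           ennreal (onorm (inv_into (adj_dom D0 A0) (adj_op D0 A0))) * ennreal ((norm B)\<^sup>2) *
           lip_const (gradient hstar) * lip_const (predual_gradient g0)"
  shows "\<exists>!x. x \<in> D \<and>
           A x + B (gradient hstar
             (- adjoint_to_dual B (predual_gradient (value_function S B g0 h0 lam p) x))) = 0"
proof -
  interpret E: extrapolated_semigroup D0 A0 S0 J D A S
    by unfold_locales (fact assms)+
  have alt: "lam > 2 * \<omega> \<or> (lam > \<omega> \<and> g0 \<in> growth_class 1)" using assms(20) by auto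
  obtain \<theta> Cg where rem: "0 < \<theta>" "0 \<le> Cg" "(1 + \<theta>) * \<omega> < lam"
    "\<And>x h. g0 (x + h) \<le> g0 x + frechet g0 x h + Cg * norm h powr (1 + \<theta>)"
    by (rule Sigma0_holder_remainder[OF assms(9) assms(7) alt]) blast
  have lam_gt: "\<omega> < lam" using alt assms(7) by auto
  have P: "control_problem S \<omega> lam h0 hstar g0 a b p \<theta> Cg"
    by unfold_locales
      (fact assms(4), fact assms(7), fact assms(8), fact lam_gt, fact assms(10), fact assms(12),
        fact assms(14), fact assms(16), fact assms(9), fact rem(1), fact rem(2), fact rem(3),
        rule rem(4), fact assms(11), fact assms(17), fact assms(18), fact assms(19))
  interpret P: control_problem S B \<omega> lam h0 hstar g0 a b p \<theta> Cg by (rule P)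
  define feedback where "feedback x = gradient hstar (- adjoint_to_dual B (P.resolvent_adj (P.g' x)))" for x
  \<comment> \<open>The inverse of A is taken by choice: surjectivity provides a value, and
    injectivity makes fixed points equivalent to the stationary equation.\<close>
  define fix_map where "fix_map x = (SOME z. z \<in> D \<and> A z = - B (feedback x))" for x
  have fix_map: "fix_map x \<in> D \<and> A (fix_map x) = - B (feedback x)" for x
  proof -
    have "\<exists>z. z \<in> D \<and> A z = - B (feedback x)" using E.A_surj[of "- B (feedback x)"] by blast
    then show ?thesis unfolding fix_map_def by (rule someI_ex)
  qed
  have fix_iff: "fix_map x = x \<longleftrightarrow> x \<in> D \<and> A x + B (feedback x) = 0" for x
  proof
    assume "fix_map x = x"
    then show "x \<in> D \<and> A x + B (feedback x) = 0" using fix_map[of x] by simp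
  next
    assume x: "x \<in> D \<and> A x + B (feedback x) = 0"
    then have "A x = - B (feedback x)" by (simp add: eq_neg_iff_add_eq_0)
    then have "A (fix_map x) = A x" using fix_map[of x] by simp
    then show "fix_map x = x" using E.A_eq_iff[of "fix_map x" x] fix_map[of x] x by simp
  qed
  define N where "N = onorm E.inv_adj"
  define Lh where "Lh = enn2real (lip_const (gradient hstar))"
  define Lg where "Lg = enn2real (lip_const (predual_gradient g0))"
  have N: "0 \<le> N" unfolding N_def by (rule onorm_pos_le[OF E.bounded_linear_inv_adj])
  have Lh: "0 \<le> Lh" "lip_const (gradient hstar) = ennreal Lh"
    using Sigma0_lip_gradient[OF assms(16)] by (simp_all add: Lh_def)
  have Lg: "0 \<le> Lg" "lip_const (predual_gradient g0) = ennreal Lg"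
    using Sigma0_lip_predual_gradient[OF assms(9)] by (simp_all add: Lg_def)
  \<comment> \<open>Both Lipschitz constants are finite by membership in \<open>Sigma0\<close>, so
    the extended inequality descends to the reals.\<close>
  have "ennreal (N * (norm B)\<^sup>2 * Lh * Lg) < ennreal (lam - \<omega>)"
    using assms(22) N Lh(1) Lg(1) unfolding Lh(2) Lg(2) N_def[symmetric] by (simp add: ennreal_mult)
  then have small: "N * (norm B)\<^sup>2 * Lh * Lg < lam - \<omega>"
    using N Lh(1) Lg(1) by (simp add: ennreal_less_iff)
  define q where "q = N * (norm B)\<^sup>2 * Lh * Lg / (lam - \<omega>)"
  have q: "0 \<le> q" "q < 1"
    using small P.lam_gt N Lh(1) Lg(1) by (simp_all add: q_def)
  have "dist (fix_map x) (fix_map y) \<le> q * dist x y" for x y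
  proof -
    let ?R = "\<lambda>x. P.resolvent_adj (P.g' x)"
    let ?k = "\<lambda>x. - adjoint_to_dual B (?R x)"
    have "norm (P.g' x - P.g' y) \<le> Lg * norm (x - y)"
      unfolding P.g'_def Lg_def by (rule lip_const_bound[OF Sigma0_lip_predual_gradient[OF assms(9)]])
    then have "norm (?R x - ?R y) \<le> Lg * norm (x - y) / (lam - \<omega>)"
      using P.lam_gt by (intro order_trans[OF P.norm_resolvent_adj_diff_le] divide_right_mono) auto
    moreover have "norm (?k x - ?k y) \<le> norm B * norm (?R x - ?R y)"
      using norm_adjoint_to_dual_diff_le[of B "?R x" "?R y"] by (simp add: norm_minus_commute)
    ultimately have "norm (?k x - ?k y) \<le> norm B * (Lg * norm (x - y) / (lam - \<omega>))"
      using mult_left_mono[OF _ norm_ge_zero[of B], of "norm (?R x - ?R y)" "Lg * norm (x - y) / (lam - \<omega>)"] by linarith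
    then have "Lh * norm (?k x - ?k y) \<le> Lh * (norm B * (Lg * norm (x - y) / (lam - \<omega>)))"
      using Lh(1) by (rule mult_left_mono)
    moreover have "norm (feedback x - feedback y) \<le> Lh * norm (?k x - ?k y)"
      unfolding feedback_def Lh_def by (rule lip_const_bound[OF Sigma0_lip_gradient[OF assms(16)]])
    ultimately have "norm (feedback x - feedback y) \<le> Lh * (norm B * (Lg * norm (x - y) / (lam - \<omega>)))"
      by linarith
    then have B: "norm (B (feedback y - feedback x)) \<le> norm B * (Lh * (norm B * (Lg * norm (x - y) / (lam - \<omega>))))"
      by (intro order_trans[OF norm_blinfun] mult_left_mono) (simp_all add: norm_minus_commute)
    have "norm (fix_map x - fix_map y) \<le> N * norm (A (fix_map x) - A (fix_map y))"
      unfolding N_def by (rule E.norm_diff_le_A) (use fix_map in auto)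
    also have "A (fix_map x) - A (fix_map y) = B (feedback y - feedback x)"
      using fix_map by (simp add: blinfun.diff_right)
    also have "N * norm (B (feedback y - feedback x)) \<le> N * (norm B * (Lh * (norm B * (Lg * norm (x - y) / (lam - \<omega>)))))"
      by (rule mult_left_mono[OF B N])
    also have "\<dots> = q * norm (x - y)" by (simp add: q_def power2_eq_square)
    finally show ?thesis by (simp add: dist_norm)
  qed
  then have unique: "\<exists>!x. fix_map x = x" by (intro banach_fix_type[OF q]) blast
  then obtain xs where xs: "fix_map xs = xs" by blast
  \<comment> \<open>The locale is entered at the fixed point, but
    \<open>predual_gradient_stationary\<close> speaks of an arbitrary solution; this is what
    uniqueness uses.\<close>
  interpret Q: equilibrium_problem S B \<omega> lam h0 hstar g0 a b p \<theta> Cg D A xs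
    using xs assms(5) unfolding fix_iff feedback_def by unfold_locales auto
  have "x \<in> D \<and> A x + B (gradient hstar (- adjoint_to_dual B (predual_gradient P.\<Psi> x))) = 0 \<longleftrightarrow>
      fix_map x = x" for x
  proof
    assume x: "x \<in> D \<and> A x + B (gradient hstar (- adjoint_to_dual B (predual_gradient P.\<Psi> x))) = 0"
    then show "fix_map x = x"
      using Q.predual_gradient_stationary[of x] by (simp add: fix_iff feedback_def)
  next
    assume "fix_map x = x"
    then have "x = xs" using unique xs by blast
    then show "x \<in> D \<and> A x + B (gradient hstar (- adjoint_to_dual B (predual_gradient P.\<Psi> x))) = 0"
      using Q.predual_gradient_equilibrium Q.xs_in_D Q.xs_stationary by simp
  qed
  with unique show ?thesis by simp
qed

end
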